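(* Let $n\ge 3$ and let the viscosity tensor $\mathbb A$ satisfy the boundedness, symmetry and ellipticity conditions on $\mathbb R^n$ stated in the context. Then for each $\mathbf f\in\mathcal H^{-1}(\mathbb R^n)^n$ and $g\in L_2(\mathbb R^n)$ the anisotropic Stokes system $$\boldsymbol{\mathcal L}(\mathbf u,\pi)=\mathbf f,\qquad \mathrm{div}\,\mathbf u=g\quad\text{in }\mathbb R^n$$ is well-posed, which means that it has a unique solution $(\mathbf u,\pi)\in\mathcal H^1(\mathbb R^n)^n\times L_2(\mathbb R^n)$ and there exists a constant $C=C(c_{\mathbb A},n)>0$ such that $$\|\mathbf u\|_{\mathcal H^1(\mathbb R^n)^n}+\|\pi\|_{L_2(\mathbb R^n)}\le C\left(\|\mathbf f\|_{\mathcal H^{-1}(\mathbb R^n)^n}+\|g\|_{L_2(\mathbb R^n)}\right).$$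
   Context: The Einstein summation convention over repeated indices from $1$ to $n$ is used. For a vector field $\mathbf u$, $E_{j\beta}(\mathbf u)=\frac12(\partial_j u_\beta+\partial_\beta u_j)$. Viscosity tensor: $\mathbb A=(a_{ij}^{\alpha\beta})_{1\le i,j,\alpha,\beta\le n}$ consists of real-valued functions $a_{ij}^{\alpha\beta}\in L_\infty(\mathbb R^n)$ such that for almost every $x$: $a_{ij}^{\alpha\beta}(x)=a_{\alpha j}^{i\beta}(x)=a_{i\beta}^{\alpha j}(x)$ and, for some constant $c_{\mathbb A}>0$ independent of $x$, $a_{ij}^{\alpha\beta}(x)\xi_{i\alpha}\xi_{j\beta}\ge c_{\mathbb A}^{-1}|\boldsymbol\xi|^2$ for all symmetric $\boldsymbol\xi=(\xi_{i\alpha})\in\mathbb R^{n\times n}$ with $\sum_{i=1}^n\xi_{ii}=0$, where $|\boldsymbol\xi|^2=\xi_{i\alpha}\xi_{i\alpha}$. Stokes operator: $(\boldsymbol{\mathcal L}(\mathbf u,\pi))_i=\partial_\alpha\big(a_{ij}^{\alpha\beta}E_{j\beta}(\mathbf u)\big)-\partial_i\pi$, $i=1,\dots,n$, in the sense of distributions. Weighted spaces: $\rho(x)=(1+|x|^2)^{1/2}$; $\mathcal H^1(\mathbb R^n)=\{f\in\mathcal D'(\mathbb R^n):\rho^{-1}f\in L_2(\mathbb R^n),\ \nabla f\in L_2(\mathbb R^n)^n\}$ with $\|f\|^2_{\mathcal H^1(\mathbb R^n)}=\|\rho^{-1}f\|^2_{L_2(\mathbb R^n)}+\|\nabla f\|^2_{L_2(\mathbb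 R^n)^n}$; $\mathcal H^{-1}(\mathbb R^n)$ is its dual (a space of distributions, since $\mathcal D(\mathbb R^n)$ is dense in $\mathcal H^1(\mathbb R^n)$).
   Formalization: The constant C depends on c_A, n and also an L_∞ bound M of the coefficients; with c_A and n alone the estimate fails, since adding λδ_{iα}δ_{jβ} to the tensor keeps c_A but changes the pressure by λg. *)

theory Defs
  imports "HOL-Analysis.Analysis"
begin

definition partial_deriv :: "'n::finite \<Rightarrow> (real^'n \<Rightarrow> real) \<Rightarrow> real^'n \<Rightarrow> real" where
  "partial_deriv i f = (\<lambda>x. frechet_derivative f (at x) (axis i 1))"

(* The space D(R^n): a function is C^infinity iff all its iterated partial
   derivatives are (totally) differentiable everywhere. *)
definition test_functions :: "(real^'n::finite \<Rightarrow> real) set" where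
  "test_functions =
     {\<phi>. (\<forall>is. foldr partial_deriv is \<phi> differentiable_on UNIV) \<and>
          compact (closure {x. \<phi> x \<noteq> 0})}"

(* Distributions are represented by functionals on functions; only their values on
   test functions matter, so equality of distributions is dist_eq. *)
type_synonym 'n distr = "(real^'n \<Rightarrow> real) \<Rightarrow> real"

definition dist_eq :: "'n::finite distr \<Rightarrow> 'n distr \<Rightarrow> bool" where
  "dist_eq S T \<longleftrightarrow> (\<forall>\<phi>\<in>test_functions. S \<phi> = T \<phi>)"

definition regular_dist :: "(real^'n::finite \<Rightarrow> real) \<Rightarrow> 'n distr" where
  "regular_dist f = (\<lambda>\<phi>. \<integral>x. f x * \<phi> x \<partial>lebesgue)"

definition dist_partial :: "'n::finite \<Rightarrow> 'n distr \<Rightarrow> 'n distr" where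
  "dist_partial i T = (\<lambda>\<phi>. - T (partial_deriv i \<phi>))"

(* Elements of L_2 and H^1 are represented by functions; two functions represent the
   same element iff they agree almost everywhere. *)
definition L2 :: "(real^'n::finite \<Rightarrow> real) set" where
  "L2 = {f \<in> borel_measurable lebesgue. integrable lebesgue (\<lambda>x. (f x)\<^sup>2)}"

definition norm_L2 :: "(real^'n::finite \<Rightarrow> real) \<Rightarrow> real" where
  "norm_L2 f = sqrt (\<integral>x. (f x)\<^sup>2 \<partial>lebesgue)"

definition rho :: "real^'n::finite \<Rightarrow> real" where
  "rho x = sqrt (1 + (norm x)\<^sup>2)"

definition H1 :: "(real^'n::finite \<Rightarrow> real) set" where
  "H1 = {f \<in> borel_measurable lebesgue. (\<lambda>x. f x / rho x) \<in> L2 \<and>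
          (\<forall>i. \<exists>h\<in>L2. dist_eq (dist_partial i (regular_dist f)) (regular_dist h))}"

(* For f in H1, an L_2 representative (unique almost everywhere) of the
   distributional derivative of f. *)
definition weak_partial :: "'n::finite \<Rightarrow> (real^'n \<Rightarrow> real) \<Rightarrow> real^'n \<Rightarrow> real" where
  "weak_partial i f =
     (SOME h. h \<in> L2 \<and> dist_eq (dist_partial i (regular_dist f)) (regular_dist h))"

definition norm_H1 :: "(real^'n::finite \<Rightarrow> real) \<Rightarrow> real" where
  "norm_H1 f = sqrt ((norm_L2 (\<lambda>x. f x / rho x))\<^sup>2 + (\<Sum>i\<in>UNIV. (norm_L2 (weak_partial i f))\<^sup>2))"

(* The dual of H1. Boundedness forces such a functional to agree on functions that are
   equal almost everywhere; its values outside H1 are irrelevant. *)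
definition Hm1 :: "'n::finite distr set" where
  "Hm1 = {F. (\<forall>v\<in>H1. \<forall>w\<in>H1. F (\<lambda>x. v x + w x) = F v + F w) \<and>
             (\<forall>v\<in>H1. \<forall>c. F (\<lambda>x. c * v x) = c * F v) \<and>
             (\<exists>K. \<forall>v\<in>H1. \<bar>F v\<bar> \<le> K * norm_H1 v)}"

definition norm_Hm1 :: "'n::finite distr \<Rightarrow> real" where
  "norm_Hm1 F = (SUP v\<in>{v\<in>H1. norm_H1 v \<le> 1}. \<bar>F v\<bar>)"

definition norm_H1_vec :: "(real^'n::finite \<Rightarrow> real^'n) \<Rightarrow> real" where
  "norm_H1_vec u = sqrt (\<Sum>i\<in>UNIV. (norm_H1 (\<lambda>x. u x $ i))\<^sup>2)"

definition norm_Hm1_vec :: "('n::finite \<Rightarrow> 'n distr) \<Rightarrow> real" where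
  "norm_Hm1_vec F = sqrt (\<Sum>i\<in>UNIV. (norm_Hm1 (F i))\<^sup>2)"

(* a i j \<alpha> \<beta> x stands for a_{ij}^{\<alpha>\<beta>}(x). *)
type_synonym 'n tensor = "'n \<Rightarrow> 'n \<Rightarrow> 'n \<Rightarrow> 'n \<Rightarrow> real^'n \<Rightarrow> real"

definition Linf_bounded_by :: "real \<Rightarrow> (real^'n::finite \<Rightarrow> real) \<Rightarrow> bool" where
  "Linf_bounded_by M f \<longleftrightarrow> f \<in> borel_measurable lebesgue \<and> (AE x in lebesgue. \<bar>f x\<bar> \<le> M)"

(* c is the ellipticity constant c_A. Ellipticity is only required for symmetric
   matrices with zero trace. *)
definition viscosity_tensor :: "real \<Rightarrow> 'n::finite tensor \<Rightarrow> bool" where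
  "viscosity_tensor c a \<longleftrightarrow>
     c > 0 \<and>
     (\<forall>i j \<alpha> \<beta>. \<exists>M. Linf_bounded_by M (a i j \<alpha> \<beta>)) \<and>
     (AE x in lebesgue. \<forall>i j \<alpha> \<beta>.
        a i j \<alpha> \<beta> x = a \<alpha> j i \<beta> x \<and> a i j \<alpha> \<beta> x = a i \<beta> \<alpha> j x) \<and>
     (AE x in lebesgue. \<forall>\<xi>::real^'n^'n. transpose \<xi> = \<xi> \<longrightarrow> trace \<xi> = 0 \<longrightarrow>
        (\<Sum>i\<in>UNIV. \<Sum>j\<in>UNIV. \<Sum>\<alpha>\<in>UNIV. \<Sum>\<beta>\<in>UNIV. a i j \<alpha> \<beta> x * \<xi> $ i $ \<alpha> * \<xi> $ j $ \<beta>)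
          \<ge> inverse c * (\<Sum>i\<in>UNIV. \<Sum>\<alpha>\<in>UNIV. (\<xi> $ i $ \<alpha>)\<^sup>2))"

definition sym_grad :: "(real^'n::finite \<Rightarrow> real^'n) \<Rightarrow> 'n \<Rightarrow> 'n \<Rightarrow> real^'n \<Rightarrow> real" where
  "sym_grad u j \<beta> x =
     (weak_partial j (\<lambda>y. u y $ \<beta>) x + weak_partial \<beta> (\<lambda>y. u y $ j) x) / 2"

definition stokes_op ::
  "'n::finite tensor \<Rightarrow> (real^'n \<Rightarrow> real^'n) \<Rightarrow> (real^'n \<Rightarrow> real) \<Rightarrow> 'n \<Rightarrow> 'n distr" where
  "stokes_op a u p i = (\<lambda>\<phi>.
     (\<Sum>\<alpha>\<in>UNIV. dist_partial \<alpha>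
        (regular_dist (\<lambda>x. \<Sum>j\<in>UNIV. \<Sum>\<beta>\<in>UNIV. a i j \<alpha> \<beta> x * sym_grad u j \<beta> x)) \<phi>)
     - dist_partial i (regular_dist p) \<phi>)"

definition dist_div :: "(real^'n::finite \<Rightarrow> real^'n) \<Rightarrow> 'n distr" where
  "dist_div u = (\<lambda>\<phi>. \<Sum>i\<in>UNIV. dist_partial i (regular_dist (\<lambda>x. u x $ i)) \<phi>)"

definition stokes_solution ::
  "'n::finite tensor \<Rightarrow> ('n \<Rightarrow> 'n distr) \<Rightarrow> (real^'n \<Rightarrow> real) \<Rightarrow>
   (real^'n \<Rightarrow> real^'n) \<Rightarrow> (real^'n \<Rightarrow> real) \<Rightarrow> bool" where
  "stokes_solution a F g u p \<longleftrightarrow>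
     (\<forall>i. (\<lambda>x. u x $ i) \<in> H1) \<and> p \<in> L2 \<and>
     (\<forall>i. dist_eq (stokes_op a u p i) (F i)) \<and>
     dist_eq (dist_div u) (regular_dist g)"

end

theory Submission
  imports Defs
begin

text \<open>
  Two classical inequalities reduce the problem to Lax-Milgram in a Hilbert space of gradients. Let
  \<open>G\<close> be the closure in \<open>L\<^sub>2\<close> of the gradients of test functions. By Hardy's inequality (valid since
  \<open>n \<ge> 3\<close>) every element of \<open>G\<close> is the gradient of some \<open>u \<in> H\<^sup>1\<close>. Conversely, if \<open>u \<in> H\<^sup>1\<close>, the part
  of \<open>\<nabla> u\<close> orthogonal to \<open>G\<close> is the gradient of a weakly harmonic function in the weighted \<open>L\<^sub>2\<close> space,
  and such a function vanishes: averaging it against a test function gives a smooth harmonic function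
  to which Caccioppoli's inequality with growing cutoffs applies. So \<open>H\<^sup>1\<close> is \<open>G\<close>, with equivalent norms.

  On \<open>G\<close> the identity \<open>\<langle>U\<^sub>j, W\<^sub>k\<rangle> = \<langle>U\<^sub>k, W\<^sub>j\<rangle>\<close> (two integrations by parts) gives Korn's inequality, so
  that ellipticity on trace-free symmetric matrices suffices on divergence-free fields. It also shows that
  \<open>p \<mapsto> (P (p e\<^sub>1), \<dots>, P (p e\<^sub>n))\<close>, with \<open>P\<close> the orthogonal projection onto \<open>G\<close>, is an isometric right inverse of
  the divergence: the difference between \<open>p\<close> and the divergence is square integrable and weakly harmonic.
  This right inverse lifts \<open>g\<close> and, composed with the residual functional, produces the pressure.
\<close>

section \<open>Hilbert spaces\<close>

text \<open>The obstacle is that \<open>H1\<close> is defined by distributional derivatives, while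
  the energy method needs the closed subspace \<open>grad_space\<close>; the weighted Liouville
  theorem bridges the two. The symmetries of the coefficients exchange i with \<alpha> and j with
  \<beta>, but not the pair (i, \<alpha>) with (j, \<beta>), so the bilinear form need not be
  symmetric and minimisation of an energy is replaced by Lax-Milgram. Velocities enter only through
  their Jacobians, as vectors of vectors over the type \<open>l2\<close>; functions are recovered
  from gradients when the result is translated back. Every constant is explicit: Hardy's inequality
  costs 2 (so \<open>norm_H1\<close> is at most 3 times the norm of the gradient), Korn's inequality
  leaves a factor 1/2, and the viscosity operator is bounded by n^4 times the bound of the
  coefficients. This is why C can be fixed before the tensor.\<close>

lemma orthogonal_projection_exists:
  fixes x :: "'a::{real_inner,banach}"
  assumes "closed S" "subspace S"
  shows "\<exists>y\<in>S. \<forall>w\<in>S. inner (x - y) w = 0"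
proof -
  have ne: "S \<noteq> {}" using assms(2) subspace_0 by blast
  define d where "d = infdist x S"
  have d0: "d \<ge> 0" by (simp add: d_def infdist_nonneg)
  have dle: "d \<le> norm (x - w)" if "w \<in> S" for w
    using infdist_le[OF that, of x] by (simp add: d_def dist_norm)
  have "\<exists>y\<in>S. norm (x - y) < d + 1 / real (Suc n)" for n
  proof -
    have "d < d + 1 / real (Suc n)" by simp
    then have "Inf ((dist x) ` S) < d + 1 / real (Suc n)"
      using ne by (simp add: d_def infdist_def)
    moreover have "bdd_below ((dist x) ` S)" by (auto intro: bdd_belowI2[where m=0])
    ultimately show ?thesis using ne by (subst (asm) cInf_less_iff) (auto simp: dist_norm)
  qed
  then obtain Y where Y: "\<And>n. Y n \<in> S" "\<And>n. norm (x - Y n) < d + 1 / real (Suc n)"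
    by metis
  \<comment> \<open>Parallelogram law: the midpoint of two almost nearest points lies in S, hence is
    at distance at least d from x, which forces the two points to be close.\<close>
  have key: "(norm (Y m - Y n))\<^sup>2 \<le> 4 * ((d + e)\<^sup>2 - d\<^sup>2)"
    if "norm (x - Y m) \<le> d + e" "norm (x - Y n) \<le> d + e" for m n e
  proof -
    let ?h = "(1/2) *\<^sub>R (Y m + Y n)"
    have "?h \<in> S" using Y(1) assms(2) by (intro subspace_scale subspace_add)
    then have "d\<^sup>2 \<le> (norm (x - ?h))\<^sup>2" using dle d0 by (intro power_mono)
    moreover have "(norm (Y m - Y n))\<^sup>2 =
        2 * (norm (x - Y m))\<^sup>2 + 2 * (norm (x - Y n))\<^sup>2 - 4 * (norm (x - ?h))\<^sup>2"
      unfolding power2_norm_eq_inner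
      by (simp add: inner_diff_left inner_diff_right inner_add_left inner_add_right inner_commute
          field_simps)
    moreover have "(norm (x - Y m))\<^sup>2 \<le> (d + e)\<^sup>2" "(norm (x - Y n))\<^sup>2 \<le> (d + e)\<^sup>2"
      using that by (auto intro!: power_mono)
    ultimately show ?thesis by (simp add: field_simps)
  qed
  have "Cauchy Y"
  proof (rule metric_CauchyI)
    fix e :: real assume e: "e > 0"
    have "((\<lambda>n. 4 * ((d + 1 / real (Suc n))\<^sup>2 - d\<^sup>2)) \<longlongrightarrow> 4 * ((d + 0)\<^sup>2 - d\<^sup>2)) sequentially"
      by (intro tendsto_intros LIMSEQ_Suc[OF lim_1_over_n])
    then have "eventually (\<lambda>n. 4 * ((d + 1 / real (Suc n))\<^sup>2 - d\<^sup>2) < e\<^sup>2) sequentially"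
      using e by (intro order_tendstoD(2)) auto
    then obtain N where N: "4 * ((d + 1 / real (Suc N))\<^sup>2 - d\<^sup>2) < e\<^sup>2"
      by (auto simp: eventually_sequentially)
    have b: "norm (x - Y n) \<le> d + 1 / real (Suc N)" if "n \<ge> N" for n
    proof -
      have "1 / real (Suc n) \<le> 1 / real (Suc N)" using that by (intro divide_left_mono) auto
      then show ?thesis using Y(2)[of n] by linarith
    qed
    have "dist (Y m) (Y n) < e" if "m \<ge> N" "n \<ge> N" for m n
    proof -
      have "(norm (Y m - Y n))\<^sup>2 < e\<^sup>2" using key[OF b[OF that(1)] b[OF that(2)]] N by linarith
      then show ?thesis using e by (simp add: dist_norm power_less_imp_less_base)
    qed
    then show "\<exists>M. \<forall>m\<ge>M. \<forall>n\<ge>M. dist (Y m) (Y n) < e" by blast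
  qed
  then obtain y where y: "Y \<longlonglongrightarrow> y" using Cauchy_convergent_iff convergent_def by blast
  have yS: "y \<in> S" using closed_sequentially[OF assms(1)] Y(1) y by blast
  have "(\<lambda>n. d + 1 / real (Suc n)) \<longlonglongrightarrow> d + 0"
    by (intro tendsto_intros LIMSEQ_Suc[OF lim_1_over_n])
  moreover have "(\<lambda>n. norm (x - Y n)) \<longlonglongrightarrow> norm (x - y)" by (intro tendsto_intros y)
  ultimately have yd: "norm (x - y) \<le> d"
    using LIMSEQ_le[of "\<lambda>n. norm (x - Y n)" _ "\<lambda>n. d + 1 / real (Suc n)" "d + 0"] Y(2)
    by (force intro: less_imp_le)
  have "inner (x - y) w = 0" if w: "w \<in> S" for w
  proof (cases "w = 0")
    case False
    \<comment> \<open>The minimiser in t of the squared distance from x to y + t w; moving there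
      would beat the distance d unless the inner product is 0.\<close>
    define t where "t = inner (x - y) w / inner w w"
    have ww: "inner w w > 0" using False by simp
    have "y + t *\<^sub>R w \<in> S" using yS w assms(2) by (intro subspace_add subspace_scale)
    then have "norm (x - y) \<le> norm (x - (y + t *\<^sub>R w))" using dle yd by force
    then have "(norm (x - y))\<^sup>2 \<le> (norm (x - (y + t *\<^sub>R w)))\<^sup>2" by (intro power_mono) auto
    also have "\<dots> = (norm (x - y))\<^sup>2 - 2 * t * inner (x - y) w + t\<^sup>2 * inner w w"
      unfolding power2_norm_eq_inner
      by (simp add: inner_diff_left inner_diff_right inner_add_left inner_add_right inner_commute
          power2_eq_square algebra_simps)
    also have "\<dots> = (norm (x - y))\<^sup>2 - (inner (x - y) w)\<^sup>2 / inner w w"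
      using ww by (simp add: t_def power2_eq_square field_simps)
    finally have "(inner (x - y) w)\<^sup>2 / inner w w \<le> 0" by linarith
    then show ?thesis using ww by (simp add: divide_le_0_iff)
  qed simp
  then show ?thesis using yS by blast
qed

section \<open>Orthogonal projection, Riesz representation and Lax-Milgram on a closed
  subspace\<close>

definition orth_proj :: "'a::real_inner set \<Rightarrow> 'a \<Rightarrow> 'a" where
  "orth_proj S x = (SOME y. y \<in> S \<and> (\<forall>w\<in>S. inner (x - y) w = 0))"

context
  fixes S :: "'a::{real_inner,banach} set"
  assumes S: "closed S" "subspace S"
begin

lemma orth_proj_props: "orth_proj S x \<in> S \<and> (\<forall>w\<in>S. inner (x - orth_proj S x) w = 0)"
  unfolding orth_proj_def by (rule someI_ex) (use orthogonal_projection_exists[OF S, of x] in blast)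

lemma orth_proj_in: "orth_proj S x \<in> S"
  using orth_proj_props by blast

lemma inner_orth_proj:
  assumes "w \<in> S" shows "inner (orth_proj S x) w = inner x w"
proof -
  have "inner (x - orth_proj S x) w = 0" using orth_proj_props assms by blast
  then show ?thesis unfolding inner_diff_left by linarith
qed

text \<open>The difference of the two candidates lies in S and is orthogonal to S, hence to itself.
  Linearity of the projection is read off from this characterisation.\<close>

lemma orth_proj_unique:
  assumes "y \<in> S" "\<And>w. w \<in> S \<Longrightarrow> inner y w = inner x w"
  shows "orth_proj S x = y"
proof -
  have d: "orth_proj S x - y \<in> S" using assms(1) orth_proj_in S(2) by (intro subspace_diff)
  have "inner (orth_proj S x - y) (orth_proj S x - y) = 0"
    using inner_orth_proj[OF d, of x] assms(2)[OF d] by (simp only: inner_diff_left)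
  then show ?thesis by simp
qed

lemma norm_orth_proj_le: "norm (orth_proj S x) \<le> norm x"
proof -
  have "(norm (orth_proj S x))\<^sup>2 = inner x (orth_proj S x)"
    using inner_orth_proj[OF orth_proj_in, of x x] by (simp add: power2_norm_eq_inner)
  also have "\<dots> \<le> norm x * norm (orth_proj S x)" by (rule norm_cauchy_schwarz)
  finally have "norm (orth_proj S x) * norm (orth_proj S x) \<le> norm x * norm (orth_proj S x)"
    by (simp add: power2_eq_square)
  then show ?thesis by (cases "orth_proj S x = 0") auto
qed

lemma bounded_linear_orth_proj: "bounded_linear (orth_proj S)"
proof (rule bounded_linear_intro)
  show "orth_proj S (x + y) = orth_proj S x + orth_proj S y" for x y
    by (rule orth_proj_unique) (auto simp: inner_orth_proj inner_add_left orth_proj_in S(2) subspace_add)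
  show "orth_proj S (r *\<^sub>R x) = r *\<^sub>R orth_proj S x" for r x
    by (rule orth_proj_unique) (auto simp: inner_orth_proj orth_proj_in S(2) subspace_scale)
  show "norm (orth_proj S x) \<le> norm x * 1" for x using norm_orth_proj_le by simp
qed

text \<open>Linearity and boundedness are asked on S alone, since the functional of
  \<open>Hm1_representation\<close> arises from a choice of potentials that behaves well on
  \<open>grad_space\<close> only. The kernel within S is closed by the bound, and r is a multiple of
  a vector of S orthogonal to it.\<close>

lemma riesz_representation:
  fixes f :: "'a \<Rightarrow> real"
  assumes add: "\<And>v w. v \<in> S \<Longrightarrow> w \<in> S \<Longrightarrow> f (v + w) = f v + f w"
    and scale: "\<And>r v. v \<in> S \<Longrightarrow> f (r *\<^sub>R v) = r * f v"
    and bound: "\<And>v. v \<in> S \<Longrightarrow> \<bar>f v\<bar> \<le> K * norm v"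
  shows "\<exists>r\<in>S. \<forall>v\<in>S. f v = inner r v"
proof -
  define N where "N = {v\<in>S. f v = 0}"
  have diff: "f (v - w) = f v - f w" if "v \<in> S" "w \<in> S" for v w
    using add[of v "(-1) *\<^sub>R w"] scale[of w "-1"] that S(2) by (simp add: subspace_neg)
  have "f 0 = 0" using scale[of 0 0] S(2) by (simp add: subspace_0)
  then have sN: "subspace N"
    using S(2) by (auto simp: N_def subspace_def add scale)
  have cN: "closed N"
  proof (unfold closed_sequential_limits, safe)
    fix X l assume X: "\<forall>n. X n \<in> N" "X \<longlonglongrightarrow> l"
    then have l: "l \<in> S" using closed_sequentially[OF S(1)] by (auto simp: N_def)
    have lim: "(\<lambda>n. K * norm (l - X n)) \<longlonglongrightarrow> K * norm (l - l)" by (intro tendsto_intros X)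
    have le: "\<bar>f l\<bar> \<le> K * norm (l - X n)" for n
    proof -
      have "X n \<in> S" "f (X n) = 0" using X(1) by (auto simp: N_def)
      then show ?thesis
        using bound[of "l - X n"] diff[OF l, of "X n"] S(2) l by (simp add: subspace_diff)
    qed
    have "\<bar>f l\<bar> \<le> K * norm (l - l)" by (rule LIMSEQ_le_const[OF lim]) (use le in blast)
    then show "l \<in> N" using l by (auto simp: N_def)
  qed
  show ?thesis
  proof (cases "N = S")
    case True
    then have "\<forall>v\<in>S. f v = inner 0 v" by (auto simp: N_def)
    then show ?thesis using S(2) subspace_0 by blast
  next
    case False
    then obtain x where x: "x \<in> S" "f x \<noteq> 0" by (auto simp: N_def)
    obtain p where p: "p \<in> N" "\<And>w. w \<in> N \<Longrightarrow> inner (x - p) w = 0"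
      using orthogonal_projection_exists[OF cN sN, of x] by blast
    define z where "z = x - p"
    have pS: "p \<in> S" "f p = 0" using p by (auto simp: N_def)
    have z: "z \<in> S" "f z \<noteq> 0" using x pS S(2) by (auto simp: z_def subspace_diff diff)
    have z0: "inner z z \<noteq> 0" using z(2) \<open>f 0 = 0\<close> by auto
    \<comment> \<open>Subtracting from v the multiple of z with the same value under f leaves an
      element of the kernel, to which z is orthogonal.\<close>
    have "f v = inner ((f z / inner z z) *\<^sub>R z) v" if v: "v \<in> S" for v
    proof -
      have s: "(f v / f z) *\<^sub>R z \<in> S" using z S(2) by (auto simp: subspace_scale)
      then have "v - (f v / f z) *\<^sub>R z \<in> N"
        using v z S(2) by (auto simp: N_def subspace_diff diff scale)
      then have "inner z (v - (f v / f z) *\<^sub>R z) = 0" using p(2) by (simp add: z_def)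
      then show ?thesis using z(2) z0 by (simp add: inner_diff_right field_simps)
    qed
    then show ?thesis using z(1) S(2) subspace_scale by blast
  qed
qed

text \<open>A may leave S and need not be self-adjoint, and it is coercive only on S. So the
  equation is projected: with P the projection onto S, the solution is the fixed point of T u = u -
  t P (A u - f), a contraction of S for a suitable t > 0.\<close>

lemma lax_milgram:
  assumes A: "bounded_linear A" and g: "g > 0"
    and coercive: "\<And>u. u \<in> S \<Longrightarrow> g * (norm u)\<^sup>2 \<le> inner (A u) u"
  shows "\<exists>u\<in>S. \<forall>w\<in>S. inner (A u) w = inner f w"
proof -
  interpret A: bounded_linear A by fact
  interpret P: bounded_linear "orth_proj S" by (rule bounded_linear_orth_proj)
  obtain K where K: "K > 0" "\<And>x. norm (A x) \<le> norm x * K" using A.pos_bounded by blast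
  \<comment> \<open>This t minimises 1 - 2 t g + t^2 K^2, the bound for the squared contraction
    factor; the minimum is 1 - g^2 / K^2.\<close>
  define t where "t = g / K\<^sup>2"
  \<comment> \<open>The maximum with 0 covers S = {0}, where coercivity does not force g \<le>
    K.\<close>
  define q where "q = sqrt (max 0 (1 - g\<^sup>2 / K\<^sup>2))"
  have t: "t > 0" using g K by (simp add: t_def)
  have q: "0 \<le> q" "q < 1" using g K by (auto simp: q_def max_def)
  define T where "T u = u - t *\<^sub>R orth_proj S (A u - f)" for u
  have TS: "T ` S \<subseteq> S"
    using S(2) by (auto simp: T_def intro!: subspace_diff subspace_scale orth_proj_in)
  have lip: "dist (T u) (T v) \<le> q * dist u v" if "u \<in> S" "v \<in> S" for u v
  proof -
    define d where "d = u - v"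
    have dS: "d \<in> S" using that S(2) by (simp add: d_def subspace_diff)
    have e: "T u - T v = d - t *\<^sub>R orth_proj S (A d)"
      by (simp add: T_def d_def P.diff A.diff algebra_simps)
    have "(norm (T u - T v))\<^sup>2 = (norm d)\<^sup>2 - 2 * t * inner (A d) d + t\<^sup>2 * (norm (orth_proj S (A d)))\<^sup>2"
      unfolding e power2_norm_eq_inner using inner_orth_proj[OF dS, of "A d"]
      by (simp add: inner_diff_left inner_diff_right inner_commute power2_eq_square algebra_simps)
    also have "\<dots> \<le> (norm d)\<^sup>2 - 2 * t * (g * (norm d)\<^sup>2) + t\<^sup>2 * (norm d * K)\<^sup>2"
    proof -
      have "norm (orth_proj S (A d)) \<le> norm d * K" using norm_orth_proj_le[of "A d"] K(2)[of d]
          by linarith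
      then have "t\<^sup>2 * (norm (orth_proj S (A d)))\<^sup>2 \<le> t\<^sup>2 * (norm d * K)\<^sup>2"
        by (intro mult_left_mono power_mono) auto
      moreover have "2 * t * (g * (norm d)\<^sup>2) \<le> 2 * t * inner (A d) d"
        using coercive[OF dS] t by (intro mult_left_mono) auto
      ultimately show ?thesis by linarith
    qed
    also have "\<dots> = (1 - g\<^sup>2 / K\<^sup>2) * (norm d)\<^sup>2"
      using K by (simp add: t_def power2_eq_square field_simps)
    also have "\<dots> \<le> q\<^sup>2 * (norm d)\<^sup>2"
      by (intro mult_right_mono) (auto simp: q_def)
    finally have "(norm (T u - T v))\<^sup>2 \<le> (q * norm d)\<^sup>2" by (simp add: power_mult_distrib)
    then show ?thesis
      using q by (auto simp: dist_norm d_def intro: power2_le_imp_le)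
  qed
  have "S \<noteq> {}" using S(2) subspace_0 by blast
  then have "\<exists>!x. x \<in> S \<and> T x = x"
    using Banach_fix[OF _ _ q TS] lip S(1) by (auto simp: complete_eq_closed)
  then obtain u where u: "u \<in> S" "T u = u" by blast
  then have "orth_proj S (A u - f) = 0" using t by (simp add: T_def)
  then have "inner (A u - f) w = 0" if "w \<in> S" for w using inner_orth_proj[OF that, of "A u - f"] by simp
  then show ?thesis using u(1) by (auto simp: inner_diff_left)
qed

end

lemma subspace_closure_normed:
  fixes S :: "'a::real_normed_vector set"
  assumes "subspace S" shows "subspace (closure S)"
proof -
  have "0 \<in> closure S" using assms closure_subset subspace_0 by blast
  moreover have "x + y \<in> closure S" if xy: "x \<in> closure S" "y \<in> closure S" for x y
  proof -
    obtain f g where f: "\<And>n. f n \<in> S" "f \<longlonglongrightarrow> x" and g: "\<And>n. g n \<in> S" "g \<longlonglongrightarrow> y"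
      using xy unfolding closure_sequential by blast
    have "(\<lambda>n. f n + g n) \<longlonglongrightarrow> x + y" by (intro tendsto_add f g)
    moreover have "f n + g n \<in> S" for n using f g assms by (simp add: subspace_add)
    ultimately show ?thesis
      unfolding closure_sequential by (auto intro!: exI[of _ "\<lambda>n. f n + g n"])
  qed
  moreover have "c *\<^sub>R x \<in> closure S" if x: "x \<in> closure S" for x c
  proof -
    obtain f where f: "\<And>n. f n \<in> S" "f \<longlonglongrightarrow> x" using x unfolding closure_sequential by blast
    have "(\<lambda>n. c *\<^sub>R f n) \<longlonglongrightarrow> c *\<^sub>R x" by (intro tendsto_scaleR tendsto_const f)
    moreover have "c *\<^sub>R f n \<in> S" for n using f assms by (simp add: subspace_scale)
    ultimately show ?thesis
      unfolding closure_sequential by (auto intro!: exI[of _ "\<lambda>n. c *\<^sub>R f n"])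
  qed
  ultimately show ?thesis by (simp add: subspace_def)
qed

section \<open>Smooth functions\<close>

definition smooth :: "(real^'n::finite \<Rightarrow> real) \<Rightarrow> bool" where
  "smooth f \<longleftrightarrow> (\<forall>is. foldr partial_deriv is f differentiable_on UNIV)"

lemma partial_deriv_eq:
  "(f has_derivative f') (at x) \<Longrightarrow> partial_deriv i f x = f' (axis i 1)"
  by (simp add: partial_deriv_def frechet_derivative_at[symmetric])

lemma smooth_differentiable: "smooth f \<Longrightarrow> f differentiable (at x)"
  unfolding smooth_def by (drule spec[of _ "[]"]) (simp add: differentiable_on_def)

lemma smooth_partial_deriv: "smooth f \<Longrightarrow> smooth (partial_deriv i f)"
  unfolding smooth_def
proof
  fix "is" assume "\<forall>is. foldr partial_deriv is f differentiable_on UNIV"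
  then have "foldr partial_deriv (is @ [i]) f differentiable_on UNIV" by blast
  then show "foldr partial_deriv is (partial_deriv i f) differentiable_on UNIV" by simp
qed

text \<open>Iterated derivatives rarely have a manageable closed form. It is enough to find a class
  around f that consists of differentiable functions and is stable under partial derivatives; every
  smoothness proof below exhibits such a class.\<close>

lemma smooth_coinduct:
  assumes "f \<in> S" "\<And>g x. g \<in> S \<Longrightarrow> g differentiable (at x)"
    "\<And>g i. g \<in> S \<Longrightarrow> partial_deriv i g \<in> S"
  shows "smooth f"
  unfolding smooth_def
proof
  fix "is"
  have "foldr partial_deriv is f \<in> S" using assms(1,3) by (induction "is") auto
  then show "foldr partial_deriv is f differentiable_on UNIV"
    using assms(2) by (simp add: differentiable_on_def differentiable_at_withinI)
qed

lemma linear_eq_sum_axis: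
  fixes h :: "real^'n::finite \<Rightarrow> real"
  assumes "linear h"
  shows "h t = (\<Sum>i\<in>UNIV. h (axis i 1) * t $ i)"
proof -
  have "t = (\<Sum>i\<in>UNIV. (t $ i) *\<^sub>R axis i 1)"
    using basis_expansion[of t] by (simp add: scalar_mult_eq_scaleR)
  then have "h t = h (\<Sum>i\<in>UNIV. (t $ i) *\<^sub>R axis i 1)" by simp
  also have "\<dots> = (\<Sum>i\<in>UNIV. h (axis i 1) * t $ i)"
    using assms by (simp add: linear_sum linear_scale mult.commute)
  finally show ?thesis .
qed

lemma differentiable_has_derivative_partials:
  assumes "f differentiable (at x)"
  shows "(f has_derivative (\<lambda>t. \<Sum>i\<in>UNIV. partial_deriv i f x * t $ i)) (at x)"
proof -
  obtain f' where f': "(f has_derivative f') (at x)" using assms differentiable_def by blast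
  have "f' t = (\<Sum>i\<in>UNIV. partial_deriv i f x * t $ i)" for t
    using linear_eq_sum_axis[OF has_derivative_linear[OF f'], of t]
    by (simp only: partial_deriv_eq[OF f'])
  then have "f' = (\<lambda>t. \<Sum>i\<in>UNIV. partial_deriv i f x * t $ i)" by (rule ext)
  then show ?thesis using f' by simp
qed

lemmas smooth_has_derivative = differentiable_has_derivative_partials[OF smooth_differentiable]

lemma smooth_continuous: "smooth f \<Longrightarrow> continuous_on A f"
  by (meson continuous_at_imp_continuous_on differentiable_imp_continuous_within smooth_differentiable)

lemma partial_deriv_const: "partial_deriv i (\<lambda>x. c) = (\<lambda>x. 0)"
  by (rule ext, subst partial_deriv_eq[OF has_derivative_const]) simp

lemma partial_deriv_add:
  assumes "f differentiable (at x)" "g differentiable (at x)"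
  shows "partial_deriv i (\<lambda>x. f x + g x) x = partial_deriv i f x + partial_deriv i g x"
  using partial_deriv_eq[OF has_derivative_add[OF
      differentiable_has_derivative_partials[OF assms(1)]
      differentiable_has_derivative_partials[OF assms(2)]], of i]
  by (simp add: axis_def if_distrib cong: if_cong)

lemma partial_deriv_mult:
  assumes "f differentiable (at x)" "g differentiable (at x)"
  shows "partial_deriv i (\<lambda>x. f x * g x) x = f x * partial_deriv i g x + partial_deriv i f x * g x"
  using partial_deriv_eq[OF has_derivative_mult[OF
      differentiable_has_derivative_partials[OF assms(1)]
      differentiable_has_derivative_partials[OF assms(2)]], of i]
  by (simp add: axis_def if_distrib cong: if_cong)

lemma partial_deriv_cmult:
  assumes "f differentiable (at x)"
  shows "partial_deriv i (\<lambda>x. c * f x) x = c * partial_deriv i f x"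
  using partial_deriv_mult[of "\<lambda>_. c" x f i] assms by (simp add: partial_deriv_const)

lemma partial_deriv_affine:
  assumes "f differentiable (at (c *\<^sub>R x + y))"
  shows "partial_deriv i (\<lambda>x. f (c *\<^sub>R x + y)) x = c * partial_deriv i f (c *\<^sub>R x + y)"
    "(\<lambda>x. f (c *\<^sub>R x + y)) differentiable (at x)"
proof -
  have h: "((\<lambda>x. c *\<^sub>R x + y) has_derivative (\<lambda>t. c *\<^sub>R t)) (at x)"
    by (auto intro!: derivative_eq_intros)
  from has_derivative_compose[OF h differentiable_has_derivative_partials[OF assms]]
  have D: "((\<lambda>x. f (c *\<^sub>R x + y)) has_derivative
     (\<lambda>t. \<Sum>i\<in>UNIV. partial_deriv i f (c *\<^sub>R x + y) * (c *\<^sub>R t) $ i)) (at x)" by (simp add: o_def)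
  show "partial_deriv i (\<lambda>x. f (c *\<^sub>R x + y)) x = c * partial_deriv i f (c *\<^sub>R x + y)"
    unfolding partial_deriv_eq[OF D] by (simp add: axis_def if_distrib cong: if_cong)
  show "(\<lambda>x. f (c *\<^sub>R x + y)) differentiable (at x)" using D differentiableI by blast
qed

lemma smooth_affine:
  assumes "smooth f"
  shows "smooth (\<lambda>x. f (c *\<^sub>R x + y))"
proof (rule smooth_coinduct)
  \<comment> \<open>The factor d collects the powers of c that the chain rule produces.\<close>
  let ?S = "{\<lambda>x. d * g (c *\<^sub>R x + y) | d g. smooth g}"
  show "(\<lambda>x. f (c *\<^sub>R x + y)) \<in> ?S" using assms by (auto intro!: exI[of _ 1] exI[of _ f])
  show "h differentiable (at x)" if "h \<in> ?S" for h x
  proof -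
    obtain d g where h: "h = (\<lambda>x. d * g (c *\<^sub>R x + y))" "smooth g" using \<open>h \<in> ?S\<close> by blast
    show ?thesis unfolding h(1)
      by (rule differentiable_mult[OF differentiable_const
            partial_deriv_affine(2)[OF smooth_differentiable[OF h(2)]]])
  qed
  show "partial_deriv i h \<in> ?S" if "h \<in> ?S" for h i
  proof -
    obtain d g where h: "h = (\<lambda>x. d * g (c *\<^sub>R x + y))" "smooth g" using \<open>h \<in> ?S\<close> by blast
    have "partial_deriv i h = (\<lambda>x. (d * c) * partial_deriv i g (c *\<^sub>R x + y))"
      unfolding h by (rule ext, subst partial_deriv_cmult)
        (auto simp: partial_deriv_affine smooth_differentiable h(2))
    then show ?thesis using smooth_partial_deriv[OF h(2)] by blast
  qed
qed

text \<open>Closing the smooth functions under sums and products first makes coinduction apply,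
  since the product rule turns one product into two.\<close>

inductive_set smooth_alg :: "(real^'n::finite \<Rightarrow> real) set" where
  smooth_alg_base: "smooth f \<Longrightarrow> f \<in> smooth_alg"
| smooth_alg_add: "f \<in> smooth_alg \<Longrightarrow> g \<in> smooth_alg \<Longrightarrow> (\<lambda>x. f x + g x) \<in> smooth_alg"
| smooth_alg_mult: "f \<in> smooth_alg \<Longrightarrow> g \<in> smooth_alg \<Longrightarrow> (\<lambda>x. f x * g x) \<in> smooth_alg"

lemma smooth_alg_smooth: "f \<in> smooth_alg \<Longrightarrow> smooth f"
proof (rule smooth_coinduct)
  show diff: "g differentiable (at x)" if "g \<in> smooth_alg" for g :: "real^'n \<Rightarrow> real" and x
    using that by induction (auto intro: smooth_differentiable differentiable_add differentiable_mult)
  show "partial_deriv i g \<in> smooth_alg" if "g \<in> smooth_alg" for g :: "real^'n \<Rightarrow> real" and i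
    using that
  proof induction
    case (smooth_alg_add f g)
    then have "partial_deriv i (\<lambda>x. f x + g x) = (\<lambda>x. partial_deriv i f x + partial_deriv i g x)"
      by (auto simp: partial_deriv_add diff)
    then show ?case using smooth_alg_add smooth_alg.smooth_alg_add by simp
  next
    case (smooth_alg_mult f g)
    then have "partial_deriv i (\<lambda>x. f x * g x) =
        (\<lambda>x. f x * partial_deriv i g x + partial_deriv i f x * g x)"
      by (auto simp: partial_deriv_mult diff)
    then show ?case
      using smooth_alg_mult by (auto intro!: smooth_alg.smooth_alg_add smooth_alg.smooth_alg_mult)
  qed (auto intro: smooth_alg_base smooth_partial_deriv)
qed

lemma smooth_add: "smooth f \<Longrightarrow> smooth g \<Longrightarrow> smooth (\<lambda>x. f x + g x)"
  and smooth_mult: "smooth f \<Longrightarrow> smooth g \<Longrightarrow> smooth (\<lambda>x. f x * g x)"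
  by (intro smooth_alg_smooth[OF smooth_alg_add] smooth_alg_smooth[OF smooth_alg_mult]
      smooth_alg_base; assumption)+

lemma smooth_const: "smooth (\<lambda>x. c)"
  by (rule smooth_coinduct[where S="range (\<lambda>c x. c)"]) (auto simp: partial_deriv_const)

lemma smooth_prod:
  "finite I \<Longrightarrow> (\<And>i. i \<in> I \<Longrightarrow> smooth (f i)) \<Longrightarrow> smooth (\<lambda>x. \<Prod>i\<in>I. f i x)"
  by (induction rule: finite_induct) (auto intro: smooth_const smooth_mult)

lemma smooth_sum:
  "finite I \<Longrightarrow> (\<And>i. i \<in> I \<Longrightarrow> smooth (f i)) \<Longrightarrow> smooth (\<lambda>x. \<Sum>i\<in>I. f i x)"
  by (induction rule: finite_induct) (auto intro: smooth_const smooth_add)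

text \<open>The functions \<open>t \<mapsto> P(1/t) exp(-1/t)\<close>, extended by zero to \<open>t \<le> 0\<close>, form a class closed
  under differentiation that contains the classical flat function.\<close>

definition flat :: "real poly \<Rightarrow> real \<Rightarrow> real" where
  "flat P t = (if t > 0 then poly P (1 / t) * exp (- (1 / t)) else 0)"

lemma poly_exp_decay: "((\<lambda>s. poly P s * exp (- s)) \<longlongrightarrow> 0) at_top" for P :: "real poly"
proof -
  have m: "((\<lambda>s::real. s ^ k * exp (- s)) \<longlongrightarrow> 0) at_top" for k
    using tendsto_power_div_exp_0[of k] by (simp add: exp_minus field_simps)
  have "((\<lambda>s. \<Sum>i\<le>degree P. coeff P i * (s ^ i * exp (- s))) \<longlongrightarrow> (\<Sum>i\<le>degree P. coeff P i * 0)) at_top"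
    by (intro tendsto_intros m)
  then show ?thesis by (simp add: poly_altdef sum_distrib_right mult.assoc)
qed

text \<open>For t > 0 the derivative of P(1/t) exp(-1/t) is (1/t^2) (P - P')(1/t) exp(-1/t), and
  \<open>[:0,0,1:]\<close> is the polynomial X^2. At 0 the difference quotient tends to 0 because
  exponential decay beats every polynomial.\<close>

lemma flat_has_derivative:
  "(flat P has_real_derivative flat ([:0,0,1:] * (P - pderiv P)) t) (at t)"
proof -
  consider "t > 0" | "t < 0" | "t = 0" by linarith
  then show ?thesis
  proof cases
    case 1
    have "((\<lambda>t. poly P (1 / t) * exp (- (1 / t))) has_real_derivative
        flat ([:0,0,1:] * (P - pderiv P)) t) (at t)"
      using 1 by (auto intro!: derivative_eq_intros DERIV_chain2[OF poly_DERIV]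
          simp: flat_def power2_eq_square field_simps)
    moreover have "eventually (\<lambda>s. flat P s = poly P (1 / s) * exp (- (1 / s))) (nhds t)"
      using 1 by (auto simp: flat_def eventually_nhds intro!: exI[of _ "{0<..}"])
    ultimately show ?thesis by (subst DERIV_cong_ev[OF refl _ refl])
  next
    case 2
    have "eventually (\<lambda>s. flat P s = 0) (nhds t)"
      using 2 by (auto simp: flat_def eventually_nhds intro!: exI[of _ "{..<0}"])
    then show ?thesis using 2 by (subst DERIV_cong_ev[OF refl _ refl]) (auto simp: flat_def)
  next
    case 3
    have "((\<lambda>h. flat P h / h) \<longlongrightarrow> 0) (at 0)"
      unfolding filterlim_at_split
    proof
      show "((\<lambda>h. flat P h / h) \<longlongrightarrow> 0) (at_left 0)"
        by (rule tendsto_eventually) (auto simp: flat_def eventually_at_filter)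
      \<comment> \<open>\<open>pCons 0 P\<close> is X P; evaluated at 1/h, the factor X absorbs the
        division by h.\<close>
      have "((\<lambda>h. poly (pCons 0 P) (inverse h) * exp (- inverse h)) \<longlongrightarrow> 0) (at_right 0)"
        by (rule filterlim_compose[OF poly_exp_decay filterlim_inverse_at_top_right])
      moreover have "eventually (\<lambda>h. poly (pCons 0 P) (inverse h) * exp (- inverse h) = flat P h / h)
          (at_right 0)"
        by (auto simp: flat_def eventually_at_filter field_simps)
      ultimately show "((\<lambda>h. flat P h / h) \<longlongrightarrow> 0) (at_right 0)"
        by (rule Lim_transform_eventually)
    qed
    then show ?thesis using 3 by (simp add: has_field_derivative_iff flat_def)
  qed
qed

lemma smooth_flat_coord: "smooth (\<lambda>x::real^'n::finite. flat P (c * x $ k + d))"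
proof (rule smooth_coinduct)
  let ?S = "{(\<lambda>x::real^'n. e * flat P (c * x $ k + d)) | e P. True}"
  show "(\<lambda>x. flat P (c * x $ k + d)) \<in> ?S"
    by (intro CollectI exI[of _ 1] exI[of _ P]) simp
  have D: "((\<lambda>x::real^'n. e * flat P (c * x $ k + d)) has_derivative
      (\<lambda>t. e * (flat ([:0,0,1:] * (P - pderiv P)) (c * x $ k + d) * (c * t $ k)))) (at x)" for P e x
  proof -
    have "((\<lambda>x::real^'n. c * x $ k + d) has_derivative (\<lambda>t. c * t $ k)) (at x)"
      by (auto intro!: derivative_eq_intros bounded_linear.has_derivative[OF bounded_linear_vec_nth])
    from has_derivative_compose[OF this
        flat_has_derivative[unfolded has_field_derivative_def, of P "c * x $ k + d"]]
    show ?thesis by (intro has_derivative_mult_right) (simp add: o_def)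
  qed
  show "h differentiable (at x)" if "h \<in> ?S" for h x
    using that D differentiableI by blast
  show "partial_deriv i h \<in> ?S" if "h \<in> ?S" for h i
  proof -
    obtain e P where h: "h = (\<lambda>x. e * flat P (c * x $ k + d))" using \<open>h \<in> ?S\<close> by blast
    have "partial_deriv i h = (\<lambda>x. (e * c * (axis i 1 :: real^'n) $ k) *
        flat ([:0,0,1:] * (P - pderiv P)) (c * x $ k + d))"
      unfolding h by (rule ext, subst partial_deriv_eq[OF D]) simp
    then show ?thesis by blast
  qed
qed

section \<open>Test functions\<close>

lemma testI:
  assumes "smooth \<phi>" "\<And>x. norm x > r \<Longrightarrow> \<phi> x = 0"
  shows "\<phi> \<in> test_functions"
proof -
  have "bounded {x. \<phi> x \<noteq> 0}"
    unfolding bounded_iff using assms(2) by (intro exI[of _ r]) (force simp: not_less[symmetric])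
  then show ?thesis using assms(1) by (simp add: test_functions_def smooth_def compact_closure)
qed

lemma test_smooth: "\<phi> \<in> test_functions \<Longrightarrow> smooth \<phi>"
  by (simp add: test_functions_def smooth_def)

lemma testE:
  assumes "\<phi> \<in> test_functions"
  obtains r where "r > 0" "\<And>x. norm x > r \<Longrightarrow> \<phi> x = 0"
proof -
  have "bounded {x. \<phi> x \<noteq> 0}" using assms by (simp add: test_functions_def compact_closure)
  then obtain r where "r > 0" "\<forall>x\<in>{x. \<phi> x \<noteq> 0}. norm x \<le> r" using bounded_pos by blast
  then show ?thesis using that[of r] by force
qed

lemma partial_deriv_zero_outside:
  fixes f :: "real^'n::finite \<Rightarrow> real"
  assumes "\<And>x. norm x > r \<Longrightarrow> f x = 0" "norm x > r"
  shows "partial_deriv i f x = 0"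
proof -
  have "((\<lambda>x. 0) has_derivative (\<lambda>_. 0)) (at x)" by simp
  moreover have "open {y::real^'n. norm y > r}"
    using open_Collect_less[of "\<lambda>_. r" "norm :: real^'n \<Rightarrow> real"] by (simp add: continuous_on_norm_id)
  ultimately have "(f has_derivative (\<lambda>_. 0)) (at x)"
    by (rule has_derivative_transform_within_open) (use assms in auto)
  then show ?thesis using partial_deriv_eq by blast
qed

lemma test_partial_deriv: "\<phi> \<in> test_functions \<Longrightarrow> partial_deriv i \<phi> \<in> test_functions"
  by (metis testE testI partial_deriv_zero_outside smooth_partial_deriv test_smooth)

lemma test_mult:
  assumes "smooth f" "\<phi> \<in> test_functions"
  shows "(\<lambda>x. f x * \<phi> x) \<in> test_functions"
proof -
  obtain r where "\<And>x. norm x > r \<Longrightarrow> \<phi> x = 0" using testE assms by metis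
  then show ?thesis
    by (intro testI[of _ r, OF smooth_mult[OF assms(1) test_smooth[OF assms(2)]]]) auto
qed

lemma test_add:
  assumes "\<phi> \<in> test_functions" "\<psi> \<in> test_functions"
  shows "(\<lambda>x. \<phi> x + \<psi> x) \<in> test_functions"
proof -
  obtain r s where "\<And>x. norm x > r \<Longrightarrow> \<phi> x = 0" "\<And>x. norm x > s \<Longrightarrow> \<psi> x = 0"
    using testE assms by metis
  then show ?thesis
    by (intro testI[of _ "max r s", OF smooth_add[OF assms[THEN test_smooth]]]) auto
qed

lemma test_cmult: "\<phi> \<in> test_functions \<Longrightarrow> (\<lambda>x. c * \<phi> x) \<in> test_functions"
  by (intro test_mult smooth_const)

lemma test_zero: "(\<lambda>x. 0) \<in> test_functions"
  by (rule testI[of _ 0]) (auto intro: smooth_const)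

lemma test_affine:
  assumes "\<phi> \<in> test_functions" "c \<noteq> 0"
  shows "(\<lambda>x. \<phi> (c *\<^sub>R x + y)) \<in> test_functions"
proof -
  obtain r where r: "\<And>x. norm x > r \<Longrightarrow> \<phi> x = 0" using testE assms by metis
  show ?thesis
  proof (rule testI[of _ "(r + norm y) / \<bar>c\<bar>"])
    fix x :: "real^'a" assume "norm x > (r + norm y) / \<bar>c\<bar>"
    then have "norm (c *\<^sub>R x) > r + norm y" using assms(2) by (simp add: field_simps)
    then have "norm (c *\<^sub>R x + y) > r" using norm_diff_ineq[of "c *\<^sub>R x" y] by linarith
    then show "\<phi> (c *\<^sub>R x + y) = 0" by (rule r)
  qed (intro smooth_affine test_smooth assms)
qed

lemma continuous_compact_support_bounded:
  fixes f :: "real^'n::finite \<Rightarrow> real"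
  assumes "continuous_on UNIV f" "\<And>x. norm x > r \<Longrightarrow> f x = 0"
  obtains K where "K > 0" "\<And>x. \<bar>f x\<bar> \<le> K"
proof -
  have "bounded (f ` cball 0 r)"
    by (intro compact_imp_bounded compact_continuous_image continuous_on_subset[OF assms(1)]) auto
  then obtain K where K: "K > 0" "\<And>x. x \<in> cball 0 r \<Longrightarrow> \<bar>f x\<bar> \<le> K"
    unfolding bounded_pos by auto
  then have "\<bar>f x\<bar> \<le> K" for x using assms(2)[of x] K(1) by (cases "norm x \<le> r") auto
  then show ?thesis using that K(1) by blast
qed

lemma test_bounded:
  assumes "\<phi> \<in> test_functions"
  obtains K where "K > 0" "\<And>x. \<bar>\<phi> x\<bar> \<le> K"
  using continuous_compact_support_bounded[OF smooth_continuous[OF test_smooth[OF assms]]]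
      testE[OF assms]
  by metis

lemma test_gradient_bounded:
  assumes "\<phi> \<in> test_functions"
  obtains K where "K > 0" "\<And>x t. \<bar>\<Sum>i\<in>UNIV. partial_deriv i \<phi> x * t $ i\<bar> \<le> K * norm t"
proof -
  have "\<forall>i. \<exists>K. K > 0 \<and> (\<forall>x. \<bar>partial_deriv i \<phi> x\<bar> \<le> K)"
    using test_bounded[OF test_partial_deriv[OF assms]] by metis
  then obtain K where K: "\<And>i. K i > 0" "\<And>i x. \<bar>partial_deriv i \<phi> x\<bar> \<le> K i" by metis
  show ?thesis
  proof
    show "(\<Sum>i\<in>UNIV. K i) > 0" by (intro sum_pos K) auto
    show "\<bar>\<Sum>i\<in>UNIV. partial_deriv i \<phi> x * t $ i\<bar> \<le> (\<Sum>i\<in>UNIV. K i) * norm t" for x t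
    proof -
      have "\<bar>\<Sum>i\<in>UNIV. partial_deriv i \<phi> x * t $ i\<bar> \<le> (\<Sum>i\<in>UNIV. \<bar>partial_deriv i \<phi> x * t $ i\<bar>)"
        by (rule sum_abs)
      also have "\<dots> \<le> (\<Sum>i\<in>UNIV. K i * norm t)"
        using K(1) by (intro sum_mono) (auto simp: abs_mult component_le_norm_cart intro!: mult_mono K(2)
            less_imp_le[OF K(1)])
      finally show ?thesis by (simp add: sum_distrib_right)
    qed
  qed
qed

lemma test_lipschitz:
  assumes "\<phi> \<in> test_functions"
  obtains K where "K > 0" "\<And>x y. \<bar>\<phi> x - \<phi> y\<bar> \<le> K * norm (x - y)"
proof -
  obtain K where K: "K > 0" "\<And>x t. \<bar>\<Sum>i\<in>UNIV. partial_deriv i \<phi> x * t $ i\<bar> \<le> K * norm t"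
    using test_gradient_bounded[OF assms] by metis
  have "norm (\<phi> x - \<phi> y) \<le> K * norm (x - y)" for x y
    by (rule differentiable_bound[OF convex_UNIV, of \<phi>])
      (auto intro!: smooth_has_derivative test_smooth assms onorm_le K(2))
  then show ?thesis using that K(1) by auto
qed

text \<open>The mean value inequality for \<phi> minus its linear part at x: on the ball of radius
  norm t about x the gradient of this difference is at most a Lipschitz constant times norm t. That
  K does not depend on x is what differentiation under the integral in
  \<open>correl_has_derivative\<close> rests on.\<close>

lemma test_taylor:
  assumes "\<phi> \<in> test_functions"
  obtains K where "K > 0"
    "\<And>x t. \<bar>\<phi> (x + t) - \<phi> x - (\<Sum>i\<in>UNIV. partial_deriv i \<phi> x * t $ i)\<bar> \<le> K * (norm t)\<^sup>2"
proof -
  have "\<forall>i. \<exists>K. K > 0 \<and> (\<forall>x y. \<bar>partial_deriv i \<phi> x - partial_deriv i \<phi> y\<bar> \<le> K * norm (x - y))"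
    using test_lipschitz[OF test_partial_deriv[OF assms]] by metis
  then obtain K where K: "\<And>i. K i > 0"
      "\<And>i x y. \<bar>partial_deriv i \<phi> x - partial_deriv i \<phi> y\<bar> \<le> K i * norm (x - y)" by metis
  define L where "L = (\<Sum>i\<in>UNIV. K i)"
  have L: "L > 0" unfolding L_def by (intro sum_pos K) auto
  have "norm (\<phi> (x + t) - \<phi> x - (\<Sum>i\<in>UNIV. partial_deriv i \<phi> x * t $ i)) \<le> L * (norm t)\<^sup>2" for x t
  proof -
    define h where "h y = \<phi> y - (\<Sum>i\<in>UNIV. partial_deriv i \<phi> x * y $ i)" for y
    have lin: "bounded_linear (\<lambda>s::real^'n. \<Sum>i\<in>UNIV. c i * s $ i)" for c
      by (rule bounded_linear_sum) (rule bounded_linear_const_mult[OF bounded_linear_vec_nth])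
    have D: "(h has_derivative (\<lambda>s. (\<Sum>i\<in>UNIV. partial_deriv i \<phi> y * s $ i) -
        (\<Sum>i\<in>UNIV. partial_deriv i \<phi> x * s $ i))) (at y within cball x (norm t))" for y
      unfolding h_def
      by (rule has_derivative_diff[OF has_derivative_at_withinI[OF smooth_has_derivative[OF
          test_smooth[OF assms]]]
          bounded_linear_imp_has_derivative[OF lin]])
    have "norm (h (x + t) - h x) \<le> (L * norm t) * norm (x + t - x)"
    proof (rule differentiable_bound[OF convex_cball D])
      fix y assume y: "y \<in> cball x (norm t)"
      show "onorm (\<lambda>s. (\<Sum>i\<in>UNIV. partial_deriv i \<phi> y * s $ i) -
        (\<Sum>i\<in>UNIV. partial_deriv i \<phi> x * s $ i)) \<le> L * norm t"
      proof (rule onorm_le)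
        fix s
        have "norm ((\<Sum>i\<in>UNIV. partial_deriv i \<phi> y * s $ i) - (\<Sum>i\<in>UNIV. partial_deriv i \<phi> x * s $ i))
            = \<bar>\<Sum>i\<in>UNIV. (partial_deriv i \<phi> y - partial_deriv i \<phi> x) * s $ i\<bar>"
          by (simp add: sum_subtractf left_diff_distrib)
        also have "\<dots> \<le> (\<Sum>i\<in>UNIV. \<bar>(partial_deriv i \<phi> y - partial_deriv i \<phi> x) * s $ i\<bar>)"
          by (rule sum_abs)
        also have "\<dots> \<le> (\<Sum>i\<in>UNIV. (K i * norm t) * norm s)"
        proof (rule sum_mono)
          fix i
          have "\<bar>partial_deriv i \<phi> y - partial_deriv i \<phi> x\<bar> \<le> K i * norm (y - x)" by (rule K(2))
          also have "\<dots> \<le> K i * norm t"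
            using K(1)[of i] y by (intro mult_left_mono) (auto simp: dist_norm norm_minus_commute)
          finally have "\<bar>partial_deriv i \<phi> y - partial_deriv i \<phi> x\<bar> \<le> K i * norm t" .
          then show "\<bar>(partial_deriv i \<phi> y - partial_deriv i \<phi> x) * s $ i\<bar> \<le> K i * norm t * norm s"
            unfolding abs_mult by (rule mult_mono) (auto simp: component_le_norm_cart less_imp_le[OF
                K(1)])
        qed
        also have "\<dots> = L * norm t * norm s" by (simp add: L_def sum_distrib_right)
        finally show "norm ((\<Sum>i\<in>UNIV. partial_deriv i \<phi> y * s $ i) -
          (\<Sum>i\<in>UNIV. partial_deriv i \<phi> x * s $ i)) \<le> L * norm t * norm s" .
      qed
    qed (auto simp: dist_norm)
    moreover have "h (x + t) - h x = \<phi> (x + t) - \<phi> x - (\<Sum>i\<in>UNIV. partial_deriv i \<phi> x * t $ i)"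
      by (simp add: h_def sum.distrib distrib_left)
    ultimately show ?thesis by (simp add: power2_eq_square mult.assoc)
  qed
  then show ?thesis using that L by auto
qed

section \<open>Symmetry of second partial derivatives\<close>

lemma has_derivative_along_axis:
  assumes "f differentiable (at (x + s *\<^sub>R axis i 1))"
  shows "((\<lambda>s. f (x + s *\<^sub>R axis i 1)) has_real_derivative partial_deriv i f (x + s *\<^sub>R axis i 1))
      (at s)"
proof -
  have h: "((\<lambda>s. x + s *\<^sub>R axis i 1) has_derivative (\<lambda>t. t *\<^sub>R axis i 1)) (at s)"
    by (auto intro!: derivative_eq_intros)
  have e: "(\<Sum>k\<in>UNIV. partial_deriv k f y * (t *\<^sub>R axis i 1) $ k) = partial_deriv i f y * t" for t y
    by (simp add: axis_def if_distrib mult.commute cong: if_cong)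
  from has_derivative_compose[OF h differentiable_has_derivative_partials[OF assms]]
  show ?thesis unfolding has_field_derivative_def o_def e .
qed

lemma partial_deriv_mvt:
  assumes "\<And>y. f differentiable (at y)" "h > 0"
  obtains \<theta> where "0 < \<theta>" "\<theta> < h"
    "f (x + h *\<^sub>R axis i 1) - f x = h * partial_deriv i f (x + \<theta> *\<^sub>R axis i 1)"
  using MVT2[OF assms(2), of "\<lambda>s. f (x + s *\<^sub>R axis i 1)" "\<lambda>s. partial_deriv i f (x + s *\<^sub>R axis i 1)"]
    has_derivative_along_axis[OF assms(1)] by force

text \<open>The mean value theorem is applied to the increment of g in direction j, seen as a
  function along direction i, and then once more along j. Each of the two displacements is shorter
  than h, so p stays within 2 h of x.\<close>

lemma mixed_difference_mvt:
  fixes g :: "real^'n::finite \<Rightarrow> real"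
  assumes g: "smooth g" and h: "h > 0"
  obtains p where "norm (p - x) \<le> 2 * h"
    "g (x + h *\<^sub>R axis i 1 + h *\<^sub>R axis j 1) - g (x + h *\<^sub>R axis i 1) - g (x + h *\<^sub>R axis j 1) + g x
      = h\<^sup>2 * partial_deriv j (partial_deriv i g) p"
proof -
  \<comment> \<open>The factor -1 in place of a subtraction matches the closure rules
    \<open>smooth_add\<close> and \<open>smooth_mult\<close>.\<close>
  define u where "u y = g (y + h *\<^sub>R axis j 1) + (-1) * g y" for y
  have su: "smooth u"
    unfolding u_def using smooth_affine[OF g, of 1 "h *\<^sub>R axis j 1"] g
    by (intro smooth_add smooth_mult smooth_const) simp_all
  obtain \<theta> where \<theta>: "0 < \<theta>" "\<theta> < h"
      "u (x + h *\<^sub>R axis i 1) - u x = h * partial_deriv i u (x + \<theta> *\<^sub>R axis i 1)"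
    using partial_deriv_mvt[of u h x i] smooth_differentiable[OF su] h by blast
  define q where "q = x + \<theta> *\<^sub>R axis i 1"
  have "partial_deriv i u q = partial_deriv i g (q + h *\<^sub>R axis j 1) - partial_deriv i g q"
    using partial_deriv_affine(1)[where f=g and c=1 and y="h *\<^sub>R axis j 1" and x=q and i=i]
      partial_deriv_affine(2)[where f=g and c=1 and y="h *\<^sub>R axis j 1" and x=q]
      partial_deriv_add[of "\<lambda>y. g (y + h *\<^sub>R axis j 1)" q "\<lambda>y. (-1) * g y" i]
      partial_deriv_cmult[of g q i "-1"] smooth_differentiable[OF g]
      differentiable_mult[OF differentiable_const smooth_differentiable[OF g], of "-1"]
    unfolding u_def by simp
  moreover obtain \<eta> where \<eta>: "0 < \<eta>" "\<eta> < h"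
      "partial_deriv i g (q + h *\<^sub>R axis j 1) - partial_deriv i g q
        = h * partial_deriv j (partial_deriv i g) (q + \<eta> *\<^sub>R axis j 1)"
    using partial_deriv_mvt[of "partial_deriv i g" h q j] smooth_differentiable[OF
        smooth_partial_deriv[OF g]] h
    by blast
  ultimately have e: "u (x + h *\<^sub>R axis i 1) - u x = h * (h * partial_deriv j (partial_deriv i g) (q
      + \<eta> *\<^sub>R axis j 1))"
    using \<theta>(3) by (simp add: q_def)
  show ?thesis
  proof
    have "norm (q + \<eta> *\<^sub>R axis j 1 - x) \<le> norm (\<theta> *\<^sub>R (axis i 1 :: real^'n))
        + norm (\<eta> *\<^sub>R (axis j 1 :: real^'n))"
      unfolding q_def using norm_triangle_ineq[of "\<theta> *\<^sub>R (axis i 1 :: real^'n)" "\<eta> *\<^sub>R axis j 1"]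
      by (simp add: algebra_simps)
    then show "norm (q + \<eta> *\<^sub>R axis j 1 - x) \<le> 2 * h" using \<theta> \<eta> by (simp add: norm_axis_1)
  qed (use e in \<open>simp add: u_def power2_eq_square algebra_simps\<close>)
qed

text \<open>The second difference is symmetric in i and j, so for every h > 0 the two mixed
  derivatives take a common value at points within 2 h of x. Continuity of both lets h tend to
  0.\<close>

lemma partial_deriv_commute:
  fixes g :: "real^'n::finite \<Rightarrow> real"
  assumes g: "smooth g"
  shows "partial_deriv i (partial_deriv j g) = partial_deriv j (partial_deriv i g)"
proof
  fix x
  have ex: "\<exists>p q. norm (p - x) \<le> 2 * h \<and> norm (q - x) \<le> 2 * h \<and>
      partial_deriv j (partial_deriv i g) p = partial_deriv i (partial_deriv j g) q" if h: "h > 0" for h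
  proof -
    obtain p where p: "norm (p - x) \<le> 2 * h"
      "g (x + h *\<^sub>R axis i 1 + h *\<^sub>R axis j 1) - g (x + h *\<^sub>R axis i 1) - g (x + h *\<^sub>R axis j 1) + g x
      = h\<^sup>2 * partial_deriv j (partial_deriv i g) p"
      using mixed_difference_mvt[OF g h] by blast
    obtain q where q: "norm (q - x) \<le> 2 * h"
      "g (x + h *\<^sub>R axis j 1 + h *\<^sub>R axis i 1) - g (x + h *\<^sub>R axis j 1) - g (x + h *\<^sub>R axis i 1) + g x
      = h\<^sup>2 * partial_deriv i (partial_deriv j g) q"
      using mixed_difference_mvt[OF g h] by blast
    have "h\<^sup>2 * partial_deriv j (partial_deriv i g) p = h\<^sup>2 * partial_deriv i (partial_deriv j g) q"
      using p(2) q(2) by (simp add: algebra_simps)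
    then show ?thesis using p(1) q(1) h by auto
  qed
  have "\<forall>n. \<exists>p q. norm (p - x) \<le> 2 * (1 / real (Suc n)) \<and> norm (q - x) \<le> 2 * (1 / real (Suc n)) \<and>
      partial_deriv j (partial_deriv i g) p = partial_deriv i (partial_deriv j g) q"
    by (intro allI ex) simp
  then obtain p q where pq: "\<And>n. norm (p n - x) \<le> 2 * (1 / real (Suc n))"
    "\<And>n. norm (q n - x) \<le> 2 * (1 / real (Suc n))"
    "\<And>n. partial_deriv j (partial_deriv i g) (p n) = partial_deriv i (partial_deriv j g) (q n)"
    by metis
  have z: "(\<lambda>n. 2 * (1 / real (Suc n))) \<longlonglongrightarrow> 0"
    using tendsto_mult_left[OF LIMSEQ_Suc[OF lim_1_over_n], of 2] by simp
  have lim: "r \<longlonglongrightarrow> x" if "\<And>n. norm (r n - x) \<le> 2 * (1 / real (Suc n))" for r :: "nat \<Rightarrow> real^'n"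
    by (rule LIM_zero_cancel[OF Lim_null_comparison[OF always_eventually z]]) (use that in blast)
  have c: "isCont (partial_deriv a (partial_deriv b g)) x" for a b
    using smooth_continuous[OF smooth_partial_deriv[OF smooth_partial_deriv[OF g]], of UNIV]
    by (simp add: continuous_on_eq_continuous_at)
  have "(\<lambda>n. partial_deriv j (partial_deriv i g) (p n)) \<longlonglongrightarrow> partial_deriv j (partial_deriv i g) x"
    by (rule isCont_tendsto_compose[OF c lim]) (rule pq(1))
  moreover have "(\<lambda>n. partial_deriv i (partial_deriv j g) (q n)) \<longlonglongrightarrow> partial_deriv i (partial_deriv j g) x"
    by (rule isCont_tendsto_compose[OF c lim]) (rule pq(2))
  ultimately show "partial_deriv i (partial_deriv j g) x = partial_deriv j (partial_deriv i g) x"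
    unfolding pq(3) by (rule LIMSEQ_unique[rotated])
qed

section \<open>Integration of test functions\<close>

lemma integrable_continuous_compact_support:
  fixes f :: "real^'n::finite \<Rightarrow> real"
  assumes "continuous_on UNIV f" "\<And>x. norm x > r \<Longrightarrow> f x = 0"
  shows "integrable lborel f"
proof -
  have "integrable lborel (\<lambda>x. indicator (cball 0 r) x *\<^sub>R f x)"
    by (intro borel_integrable_compact continuous_on_subset[OF assms(1)]) auto
  also have "(\<lambda>x. indicator (cball 0 r) x *\<^sub>R f x) = f"
    using assms(2) by (auto simp: indicator_def fun_eq_iff not_le[symmetric])
  finally show ?thesis .
qed

lemma integral_translate:
  fixes f :: "real^'n::finite \<Rightarrow> real"
  assumes "f \<in> borel_measurable borel"
  shows "(\<integral>x. f (x + c) \<partial>lborel) = (\<integral>x. f x \<partial>lborel)"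
proof -
  have "(\<integral>x. f x \<partial>lborel) = (\<integral>x. f x \<partial>distr lborel borel ((+) c))"
    by (simp only: lborel_distr_plus)
  also have "\<dots> = (\<integral>x. f (c + x) \<partial>lborel)"
    by (rule integral_distr) (use assms in auto)
  finally show ?thesis by (simp add: add.commute)
qed

text \<open>The difference quotients of f integrate to 0 by translation invariance of Lebesgue
  measure. They converge pointwise to the derivative, are bounded by its maximum and are supported
  in one ball, so dominated convergence transfers the value 0.\<close>

lemma integral_partial_deriv_eq_0:
  fixes f :: "real^'n::finite \<Rightarrow> real"
  assumes f: "\<And>x. f differentiable (at x)" and c: "continuous_on UNIV (partial_deriv i f)"
    and r: "\<And>x. norm x > r \<Longrightarrow> f x = 0"
  shows "(\<integral>x. partial_deriv i f x \<partial>lborel) = 0"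
proof -
  define h where "h k = 1 / real (Suc k)" for k
  have h: "h k > 0" "h k \<le> 1" for k by (auto simp: h_def)
  define d where "d k x = (f (x + h k *\<^sub>R axis i 1) - f x) / h k" for k x
  obtain K where K: "K > 0" "\<And>x. \<bar>partial_deriv i f x\<bar> \<le> K"
    using continuous_compact_support_bounded[OF c, of r] partial_deriv_zero_outside[of r f _ i] r
        by metis
  have cf: "continuous_on UNIV f"
    using f by (auto intro!: continuous_at_imp_continuous_on differentiable_imp_continuous_within)
  then have [measurable]: "f \<in> borel_measurable borel" by (rule borel_measurable_continuous_onI)
  have [measurable]: "partial_deriv i f \<in> borel_measurable borel"
    using c by (rule borel_measurable_continuous_onI)
  have "(\<lambda>k. \<integral>x. d k x \<partial>lborel) \<longlonglongrightarrow> (\<integral>x. partial_deriv i f x \<partial>lborel)"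
  proof (rule integral_dominated_convergence)
    \<comment> \<open>The radius r + 1 covers all shifted supports, because the shifts
      \<open>h k\<close> are at most 1.\<close>
    show "integrable lborel (\<lambda>x::real^'n. K * indicator (cball 0 (r + 1)) x)"
      by (intro integrable_mult_right integrable_real_indicator) (use emeasure_lborel_cball_finite[of
          "0::real^'n" "r + 1"] in auto)
    show "AE x in lborel. (\<lambda>k. d k x) \<longlonglongrightarrow> partial_deriv i f x"
    proof (rule AE_I2)
      fix x
      have "((\<lambda>s. f (x + s *\<^sub>R axis i 1)) has_real_derivative partial_deriv i f (x + 0 *\<^sub>R axis i 1))
          (at 0)"
        by (rule has_derivative_along_axis) (rule f)
      then have *: "((\<lambda>s. (f (x + s *\<^sub>R axis i 1) - f x) / s) \<longlongrightarrow> partial_deriv i f x) (at 0)"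
        by (simp add: has_field_derivative_iff)
      have "filterlim h (at 0) sequentially"
        unfolding filterlim_at h_def using LIMSEQ_Suc[OF lim_1_over_n] by auto
      from filterlim_compose[OF * this] show "(\<lambda>k. d k x) \<longlonglongrightarrow> partial_deriv i f x"
        by (simp add: d_def)
    qed
    show "AE x in lborel. norm (d k x) \<le> K * indicator (cball 0 (r + 1)) x" for k
    proof (rule AE_I2)
      fix x
      obtain \<theta> where "f (x + h k *\<^sub>R axis i 1) - f x = h k * partial_deriv i f (x + \<theta> *\<^sub>R axis i 1)"
        using partial_deriv_mvt[OF f h(1)] by blast
      then have "d k x = partial_deriv i f (x + \<theta> *\<^sub>R axis i 1)" using h(1)[of k] by (simp add: d_def)
      then have dK: "\<bar>d k x\<bar> \<le> K" using K(2) by simp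
      show "norm (d k x) \<le> K * indicator (cball 0 (r + 1)) x"
      proof (cases "norm x \<le> r + 1")
        case False
        have "norm (h k *\<^sub>R (axis i 1 :: real^'n)) \<le> 1" using h[of k] by (simp add: norm_axis_1)
        then have "norm (x + h k *\<^sub>R axis i 1) > r"
          using norm_diff_ineq[of x "h k *\<^sub>R axis i 1"] False by linarith
        then show ?thesis using r False K(1) by (simp add: d_def)
      qed (use dK in simp)
    qed
  qed (simp_all add: d_def)
  moreover have "(\<integral>x. d k x \<partial>lborel) = 0" for k
  proof -
    have if': "integrable lborel f" by (rule integrable_continuous_compact_support[OF cf]) (rule r)
    have "integrable lborel (\<lambda>x. f (x + h k *\<^sub>R axis i 1))"
    proof (rule integrable_continuous_compact_support)
      show "continuous_on UNIV (\<lambda>x. f (x + h k *\<^sub>R axis i 1))"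
        by (intro continuous_on_compose2[OF cf] continuous_intros) auto
      fix x :: "real^'n" assume "norm x > r + 1"
      moreover have "norm (h k *\<^sub>R (axis i 1 :: real^'n)) \<le> 1" using h[of k] by (simp add: norm_axis_1)
      ultimately have "norm (x + h k *\<^sub>R axis i 1) > r"
        using norm_diff_ineq[of x "h k *\<^sub>R axis i 1"] by linarith
      then show "f (x + h k *\<^sub>R axis i 1) = 0" by (rule r)
    qed
    then show ?thesis using if' by (simp add: d_def integral_translate)
  qed
  ultimately show ?thesis by (simp add: LIMSEQ_const_iff)
qed

lemma test_borel [measurable_dest]: "\<phi> \<in> test_functions \<Longrightarrow> \<phi> \<in> borel_measurable borel"
  by (intro borel_measurable_continuous_onI smooth_continuous test_smooth)

lemma test_integrable: "\<phi> \<in> test_functions \<Longrightarrow> integrable lebesgue \<phi>"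
proof -
  assume \<phi>: "\<phi> \<in> test_functions"
  obtain r where "\<And>x. norm x > r \<Longrightarrow> \<phi> x = 0" using testE \<phi> by metis
  then have "integrable lborel \<phi>"
    using integrable_continuous_compact_support[OF smooth_continuous[OF test_smooth[OF \<phi>]]] by metis
  then show ?thesis using test_borel[OF \<phi>] by (simp add: integrable_completion)
qed

lemma test_integral_partial_deriv:
  assumes "\<phi> \<in> test_functions"
  shows "(\<integral>x. partial_deriv i \<phi> x \<partial>lebesgue) = 0"
proof -
  have "(\<integral>x. partial_deriv i \<phi> x \<partial>lebesgue) = (\<integral>x. partial_deriv i \<phi> x \<partial>lborel)"
    by (rule integral_completion) (use test_borel[OF test_partial_deriv[OF assms]] in simp)
  also have "\<dots> = 0"
    using integral_partial_deriv_eq_0[OF smooth_differentiable[OF test_smooth[OF assms]]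
        smooth_continuous[OF smooth_partial_deriv[OF test_smooth[OF assms]]]] testE[OF assms] by metis
  finally show ?thesis .
qed

text \<open>Compact support of one factor suffices. The other factor will be the vector field of
  Hardy's inequality or a derivative of a harmonic function, neither of which has compact support in
  general.\<close>

lemma integral_by_parts:
  assumes f: "smooth f" and \<phi>: "\<phi> \<in> test_functions"
  shows "(\<integral>x. f x * partial_deriv i \<phi> x \<partial>lebesgue) = - (\<integral>x. partial_deriv i f x * \<phi> x \<partial>lebesgue)"
proof -
  have "partial_deriv i (\<lambda>x. f x * \<phi> x) = (\<lambda>x. f x * partial_deriv i \<phi> x + partial_deriv i f x * \<phi> x)"
    by (rule ext) (intro partial_deriv_mult smooth_differentiable f test_smooth[OF \<phi>])
  then have "(\<integral>x. f x * partial_deriv i \<phi> x + partial_deriv i f x * \<phi> x \<partial>lebesgue) = 0"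
    using test_integral_partial_deriv[OF test_mult[OF f \<phi>], of i] by simp
  moreover have "integrable lebesgue (\<lambda>x. f x * partial_deriv i \<phi> x)"
    by (intro test_integrable test_mult f test_partial_deriv \<phi>)
  moreover have "integrable lebesgue (\<lambda>x. partial_deriv i f x * \<phi> x)"
    by (intro test_integrable test_mult smooth_partial_deriv f \<phi>)
  ultimately show ?thesis by (simp add: eq_neg_iff_add_eq_0)
qed

text \<open>Both sides equal minus the integral of f against the mixed second derivative of g. This
  is the source of \<open>grad_space_swap\<close> and thereby of Korn's inequality.\<close>

lemma integral_partial_deriv_swap:
  assumes f: "f \<in> test_functions" and g: "g \<in> test_functions"
  shows "(\<integral>x. partial_deriv i f x * partial_deriv j g x \<partial>lebesgue)
       = (\<integral>x. partial_deriv j f x * partial_deriv i g x \<partial>lebesgue)"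
  using integral_by_parts[OF test_smooth[OF f] test_partial_deriv[OF g], of i j]
    integral_by_parts[OF test_smooth[OF f] test_partial_deriv[OF g], of j i]
  by (simp add: partial_deriv_commute[OF test_smooth[OF g], of i j])

section \<open>Square integrable functions\<close>

lemma L2_measurable: "f \<in> L2 \<Longrightarrow> f \<in> borel_measurable lebesgue"
  and L2_integrable_square: "f \<in> L2 \<Longrightarrow> integrable lebesgue (\<lambda>x. (f x)\<^sup>2)"
  by (auto simp: L2_def)

lemma L2_mult_integrable:
  assumes "f \<in> L2" "g \<in> L2"
  shows "integrable lebesgue (\<lambda>x. f x * g x)"
proof (rule Bochner_Integration.integrable_bound)
  show "integrable lebesgue (\<lambda>x. (f x)\<^sup>2 + (g x)\<^sup>2)"
    using assms by (intro Bochner_Integration.integrable_add L2_integrable_square)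
  show "(\<lambda>x. f x * g x) \<in> borel_measurable lebesgue"
    using assms by (intro borel_measurable_times L2_measurable)
  show "AE x in lebesgue. norm (f x * g x) \<le> norm ((f x)\<^sup>2 + (g x)\<^sup>2)"
  proof (rule AE_I2)
    fix x
    have "2 * \<bar>f x\<bar> * \<bar>g x\<bar> \<le> \<bar>f x\<bar>\<^sup>2 + \<bar>g x\<bar>\<^sup>2" by (rule sum_squares_bound)
    moreover have "0 \<le> \<bar>f x\<bar> * \<bar>g x\<bar>" by simp
    ultimately have "\<bar>f x\<bar> * \<bar>g x\<bar> \<le> (f x)\<^sup>2 + (g x)\<^sup>2"
      unfolding power2_abs mult.assoc by linarith
    then show "norm (f x * g x) \<le> norm ((f x)\<^sup>2 + (g x)\<^sup>2)" by (simp add: abs_mult)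
  qed
qed

lemma L2_add:
  assumes "f \<in> L2" "g \<in> L2" shows "(\<lambda>x. f x + g x) \<in> L2"
proof -
  have "(\<lambda>x. (f x + g x)\<^sup>2) = (\<lambda>x. (f x)\<^sup>2 + (g x)\<^sup>2 + 2 * (f x * g x))"
    by (auto simp: power2_eq_square algebra_simps)
  then show ?thesis
    using assms L2_mult_integrable[OF assms] by (auto simp: L2_def)
qed

lemma L2_cmult: "f \<in> L2 \<Longrightarrow> (\<lambda>x. c * f x) \<in> L2"
  by (auto simp: L2_def power_mult_distrib)

lemma L2_zero: "(\<lambda>x. 0) \<in> L2"
  by (simp add: L2_def)

lemma L2_bounded_mult:
  assumes f: "f \<in> L2" and a: "a \<in> borel_measurable lebesgue" "AE x in lebesgue. \<bar>a x\<bar> \<le> K"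
  shows "(\<lambda>x. a x * f x) \<in> L2"
proof -
  have [measurable]: "f \<in> borel_measurable lebesgue" "a \<in> borel_measurable lebesgue"
    using a(1) L2_measurable[OF f] by auto
  have "integrable lebesgue (\<lambda>x. (a x * f x)\<^sup>2)"
  proof (rule Bochner_Integration.integrable_bound)
    show "integrable lebesgue (\<lambda>x. K\<^sup>2 * (f x)\<^sup>2)"
      using f by (intro integrable_mult_right L2_integrable_square)
    show "AE x in lebesgue. norm ((a x * f x)\<^sup>2) \<le> norm (K\<^sup>2 * (f x)\<^sup>2)"
      using a(2)
    proof eventually_elim
      case (elim x)
      then have "(a x)\<^sup>2 \<le> K\<^sup>2" by (metis abs_ge_zero power2_abs power_mono)
      then show ?case by (simp add: power_mult_distrib mult_right_mono)
    qed
  qed simp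
  then show ?thesis by (simp add: L2_def)
qed

lemma test_L2: "\<phi> \<in> test_functions \<Longrightarrow> \<phi> \<in> L2"
  using test_integrable[OF test_mult[OF test_smooth]]
  by (auto simp: L2_def power2_eq_square dest: borel_measurable_integrable[OF test_integrable])

section \<open>The weight of the space \<open>H1\<close>\<close>

lemma rho_pos: "rho x > 0"
  by (simp add: rho_def add_pos_nonneg)

lemma rho_nonzero [simp]: "rho x \<noteq> 0"
  using rho_pos[of x] by simp

lemma rho_ge_1: "rho x \<ge> 1"
  by (simp add: rho_def)

lemma rho_square: "(rho x)\<^sup>2 = 1 + (norm x)\<^sup>2"
  by (simp add: rho_def)

lemma continuous_rho: "continuous_on A rho"
  unfolding rho_def by (intro continuous_intros)

lemma rho_borel [measurable]: "rho \<in> borel_measurable borel"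
  using continuous_rho by (rule borel_measurable_continuous_onI)

lemma rho_lebesgue [measurable]: "rho \<in> borel_measurable lebesgue"
  using rho_borel by (auto intro: measurable_completion)

lemma test_rho_L2:
  assumes "\<phi> \<in> test_functions" shows "(\<lambda>x. rho x * \<phi> x) \<in> L2"
proof -
  have c: "continuous_on UNIV (\<lambda>x. rho x * \<phi> x)"
    by (intro continuous_on_mult continuous_rho smooth_continuous test_smooth assms)
  obtain r where "\<And>x. norm x > r \<Longrightarrow> \<phi> x = 0" using testE assms by metis
  then have "integrable lborel (\<lambda>x. (rho x * \<phi> x)\<^sup>2)"
    by (intro integrable_continuous_compact_support[of _ r] continuous_on_power c) auto
  moreover have "(\<lambda>x. rho x * \<phi> x) \<in> borel_measurable borel" using c
      by (rule borel_measurable_continuous_onI)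
  ultimately show ?thesis by (auto simp: L2_def integrable_completion intro!: measurable_completion)
qed

lemma test_over_rho_L2: "\<phi> \<in> test_functions \<Longrightarrow> (\<lambda>x. \<phi> x / rho x) \<in> L2"
proof -
  assume "\<phi> \<in> test_functions"
  then have "(\<lambda>x. (1 / rho x) * \<phi> x) \<in> L2"
    using rho_ge_1 by (intro L2_bounded_mult[where K=1] test_L2) (auto simp: abs_of_pos rho_pos
        divide_le_eq_1)
  then show ?thesis by simp
qed

text \<open>The product splits into f / rho and rho \<phi>, both square integrable. Thus functions
  in the weighted space act as distributions.\<close>

lemma weighted_mult_test_integrable:
  assumes "(\<lambda>x. f x / rho x) \<in> L2" "\<phi> \<in> test_functions"
  shows "integrable lebesgue (\<lambda>x. f x * \<phi> x)"
proof -
  have "(\<lambda>x. (f x / rho x) * (rho x * \<phi> x)) = (\<lambda>x. f x * \<phi> x)"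
    by (simp add: fun_eq_iff)
  then show ?thesis using L2_mult_integrable[OF assms(1) test_rho_L2[OF assms(2)]] by simp
qed

section \<open>The fundamental lemma of the calculus of variations\<close>

lemma compact_indicator_rho_L2:
  assumes "compact S" shows "(\<lambda>x. indicator S x * rho x) \<in> L2"
proof -
  have "integrable lborel (\<lambda>x. indicator S x *\<^sub>R (rho x)\<^sup>2)"
    by (intro borel_integrable_compact assms continuous_on_power continuous_rho)
  moreover have "(\<lambda>x. (indicator S x * rho x)\<^sup>2) = (\<lambda>x. indicator S x *\<^sub>R (rho x)\<^sup>2)"
    by (auto simp: indicator_def)
  moreover have "S \<in> sets borel" using assms by (rule borel_compact)
  ultimately show ?thesis by (auto simp: L2_def integrable_completion intro!: measurable_completion)
qed

lemma weighted_L2_locally_integrable: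
  assumes "(\<lambda>x. f x / rho x) \<in> L2" "compact S"
  shows "integrable lebesgue (\<lambda>x. f x * indicator S x)"
proof -
  have "(\<lambda>x. (f x / rho x) * (indicator S x * rho x)) = (\<lambda>x. f x * indicator S x)"
    by (simp add: fun_eq_iff)
  then show ?thesis using L2_mult_integrable[OF assms(1) compact_indicator_rho_L2[OF assms(2)]] by simp
qed

lemma weighted_L2_measurable:
  assumes "(\<lambda>x. f x / rho x) \<in> L2"
  shows "f \<in> borel_measurable lebesgue"
proof -
  have "(\<lambda>x. (f x / rho x) * rho x) \<in> borel_measurable lebesgue"
    by (intro borel_measurable_times L2_measurable assms rho_lebesgue)
  then show ?thesis by simp
qed

section \<open>Smooth approximation of the indicator of a box\<close>

lemma flat_1: "flat 1 t = (if t > 0 then exp (- (1 / t)) else 0)"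
  by (simp add: flat_def)

lemma flat_1_bounds: "0 \<le> flat 1 t" "flat 1 t \<le> 1"
  by (auto simp: flat_1)

lemma flat_1_tendsto: "s > 0 \<Longrightarrow> (\<lambda>k. flat 1 (real (Suc k) * s)) \<longlonglongrightarrow> 1"
proof -
  assume s: "s > 0"
  have "(\<lambda>k. exp (- ((1 / real (Suc k)) * (1 / s)))) \<longlonglongrightarrow> exp (- (0 * (1 / s)))"
    by (intro tendsto_intros LIMSEQ_Suc[OF lim_1_over_n])
  moreover have "flat 1 (real (Suc k) * s) = exp (- ((1 / real (Suc k)) * (1 / s)))" for k
  proof -
    have "real (Suc k) * s > 0" using s by (intro mult_pos_pos) auto
    then show ?thesis by (simp add: flat_1)
  qed
  ultimately show ?thesis by simp
qed

text \<open>One factor \<open>flat 1\<close> for each face of the box, steepened with k: the product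
  vanishes outside the box and tends to 1 inside. \<open>Suc k\<close> keeps the scale
  positive.\<close>

definition box_bump :: "real^'n::finite \<Rightarrow> real^'n \<Rightarrow> nat \<Rightarrow> real^'n \<Rightarrow> real" where
  "box_bump a b k x = (\<Prod>i\<in>UNIV. flat 1 (real (Suc k) * (x $ i - a $ i)) * flat 1 (real (Suc k) * (b $ i
      - x $ i)))"

lemma box_bump_outside: "x \<notin> box a b \<Longrightarrow> box_bump a b k x = 0"
proof -
  assume "x \<notin> box a b"
  then obtain i where "\<not> (a $ i < x $ i \<and> x $ i < b $ i)" by (auto simp: mem_box_cart)
  then have "flat 1 (real (Suc k) * (x $ i - a $ i)) * flat 1 (real (Suc k) * (b $ i - x $ i)) = 0"
    by (auto simp: flat_1 zero_less_mult_iff)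
  then show ?thesis unfolding box_bump_def by (intro prod_zero) auto
qed

lemma box_bump_bounds: "0 \<le> box_bump a b k x" "box_bump a b k x \<le> 1"
  unfolding box_bump_def
  by (auto intro!: prod_nonneg prod_le_1 mult_nonneg_nonneg mult_le_one flat_1_bounds)

lemma box_bump_test: "box_bump a b k \<in> test_functions"
proof -
  have "bounded (box a b)" by (rule bounded_box)
  then obtain r where r: "\<And>x. x \<in> box a b \<Longrightarrow> norm x \<le> r" using bounded_iff by metis
  show ?thesis
  proof (rule testI[of _ r])
    have "smooth (\<lambda>x::real^'a. flat 1 (real (Suc k) * x $ i + (- real (Suc k) * a $ i)) *
        flat 1 ((- real (Suc k)) * x $ i + real (Suc k) * b $ i))" for i
      by (intro smooth_mult smooth_flat_coord)
    then show "smooth (box_bump a b k)"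
      unfolding box_bump_def by (intro smooth_prod) (simp_all add: algebra_simps)
    show "box_bump a b k x = 0" if "norm x > r" for x using box_bump_outside r that by force
  qed
qed

lemma box_bump_tendsto: "(\<lambda>k. box_bump a b k x) \<longlonglongrightarrow> indicator (box a b) x"
proof (cases "x \<in> box a b")
  case True
  then have "(\<lambda>k. box_bump a b k x) \<longlonglongrightarrow> (\<Prod>i\<in>(UNIV::'a set). 1 * 1)"
    unfolding box_bump_def by (intro tendsto_prod tendsto_mult flat_1_tendsto) (auto simp: mem_box_cart)
  then show ?thesis using True by simp
qed (simp add: box_bump_outside)

lemma integral_box_eq_0:
  assumes z: "(\<lambda>x. z x / rho x) \<in> L2"
    and orth: "\<And>\<phi>. \<phi> \<in> test_functions \<Longrightarrow> (\<integral>x. z x * \<phi> x \<partial>lebesgue) = 0"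
  shows "(\<integral>x. z x * indicator (box a b) x \<partial>lebesgue) = 0"
proof -
  note [measurable] = weighted_L2_measurable[OF z]
  have bm [measurable]: "box_bump a b k \<in> borel_measurable lebesgue" for k
    using test_borel[OF box_bump_test, of a b k] by (auto intro: measurable_completion)
  have [measurable]: "box a b \<in> sets lebesgue" by (intro fmeasurableD lmeasurable_box)
  have "(\<lambda>k. \<integral>x. z x * box_bump a b k x \<partial>lebesgue) \<longlonglongrightarrow> (\<integral>x. z x * indicator (box a b) x \<partial>lebesgue)"
  proof (rule integral_dominated_convergence)
    \<comment> \<open>The bumps live on the open box, but the dominating function is taken on the
      closed one because local integrability is stated for compact sets.\<close>
    show "integrable lebesgue (\<lambda>x. \<bar>z x * indicator (cbox a b) x\<bar>)"
      by (intro integrable_abs weighted_L2_locally_integrable z compact_cbox)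
    show "AE x in lebesgue. (\<lambda>k. z x * box_bump a b k x) \<longlonglongrightarrow> z x * indicator (box a b) x"
      by (intro AE_I2 tendsto_intros box_bump_tendsto)
    show "AE x in lebesgue. norm (z x * box_bump a b k x) \<le> \<bar>z x * indicator (cbox a b) x\<bar>" for k
    proof (rule AE_I2)
      fix x
      show "norm (z x * box_bump a b k x) \<le> \<bar>z x * indicator (cbox a b) x\<bar>"
      proof (cases "x \<in> box a b")
        case True
        then have "x \<in> cbox a b" using box_subset_cbox by blast
        then show ?thesis using box_bump_bounds[of a b k x]
          by (simp add: abs_mult mult_left_le)
      qed (simp add: box_bump_outside)
    qed
  qed auto
  then show ?thesis by (simp add: orth[OF box_bump_test] LIMSEQ_const_iff)
qed

text \<open>The weighted hypothesis lets the lemma serve both L2 functions and members of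
  \<open>H1\<close>. Since z integrates to 0 over every box, the measures whose densities are the
  positive and the negative part of z agree on boxes, an intersection-stable generator of the Borel
  sets; hence the two parts coincide almost everywhere.\<close>

lemma fundamental_lemma:
  fixes z :: "real^'n::finite \<Rightarrow> real"
  assumes z: "(\<lambda>x. z x / rho x) \<in> L2"
    and orth: "\<And>\<phi>. \<phi> \<in> test_functions \<Longrightarrow> (\<integral>x. z x * \<phi> x \<partial>lebesgue) = 0"
  shows "AE x in lebesgue. z x = 0"
proof -
  have zm: "z \<in> borel_measurable lebesgue" by (rule weighted_L2_measurable[OF z])
  obtain z' where z'[measurable]: "z' \<in> borel_measurable lborel" and ae: "AE x in lborel. z x = z' x"
    using completion_ex_borel_measurable_real[OF zm] by blast
  have ae': "AE x in lebesgue. z x = z' x" using ae by (rule AE_completion)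
  have box: "(\<integral>\<^sup>+x. ennreal (z' x) * indicator (box a b) x \<partial>lborel)
      = (\<integral>\<^sup>+x. ennreal (- z' x) * indicator (box a b) x \<partial>lborel)
    \<and> (\<integral>\<^sup>+x. ennreal (z' x) * indicator (box a b) x \<partial>lborel) \<noteq> \<infinity>" for a b
  proof -
    let ?f = "\<lambda>x. z' x * indicator (box a b) x"
    have zi: "integrable lebesgue (\<lambda>x. z x * indicator (box a b) x)"
    proof (rule Bochner_Integration.integrable_bound[OF weighted_L2_locally_integrable[OF z
        compact_cbox[of a b]]])
      show "(\<lambda>x. z x * indicator (box a b) x) \<in> borel_measurable lebesgue"
        by (intro borel_measurable_times zm borel_measurable_indicator fmeasurableD lmeasurable_box)
      show "AE x in lebesgue. norm (z x * indicator (box a b) x) \<le> norm (z x * indicator (cbox a b) x)"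
        using box_subset_cbox[of a b] by (auto intro!: AE_I2 simp: indicator_def)
    qed
    have fm: "?f \<in> borel_measurable lborel" by measurable
    have aef: "AE x in lebesgue. z x * indicator (box a b) x = ?f x"
      using ae' by eventually_elim simp
    have "integrable lebesgue ?f"
      using zi integrable_cong_AE[OF borel_measurable_integrable[OF zi] measurable_completion[OF fm]
          aef] by simp
    then have fi: "integrable lborel ?f" using fm by (simp add: integrable_completion)
    have "integral\<^sup>L lborel ?f = integral\<^sup>L lebesgue ?f" using fm
        by (rule integral_completion[symmetric])
    also have "\<dots> = 0"
      using integral_cong_AE[OF borel_measurable_integrable[OF zi] measurable_completion[OF fm] aef]
        integral_box_eq_0[OF z orth] by simp
    finally have i0: "integral\<^sup>L lborel ?f = 0" .
    have fin: "(\<integral>\<^sup>+x. ennreal (?f x) \<partial>lborel) \<noteq> \<infinity>" "(\<integral>\<^sup>+x. ennreal (- ?f x) \<partial>lborel) \<noteq> \<infinity>"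
      using fi by (auto simp: real_integrable_def)
    have "ennreal (enn2real (\<integral>\<^sup>+x. ennreal (?f x) \<partial>lborel))
        = ennreal (enn2real (\<integral>\<^sup>+x. ennreal (- ?f x) \<partial>lborel))"
      using i0 real_lebesgue_integral_def[OF fi] by simp
    then have "(\<integral>\<^sup>+x. ennreal (?f x) \<partial>lborel) = (\<integral>\<^sup>+x. ennreal (- ?f x) \<partial>lborel)"
      using fin by (simp only: ennreal_enn2real_if infinity_ennreal_def if_False)
    moreover have "ennreal (?f x) = ennreal (z' x) * indicator (box a b) x"
      "ennreal (- ?f x) = ennreal (- z' x) * indicator (box a b) x" for x
      by (auto simp: indicator_def)
    ultimately show ?thesis using fin by simp
  qed
  \<comment> \<open>\<open>ennreal\<close> sends negative reals to 0, so these densities are the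
    positive and the negative part of z'; they are equal only where z' vanishes.\<close>
  have "density lborel (\<lambda>x. ennreal (z' x)) = density lborel (\<lambda>x. ennreal (- z' x))"
  proof (rule measure_eqI_generator_eq[where E="range (\<lambda>(a, b). box a b)" and \<Omega>=UNIV
        and A="\<lambda>n. box (- (real n *\<^sub>R One)) (real n *\<^sub>R One)"])
    show "Int_stable (range (\<lambda>(a, b). box a b :: (real^'n) set))"
      by (auto simp: Int_stable_def box_Int_box)
    show "emeasure (density lborel (\<lambda>x. ennreal (z' x))) X
        = emeasure (density lborel (\<lambda>x. ennreal (- z' x))) X"
      if "X \<in> range (\<lambda>(a, b). box a b)" for X
      using that box by (auto simp: emeasure_density)
    show "sets (density lborel (\<lambda>x. ennreal (z' x))) = sigma_sets UNIV (range (\<lambda>(a, b). box a b))"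
      "sets (density lborel (\<lambda>x. ennreal (- z' x))) = sigma_sets UNIV (range (\<lambda>(a, b). box a b))"
      by (simp_all add: borel_eq_box)
    show "(\<Union>n. box (- (real n *\<^sub>R One)) (real n *\<^sub>R One)) = (UNIV :: (real^'n) set)"
      by (rule UN_box_eq_UNIV)
    show "emeasure (density lborel (\<lambda>x. ennreal (z' x))) (box (- (real n *\<^sub>R One)) (real n *\<^sub>R One)) \<noteq>
        \<infinity>" for n
      using box[THEN conjunct2] by (simp add: emeasure_density)
  qed auto
  then have "AE x in lborel. ennreal (z' x) = ennreal (- z' x)"
    by (intro sigma_finite_measure.density_unique[OF sigma_finite_lborel]) auto
  then have "AE x in lborel. z' x = 0"
  proof eventually_elim
    case (elim x)
    then show ?case
      by (metis ennreal_neg ennreal_eq_0_iff linorder_le_cases neg_0_le_iff_le neg_le_0_iff_le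
          order_antisym)
  qed
  then have "AE x in lborel. z x = 0" using ae by eventually_elim simp
  then show ?thesis by (rule AE_completion)
qed

section \<open>A Liouville theorem in the weighted space\<close>

text \<open>A cross-correlation: the kernel is \<open>\<eta> (y - x)\<close> and not
  \<open>\<eta> (x - y)\<close>, so that the value at x = 0 is the pairing of z with \<eta>
  itself.\<close>

definition correl :: "(real^'n::finite \<Rightarrow> real) \<Rightarrow> (real^'n \<Rightarrow> real) \<Rightarrow> real^'n \<Rightarrow> real" where
  "correl z \<eta> x = (\<integral>y. z y * \<eta> (y - x) \<partial>lebesgue)"

lemma test_translate: "\<phi> \<in> test_functions \<Longrightarrow> (\<lambda>y. \<phi> (y - x)) \<in> test_functions"
  using test_affine[of \<phi> 1 "- x"] by simp

lemma partial_deriv_translate: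
  "smooth \<phi> \<Longrightarrow> partial_deriv i (\<lambda>y. \<phi> (y - x)) = (\<lambda>y. partial_deriv i \<phi> (y - x))"
  using partial_deriv_affine(1)[of \<phi> 1 _ "- x" i] smooth_differentiable[of \<phi>] by fastforce

context
  fixes z :: "real^'n::finite \<Rightarrow> real"
  assumes z: "(\<lambda>x. z x / rho x) \<in> L2"
begin

lemma correl_integrable:
  "\<eta> \<in> test_functions \<Longrightarrow> integrable lebesgue (\<lambda>y. z y * \<eta> (y - x))"
  by (rule weighted_mult_test_integrable[OF z test_translate])

text \<open>Differentiation under the integral sign, justified by the uniform second order remainder
  of \<open>test_taylor\<close>: for norm t at most 1 the remainder vanishes outside a fixed ball
  about x, and z is integrable on that ball.\<close>

lemma correl_has_derivative:
  assumes \<eta>: "\<eta> \<in> test_functions"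
  shows "(correl z \<eta> has_derivative (\<lambda>t. \<Sum>i\<in>UNIV. - correl z (partial_deriv i \<eta>) x * t $ i)) (at x)"
  unfolding has_derivative_at_alt
proof (intro conjI allI impI)
  let ?L = "\<lambda>t::real^'n. \<Sum>i\<in>UNIV. - correl z (partial_deriv i \<eta>) x * t $ i"
  show "bounded_linear ?L"
    by (rule bounded_linear_sum) (rule bounded_linear_const_mult[OF bounded_linear_vec_nth])
  fix e :: real assume e: "e > 0"
  obtain r where r: "r > 0" "\<And>x. norm x > r \<Longrightarrow> \<eta> x = 0" using testE[OF \<eta>] by metis
  obtain K where K: "K > 0"
    "\<And>x t. \<bar>\<eta> (x + t) - \<eta> x - (\<Sum>i\<in>UNIV. partial_deriv i \<eta> x * t $ i)\<bar> \<le> K * (norm t)\<^sup>2"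
    using test_taylor[OF \<eta>] by metis
  define I where "I = (\<integral>y. \<bar>z y * indicator (cball x (r + 1)) y\<bar> \<partial>lebesgue)"
  have I0: "I \<ge> 0" by (simp add: I_def)
  have zi: "integrable lebesgue (\<lambda>y. \<bar>z y * indicator (cball x (r + 1)) y\<bar>)"
    by (intro integrable_abs weighted_L2_locally_integrable z compact_cball)
  have main: "norm (correl z \<eta> (x + t) - correl z \<eta> x - ?L t) \<le> K * (norm t)\<^sup>2 * I" if t: "norm t \<le> 1"
      for t
  proof -
    define R where "R y = \<eta> (y - x + (- t)) - \<eta> (y - x) - (\<Sum>i\<in>UNIV. partial_deriv i \<eta> (y - x) * (- t) $
        i)" for y
    have Rb: "\<bar>R y\<bar> \<le> K * (norm t)\<^sup>2 * indicator (cball x (r + 1)) y" for y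
    proof (cases "norm (y - x) \<le> r + 1")
      case True
      then show ?thesis using K(2)[of "y - x" "- t"] by (simp add: R_def dist_norm norm_minus_commute)
    next
      case False
      then have "norm (y - x) > r" by simp
      then have "\<eta> (y - x) = 0" "\<And>i. partial_deriv i \<eta> (y - x) = 0"
        using r(2) partial_deriv_zero_outside[of r \<eta>] by auto
      moreover have "norm (y - x + (- t)) > r"
        using False t norm_diff_ineq[of "y - x" "- t"] by simp
      then have "\<eta> (y - x + (- t)) = 0" by (rule r(2))
      ultimately show ?thesis using K(1) by (simp add: R_def)
    qed
    have int1: "integrable lebesgue (\<lambda>y. z y * \<eta> (y - (x + t)))" "integrable lebesgue (\<lambda>y. z y * \<eta> (y
        - x))"
      "\<And>i. integrable lebesgue (\<lambda>y. z y * partial_deriv i \<eta> (y - x))"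
      by (intro correl_integrable \<eta> test_partial_deriv)+
    have eq: "(\<lambda>y. z y * R y) = (\<lambda>y. z y * \<eta> (y - (x + t)) - z y * \<eta> (y - x)
        + (\<Sum>i\<in>UNIV. t $ i * (z y * partial_deriv i \<eta> (y - x))))"
      by (simp add: fun_eq_iff R_def algebra_simps sum_distrib_left sum_negf)
    have "(\<integral>y. z y * R y \<partial>lebesgue) = correl z \<eta> (x + t) - correl z \<eta> x
        + (\<Sum>i\<in>UNIV. t $ i * correl z (partial_deriv i \<eta>) x)"
      unfolding eq correl_def using int1 by simp
    then have "correl z \<eta> (x + t) - correl z \<eta> x - ?L t = (\<integral>y. z y * R y \<partial>lebesgue)"
      by (simp add: sum_negf mult.commute)
    also have "norm \<dots> \<le> (\<integral>y. norm (z y * R y) \<partial>lebesgue)" by (rule integral_norm_bound)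
    also have "\<dots> \<le> (\<integral>y. (K * (norm t)\<^sup>2) * \<bar>z y * indicator (cball x (r + 1)) y\<bar> \<partial>lebesgue)"
    proof (rule integral_mono)
      have "integrable lebesgue (\<lambda>y. z y * R y)"
        unfolding eq
        by (intro Bochner_Integration.integrable_add Bochner_Integration.integrable_diff
            Bochner_Integration.integrable_sum integrable_mult_right int1)
      then show "integrable lebesgue (\<lambda>y. norm (z y * R y))" by (rule integrable_norm)
      show "integrable lebesgue (\<lambda>y. (K * (norm t)\<^sup>2) * \<bar>z y * indicator (cball x (r + 1)) y\<bar>)"
        using zi by (rule integrable_mult_right)
      show "norm (z y * R y) \<le> (K * (norm t)\<^sup>2) * \<bar>z y * indicator (cball x (r + 1)) y\<bar>" for y
        using mult_left_mono[OF Rb[of y] abs_ge_zero[of "z y"]] by (simp add: abs_mult mult_ac)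
    qed
    also have "\<dots> = K * (norm t)\<^sup>2 * I" by (simp add: I_def)
    finally show ?thesis .
  qed
  \<comment> \<open>The summand 1 keeps the denominator positive when I = 0.\<close>
  define d where "d = min 1 (e / (K * I + 1))"
  have KI: "K * I + 1 > 0" using K(1) I0 by (simp add: add_nonneg_pos)
  have "d > 0" using e KI by (simp add: d_def)
  moreover have "norm (correl z \<eta> y - correl z \<eta> x - ?L (y - x)) \<le> e * norm (y - x)" if "norm (y - x)
      < d" for y
  proof -
    have t: "norm (y - x) \<le> 1" "norm (y - x) * (K * I + 1) \<le> e"
      using that KI by (auto simp: d_def field_simps)
    have "norm (correl z \<eta> y - correl z \<eta> x - ?L (y - x)) \<le> K * (norm (y - x))\<^sup>2 * I"
      using main[OF t(1)] by simp
    also have "\<dots> \<le> (norm (y - x) * (K * I + 1)) * norm (y - x)"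
      by (simp add: power2_eq_square algebra_simps)
    also have "\<dots> \<le> e * norm (y - x)" by (intro mult_right_mono t) auto
    finally show ?thesis .
  qed
  ultimately show "\<exists>d>0. \<forall>y. norm (y - x) < d \<longrightarrow>
      norm (correl z \<eta> y - correl z \<eta> x - ?L (y - x)) \<le> e * norm (y - x)" by blast
qed

text \<open>The minus sign comes from the argument y - x. It is kept inside the kernel so that the
  derivative is again a correlation of z with a test function, which makes the class in
  \<open>smooth_correl\<close> stable.\<close>

lemma partial_deriv_correl:
  assumes "\<eta> \<in> test_functions"
  shows "partial_deriv i (correl z \<eta>) = correl z (\<lambda>x. -1 * partial_deriv i \<eta> x)"
proof
  fix x
  show "partial_deriv i (correl z \<eta>) x = correl z (\<lambda>x. -1 * partial_deriv i \<eta> x) x"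
    unfolding partial_deriv_eq[OF correl_has_derivative[OF assms]]
    by (simp add: axis_def if_distrib correl_def cong: if_cong)
qed

lemma smooth_correl:
  assumes "\<eta> \<in> test_functions" shows "smooth (correl z \<eta>)"
proof (rule smooth_coinduct)
  show "correl z \<eta> \<in> correl z ` test_functions" using assms by simp
  show "g differentiable (at x)" if "g \<in> correl z ` test_functions" for g x
    using that correl_has_derivative differentiableI by blast
  show "partial_deriv i g \<in> correl z ` test_functions" if "g \<in> correl z ` test_functions" for g i
    using that partial_deriv_correl test_cmult[OF test_partial_deriv] by blast
qed

lemma correl_harmonic:
  assumes harm: "\<And>\<phi>. \<phi> \<in> test_functions \<Longrightarrow>
      (\<integral>x. z x * (\<Sum>i\<in>UNIV. partial_deriv i (partial_deriv i \<phi>) x) \<partial>lebesgue) = 0"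
    and \<eta>: "\<eta> \<in> test_functions"
  shows "(\<Sum>i\<in>UNIV. partial_deriv i (partial_deriv i (correl z \<eta>)) x) = 0"
proof -
  have e: "partial_deriv i (partial_deriv i (correl z \<eta>))
      = correl z (partial_deriv i (partial_deriv i \<eta>))" for i
  proof -
    have "partial_deriv i (\<lambda>x. -1 * partial_deriv i \<eta> x)
        = (\<lambda>x. -1 * partial_deriv i (partial_deriv i \<eta>) x)"
      by (rule ext) (intro partial_deriv_cmult smooth_differentiable smooth_partial_deriv test_smooth \<eta>)
    then show ?thesis
      unfolding partial_deriv_correl[OF \<eta>] partial_deriv_correl[OF test_cmult[OF test_partial_deriv[OF
          \<eta>]]]
      by simp
  qed
  have "(\<Sum>i\<in>UNIV. correl z (partial_deriv i (partial_deriv i \<eta>)) x)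
      = (\<integral>y. (\<Sum>i\<in>UNIV. z y * partial_deriv i (partial_deriv i \<eta>) (y - x)) \<partial>lebesgue)"
    unfolding correl_def
    by (rule Bochner_Integration.integral_sum[symmetric]) (intro correl_integrable test_partial_deriv \<eta>)
  also have "\<dots> = (\<integral>y. z y * (\<Sum>i\<in>UNIV. partial_deriv i (partial_deriv i (\<lambda>y. \<eta> (y - x))) y) \<partial>lebesgue)"
    by (simp add: partial_deriv_translate test_smooth[OF \<eta>] smooth_partial_deriv sum_distrib_left)
  also have "\<dots> = 0" by (intro harm test_translate \<eta>)
  finally show ?thesis by (simp add: e)
qed

text \<open>Shifting a point by at most r changes the weight by a bounded factor, so averaging over
  balls of radius r respects the weighted space.\<close>

lemma rho_comparable:
  assumes "dist x y \<le> r" shows "rho y \<le> sqrt (2 * (1 + r\<^sup>2)) * rho (x :: real^'n)"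
proof -
  have r: "r \<ge> 0" using assms zero_le_dist order_trans by blast
  have "norm y \<le> norm x + r" using assms norm_triangle_ineq2[of y x]
      by (simp add: dist_norm norm_minus_commute)
  then have "(norm y)\<^sup>2 \<le> (norm x + r)\<^sup>2" by (intro power_mono) auto
  also have "\<dots> \<le> 2 * (norm x)\<^sup>2 + 2 * r\<^sup>2" using sum_squares_bound[of "norm x" r]
      by (simp add: power2_sum)
  finally have "1 + (norm y)\<^sup>2 \<le> 2 * (1 + r\<^sup>2) * (1 + (norm x)\<^sup>2)" by (simp add: algebra_simps)
      (smt (verit, best) mult_nonneg_nonneg zero_le_power2)
  then show ?thesis unfolding rho_def real_sqrt_mult[symmetric] by (rule real_sqrt_le_mono)
qed

text \<open>A Young-type estimate. Up to the factor C the quotient is at most the integral of the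
  modulus of s = z / rho over the ball of radius r about x. Cauchy-Schwarz in y and an exchange of
  integrations then bound the squared norm by C^2 V^2 times that of s, with V the volume of the
  ball.\<close>

lemma correl_over_rho_L2:
  assumes \<eta>: "\<eta> \<in> test_functions"
  shows "integrable lborel (\<lambda>x. (correl z \<eta> x / rho x)\<^sup>2)"
proof -
  obtain r where r: "r > 0" "\<And>x. norm x > r \<Longrightarrow> \<eta> x = 0" using testE[OF \<eta>] by metis
  obtain K where K: "K > 0" "\<And>x. \<bar>\<eta> x\<bar> \<le> K" using test_bounded[OF \<eta>] by metis
  define C where "C = K * sqrt (2 * (1 + r\<^sup>2))"
  have C: "C \<ge> 0" using K by (simp add: C_def)
  obtain s where s [measurable]: "s \<in> borel_measurable lborel" and aes: "AE x in lborel. z x / rho x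
      = s x"
    using completion_ex_borel_measurable_real[OF L2_measurable[OF z]] by blast
  define V where "V = emeasure lborel (cball (0::real^'n) r)"
  have V: "emeasure lborel (cball (x::real^'n) r) = V" for x
    using r(1) by (simp add: V_def emeasure_cball)
  have Vfin: "V < \<infinity>" unfolding V_def by (rule emeasure_lborel_cball_finite)
  \<comment> \<open>J is the kernel of integration over balls of radius r. It equals its own square,
    so the integrand is written with J twice: Cauchy-Schwarz assigns one copy to s and keeps the
    other, whose integral is V.\<close>
  define J where "J x y = (indicator {p. dist (fst p) (snd p) \<le> r} (x, y) :: ennreal)"
      for x y :: "real^'n"
  have Jm [measurable]: "(\<lambda>p. J (fst p) (snd p)) \<in> borel_measurable (lborel \<Otimes>\<^sub>M lborel)"
    unfolding J_def by measurable
  have Jm1 [measurable]: "(\<lambda>y. J x y) \<in> borel_measurable lborel" "(\<lambda>y. J y x) \<in> borel_measurable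
      lborel" for x
    unfolding J_def by measurable
  have Jint: "(\<integral>\<^sup>+y. J x y \<partial>lborel) = V" "(\<integral>\<^sup>+y. J y x \<partial>lborel) = V" for x
  proof -
    have "J x y = indicator (cball x r) y" "J y x = indicator (cball x r) y" for y
      by (auto simp: J_def indicator_def dist_commute)
    then show "(\<integral>\<^sup>+y. J x y \<partial>lborel) = V" "(\<integral>\<^sup>+y. J y x \<partial>lborel) = V" by (simp_all add: V)
  qed
  have J2: "J x y ^ 2 = J x y" for x y by (simp add: J_def indicator_def)
  have pw: "ennreal \<bar>correl z \<eta> x / rho x\<bar> \<le> (\<integral>\<^sup>+y. (ennreal (C * \<bar>s y\<bar>) * J x y) * J x y \<partial>lborel)" for x
  proof -
    have "ennreal \<bar>correl z \<eta> x\<bar> \<le> (\<integral>\<^sup>+y. ennreal (norm (z y * \<eta> (y - x))) \<partial>lebesgue)"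
      unfolding correl_def using integral_norm_bound_ennreal[OF correl_integrable[OF \<eta>]] by simp
    also have "\<dots> = (\<integral>\<^sup>+y. ennreal (norm (z y * \<eta> (y - x))) \<partial>lborel)" by (rule nn_integral_completion)
    also have "\<dots> \<le> (\<integral>\<^sup>+y. ennreal (rho x) * ((ennreal (C * \<bar>s y\<bar>) * J x y) * J x y) \<partial>lborel)"
    proof (rule nn_integral_mono_AE, use aes in eventually_elim)
      case (elim y)
      show ?case
      proof (cases "dist x y \<le> r")
        case True
        have "norm (z y * \<eta> (y - x)) = \<bar>s y\<bar> * (rho y * \<bar>\<eta> (y - x)\<bar>)"
          using elim rho_pos[of y] by (simp add: abs_mult field_simps)
        also have "\<dots> \<le> \<bar>s y\<bar> * ((sqrt (2 * (1 + r\<^sup>2)) * rho x) * K)"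
          using K rho_comparable[OF True] rho_pos[of x]
          by (intro mult_left_mono mult_mono) auto
        also have "\<dots> = rho x * (C * \<bar>s y\<bar>)" by (simp add: C_def)
        finally have "ennreal (norm (z y * \<eta> (y - x))) \<le> ennreal (rho x) * ennreal (C * \<bar>s y\<bar>)"
          using rho_pos[of x] C by (simp add: ennreal_mult[symmetric])
        moreover have "J x y = 1" using True by (simp add: J_def)
        ultimately show ?thesis by simp
      next
        case False
        then have "\<eta> (y - x) = 0" by (intro r(2)) (simp add: dist_norm norm_minus_commute)
        then show ?thesis by simp
      qed
    qed
    also have "\<dots> = ennreal (rho x) * (\<integral>\<^sup>+y. (ennreal (C * \<bar>s y\<bar>) * J x y) * J x y \<partial>lborel)"
      by (rule nn_integral_cmult) measurable
    finally have *: "ennreal \<bar>correl z \<eta> x\<bar> \<le> ennreal (rho x) * (\<integral>\<^sup>+y. (ennreal (C * \<bar>s y\<bar>) * J x y)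
        * J x y \<partial>lborel)" .
    have "ennreal \<bar>correl z \<eta> x / rho x\<bar> = ennreal (1 / rho x) * ennreal \<bar>correl z \<eta> x\<bar>"
      using rho_pos[of x] by (simp add: ennreal_mult[symmetric] abs_divide)
    also have "\<dots> \<le> ennreal (1 / rho x) * (ennreal (rho x) * (\<integral>\<^sup>+y. (ennreal (C * \<bar>s y\<bar>) * J x y) * J x
        y \<partial>lborel))"
      by (intro mult_left_mono *) auto
    also have "\<dots> = (\<integral>\<^sup>+y. (ennreal (C * \<bar>s y\<bar>) * J x y) * J x y \<partial>lborel)"
      using rho_pos[of x] by (simp add: mult.assoc[symmetric] ennreal_mult[symmetric])
    finally show ?thesis .
  qed
  have cm [measurable]: "correl z \<eta> \<in> borel_measurable borel"
    by (intro borel_measurable_continuous_onI smooth_continuous smooth_correl \<eta>)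
  have "(\<integral>\<^sup>+x. ennreal ((correl z \<eta> x / rho x)\<^sup>2) \<partial>lborel) \<le>
      (\<integral>\<^sup>+x. (\<integral>\<^sup>+y. ennreal ((C * s y)\<^sup>2) * J x y \<partial>lborel) * V \<partial>lborel)"
  proof (rule nn_integral_mono)
    fix x :: "real^'n"
    have "ennreal ((correl z \<eta> x / rho x)\<^sup>2) = (ennreal \<bar>correl z \<eta> x / rho x\<bar>)\<^sup>2"
      by (simp add: ennreal_power del: abs_divide)
    also have "\<dots> \<le> (\<integral>\<^sup>+y. (ennreal (C * \<bar>s y\<bar>) * J x y) * J x y \<partial>lborel)\<^sup>2"
      by (intro power_mono pw) auto
    also have "\<dots> \<le> (\<integral>\<^sup>+y. (ennreal (C * \<bar>s y\<bar>) * J x y)\<^sup>2 \<partial>lborel) * (\<integral>\<^sup>+y. (J x y)\<^sup>2 \<partial>lborel)"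
      by (rule Cauchy_Schwarz_nn_integral) measurable
    also have "\<dots> = (\<integral>\<^sup>+y. ennreal ((C * s y)\<^sup>2) * J x y \<partial>lborel) * V"
      using C by (simp add: J2 Jint power_mult_distrib ennreal_power)
    finally show "ennreal ((correl z \<eta> x / rho x)\<^sup>2) \<le> (\<integral>\<^sup>+y. ennreal ((C * s y)\<^sup>2) * J x y \<partial>lborel)
        * V" .
  qed
  also have "\<dots> = (\<integral>\<^sup>+x. (\<integral>\<^sup>+y. ennreal ((C * s y)\<^sup>2) * J x y \<partial>lborel) \<partial>lborel) * V"
    by (rule nn_integral_multc) (unfold J_def, measurable)
  also have "(\<integral>\<^sup>+x. (\<integral>\<^sup>+y. ennreal ((C * s y)\<^sup>2) * J x y \<partial>lborel) \<partial>lborel)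
      = (\<integral>\<^sup>+y. (\<integral>\<^sup>+x. ennreal ((C * s y)\<^sup>2) * J x y \<partial>lborel) \<partial>lborel)"
    by (rule lborel_pair.Fubini'[symmetric]) (unfold J_def, measurable)
  also have "\<dots> = (\<integral>\<^sup>+y. ennreal ((C * s y)\<^sup>2) * V \<partial>lborel)"
    by (simp add: nn_integral_cmult Jint)
  also have "\<dots> = (\<integral>\<^sup>+y. ennreal (C\<^sup>2) * ennreal ((s y)\<^sup>2) \<partial>lborel) * V"
    by (subst nn_integral_multc) (auto simp: power_mult_distrib ennreal_mult)
  also have "\<dots> = ennreal (C\<^sup>2) * (\<integral>\<^sup>+y. ennreal ((s y)\<^sup>2) \<partial>lborel) * V"
    by (subst nn_integral_cmult) auto
  also have "\<dots> * V < \<infinity>"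
  proof -
    have "(\<integral>\<^sup>+y. ennreal ((s y)\<^sup>2) \<partial>lborel) = (\<integral>\<^sup>+y. ennreal ((z y / rho y)\<^sup>2) \<partial>lborel)"
      by (rule nn_integral_cong_AE) (use aes in \<open>eventually_elim, simp\<close>)
    also have "\<dots> = (\<integral>\<^sup>+y. ennreal ((z y / rho y)\<^sup>2) \<partial>lebesgue)"
        by (rule nn_integral_completion[symmetric])
    also have "\<dots> < \<infinity>"
      using L2_integrable_square[OF z] by (subst nn_integral_eq_integral) auto
    finally show ?thesis using Vfin by (simp add: ennreal_mult_less_top)
  qed
  finally show ?thesis by (intro integrableI_bounded) (auto simp: power_divide)
qed

end

text \<open>The equation is tested with \<omega>^2 w. The mixed term is absorbed into half of the
  gradient term at the price of twice the integral of w^2 times the squared gradient of \<omega>;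
  hence the factor 4.\<close>

lemma caccioppoli:
  assumes w: "smooth w" and harm: "\<And>x. (\<Sum>i\<in>UNIV. partial_deriv i (partial_deriv i w) x) = 0"
    and \<omega>: "\<omega> \<in> test_functions"
  shows "(\<integral>x. (\<omega> x)\<^sup>2 * (\<Sum>i\<in>UNIV. (partial_deriv i w x)\<^sup>2) \<partial>lebesgue)
    \<le> 4 * (\<integral>x. (w x)\<^sup>2 * (\<Sum>i\<in>UNIV. (partial_deriv i \<omega> x)\<^sup>2) \<partial>lebesgue)"
proof -
  note s\<omega> = test_smooth[OF \<omega>]
  let ?G = "\<lambda>x. (\<omega> x)\<^sup>2 * (\<Sum>i\<in>UNIV. (partial_deriv i w x)\<^sup>2)"
  let ?H = "\<lambda>x. (w x)\<^sup>2 * (\<Sum>i\<in>UNIV. (partial_deriv i \<omega> x)\<^sup>2)"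
  \<comment> \<open>Grouped with the test function \<omega> as the last factor, the shape that
    \<open>test_mult\<close> expects.\<close>
  define \<phi> where "\<phi> x = (\<omega> x * w x) * \<omega> x" for x
  have \<phi>: "\<phi> \<in> test_functions"
    unfolding \<phi>_def by (intro test_mult smooth_mult s\<omega> w \<omega>)
  have d\<phi>: "partial_deriv i \<phi> x = 2 * \<omega> x * partial_deriv i \<omega> x * w x + (\<omega> x)\<^sup>2 * partial_deriv i w x"
      for i x
  proof -
    have "partial_deriv i \<phi> x = (\<omega> x * w x) * partial_deriv i \<omega> x + partial_deriv i (\<lambda>x. \<omega> x * w x) x
        * \<omega> x"
      unfolding \<phi>_def by (intro partial_deriv_mult smooth_differentiable smooth_mult s\<omega> w)
    moreover have "partial_deriv i (\<lambda>x. \<omega> x * w x) x = \<omega> x * partial_deriv i w x + partial_deriv i \<omega> x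
        * w x"
      by (intro partial_deriv_mult smooth_differentiable s\<omega> w)
    ultimately show ?thesis by (simp add: algebra_simps power2_eq_square)
  qed
  have intd: "integrable lebesgue (\<lambda>x. partial_deriv i w x * partial_deriv i \<phi> x)" for i
    by (intro test_integrable test_mult smooth_partial_deriv w test_partial_deriv \<phi>)
  have intl: "integrable lebesgue (\<lambda>x. partial_deriv i (partial_deriv i w) x * \<phi> x)" for i
    by (intro test_integrable test_mult smooth_partial_deriv w \<phi>)
  have intG: "integrable lebesgue ?G"
  proof -
    have "integrable lebesgue (\<lambda>x. \<Sum>i\<in>UNIV. (partial_deriv i w x * partial_deriv i w x) * (\<omega> x * \<omega> x))"
      by (intro Bochner_Integration.integrable_sum test_integrable test_mult smooth_mult
          smooth_partial_deriv w s\<omega> \<omega>)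
    then show ?thesis by (simp add: power2_eq_square sum_distrib_left mult_ac)
  qed
  have intH: "integrable lebesgue ?H"
  proof -
    have "integrable lebesgue (\<lambda>x. \<Sum>i\<in>UNIV. (w x * w x) * (partial_deriv i \<omega> x * partial_deriv i \<omega> x))"
      by (intro Bochner_Integration.integrable_sum test_integrable test_mult smooth_mult
          smooth_partial_deriv w s\<omega> test_partial_deriv \<omega>)
    then show ?thesis by (simp add: power2_eq_square sum_distrib_left mult_ac)
  qed
  have "(\<integral>x. (\<Sum>i\<in>UNIV. partial_deriv i w x * partial_deriv i \<phi> x) \<partial>lebesgue)
      = (\<Sum>i\<in>UNIV. (\<integral>x. partial_deriv i w x * partial_deriv i \<phi> x \<partial>lebesgue))"
    by (rule Bochner_Integration.integral_sum) (rule intd)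
  also have "\<dots> = - (\<Sum>i\<in>UNIV. (\<integral>x. partial_deriv i (partial_deriv i w) x * \<phi> x \<partial>lebesgue))"
    by (simp add: integral_by_parts[OF smooth_partial_deriv[OF w] \<phi>] sum_negf)
  also have "(\<Sum>i\<in>UNIV. (\<integral>x. partial_deriv i (partial_deriv i w) x * \<phi> x \<partial>lebesgue))
      = (\<integral>x. (\<Sum>i\<in>UNIV. partial_deriv i (partial_deriv i w) x * \<phi> x) \<partial>lebesgue)"
    by (rule Bochner_Integration.integral_sum[symmetric]) (rule intl)
  also have "\<dots> = 0" by (simp add: sum_distrib_right[symmetric] harm)
  finally have 0: "(\<integral>x. (\<Sum>i\<in>UNIV. partial_deriv i w x * partial_deriv i \<phi> x) \<partial>lebesgue) = 0" by simp
  have "(1/2) * (\<integral>x. ?G x \<partial>lebesgue) - 2 * (\<integral>x. ?H x \<partial>lebesgue)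
      = (\<integral>x. (1/2) * ?G x - 2 * ?H x \<partial>lebesgue)"
    using intG intH by simp
  also have "\<dots> \<le> (\<integral>x. (\<Sum>i\<in>UNIV. partial_deriv i w x * partial_deriv i \<phi> x) \<partial>lebesgue)"
  proof (rule integral_mono)
    show "integrable lebesgue (\<lambda>x. (1/2) * ?G x - 2 * ?H x)" using intG intH by simp
    show "integrable lebesgue (\<lambda>x. \<Sum>i\<in>UNIV. partial_deriv i w x * partial_deriv i \<phi> x)"
      using intd by (rule Bochner_Integration.integrable_sum)
    show "(1/2) * ?G x - 2 * ?H x \<le> (\<Sum>i\<in>UNIV. partial_deriv i w x * partial_deriv i \<phi> x)" for x
    proof -
      have "(1/2) * ?G x - 2 * ?H x = (\<Sum>i\<in>UNIV. (1/2) * (\<omega> x * partial_deriv i w x)\<^sup>2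
          - 2 * (w x * partial_deriv i \<omega> x)\<^sup>2)"
        by (simp add: sum_subtractf sum_distrib_left power_mult_distrib)
      also have "\<dots> \<le> (\<Sum>i\<in>UNIV. partial_deriv i w x * partial_deriv i \<phi> x)"
      proof (rule sum_mono)
        fix i
        \<comment> \<open>This square is twice the difference of the two sides.\<close>
        have "0 \<le> (\<omega> x * partial_deriv i w x + 2 * (w x * partial_deriv i \<omega> x))\<^sup>2" by simp
        then show "(1/2) * (\<omega> x * partial_deriv i w x)\<^sup>2 - 2 * (w x * partial_deriv i \<omega> x)\<^sup>2
            \<le> partial_deriv i w x * partial_deriv i \<phi> x"
          by (simp add: d\<phi> power2_eq_square algebra_simps)
      qed
      finally show ?thesis .
    qed
  qed
  finally show ?thesis using 0 by simp
qed

text \<open>Dilates of a single bump. On the support of the k-th dilate rho x is at most (k + 1)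
  sqrt (1 + r^2), while its derivatives carry the factor 1 / (k + 1). This gives the bound C / rho x
  uniformly in k, which matches the weight under which the averages of z are square integrable. The
  limit c is the value of the bump at 0, positive but not normalised to 1.\<close>

lemma cutoff_sequence:
  obtains \<omega> :: "nat \<Rightarrow> real^'n::finite \<Rightarrow> real" and c C
  where "\<And>k. \<omega> k \<in> test_functions" "c > 0" "\<And>x. (\<lambda>k. \<omega> k x) \<longlonglongrightarrow> c"
    "\<And>k i x. \<bar>partial_deriv i (\<omega> k) x\<bar> \<le> C / rho x" "\<And>i x. (\<lambda>k. partial_deriv i (\<omega> k) x) \<longlonglongrightarrow> 0"
proof -
  define \<phi> :: "real^'n \<Rightarrow> real" where "\<phi> = box_bump (\<chi> i. -1) (\<chi> i. 1) 0"
  have \<phi>: "\<phi> \<in> test_functions" by (simp add: \<phi>_def box_bump_test)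
  define X where "X k x = \<phi> ((1 / real (Suc k)) *\<^sub>R x)" for k x
  have X: "X k \<in> test_functions" for k
    unfolding X_def using test_affine[OF \<phi>, of "1 / real (Suc k)" 0] by simp
  have dX: "partial_deriv i (X k) x = (1 / real (Suc k)) * partial_deriv i \<phi> ((1 / real (Suc k)) *\<^sub>R
      x)" for i k x
    unfolding X_def using partial_deriv_affine(1)[of \<phi> "1 / real (Suc k)" x 0 i]
      smooth_differentiable[OF test_smooth[OF \<phi>]] by simp
  have "\<phi> 0 = (\<Prod>i\<in>(UNIV::'n set). exp (-1) * exp (-1))"
    unfolding \<phi>_def box_bump_def by (simp add: flat_1)
  then have c: "\<phi> 0 > 0" by (auto intro!: prod_pos)
  have z: "(\<lambda>k. (1 / real (Suc k)) *\<^sub>R x) \<longlonglongrightarrow> 0" for x :: "real^'n"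
    using tendsto_scaleR[OF LIMSEQ_Suc[OF lim_1_over_n] tendsto_const[of x]] by simp
  have lim: "(\<lambda>k. X k x) \<longlonglongrightarrow> \<phi> 0" for x
    unfolding X_def
    using smooth_continuous[OF test_smooth[OF \<phi>], of UNIV]
    by (intro isCont_tendsto_compose[OF _ z]) (simp add: continuous_on_eq_continuous_at)
  obtain r where r: "r > 0" "\<And>x. norm x > r \<Longrightarrow> \<phi> x = 0" using testE[OF \<phi>] by metis
  have "\<forall>i. \<exists>K>0. \<forall>x. \<bar>partial_deriv i \<phi> x\<bar> \<le> K" using test_bounded[OF test_partial_deriv[OF \<phi>]] by metis
  then obtain K where K: "\<And>i. K i > 0" "\<And>i x. \<bar>partial_deriv i \<phi> x\<bar> \<le> K i" by metis
  define L where "L = (\<Sum>i\<in>UNIV. K i)"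
  have L: "K i \<le> L" for i unfolding L_def by (rule member_le_sum) (auto intro: less_imp_le K)
  have b: "\<bar>partial_deriv i (X k) x\<bar> \<le> L * sqrt (1 + r\<^sup>2) / rho x" for i k x
  proof (cases "norm x \<le> real (Suc k) * r")
    case True
    then have "(norm x)\<^sup>2 \<le> (real (Suc k) * r)\<^sup>2" by (intro power_mono) auto
    moreover have "1 \<le> (real (Suc k))\<^sup>2" by (rule one_le_power) simp
    ultimately have "1 + (norm x)\<^sup>2 \<le> (real (Suc k))\<^sup>2 * (1 + r\<^sup>2)"
      unfolding power_mult_distrib distrib_left mult_1_right by linarith
    then have "rho x \<le> real (Suc k) * sqrt (1 + r\<^sup>2)"
      unfolding rho_def using real_sqrt_le_mono by (fastforce simp: real_sqrt_mult)
    then have "1 / real (Suc k) \<le> sqrt (1 + r\<^sup>2) / rho x"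
      using rho_pos[of x] by (simp add: field_simps)
    moreover have "\<bar>partial_deriv i \<phi> ((1 / real (Suc k)) *\<^sub>R x)\<bar> \<le> L" using K(2) L order_trans by blast
    ultimately have "(1 / real (Suc k)) * \<bar>partial_deriv i \<phi> ((1 / real (Suc k)) *\<^sub>R x)\<bar>
        \<le> (sqrt (1 + r\<^sup>2) / rho x) * L"
      using rho_pos[of x] by (intro mult_mono) auto
    then show ?thesis by (simp add: dX abs_mult mult_ac)
  next
    case False
    then have "norm ((1 / real (Suc k)) *\<^sub>R x) > r" by (simp add: field_simps)
    then have "partial_deriv i \<phi> ((1 / real (Suc k)) *\<^sub>R x) = 0"
      using r(2) partial_deriv_zero_outside[of r \<phi>] by blast
    moreover have "L \<ge> 0" using L K(1) less_imp_le order_trans by blast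
    ultimately show ?thesis using rho_pos[of x] by (simp add: dX)
  qed
  have dlim: "(\<lambda>k. partial_deriv i (X k) x) \<longlonglongrightarrow> 0" for i x
  proof (rule Lim_null_comparison[OF always_eventually])
    show "\<forall>k. norm (partial_deriv i (X k) x) \<le> (1 / real (Suc k)) * L"
    proof
      fix k
      have "\<bar>partial_deriv i \<phi> ((1 / real (Suc k)) *\<^sub>R x)\<bar> \<le> L" using K(2) L order_trans by blast
      then have "(1 / real (Suc k)) * \<bar>partial_deriv i \<phi> ((1 / real (Suc k)) *\<^sub>R x)\<bar>
          \<le> (1 / real (Suc k)) * L"
        by (intro mult_left_mono) auto
      then show "norm (partial_deriv i (X k) x) \<le> (1 / real (Suc k)) * L" by (simp add: dX abs_mult)
    qed
    show "(\<lambda>k. (1 / real (Suc k)) * L) \<longlonglongrightarrow> 0"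
      using tendsto_mult_right[OF LIMSEQ_Suc[OF lim_1_over_n], of L] by simp
  qed
  show ?thesis by (rule that[OF X c lim b dlim])
qed

text \<open>The ball of radius R contributes at least u R^n / (1 + R^2), which grows at least
  linearly because n \<ge> 3. Hence the weighted space contains no nonzero constant.\<close>

lemma rho_power_not_integrable:
  assumes n: "CARD('n::finite) \<ge> 3"
  shows "\<not> integrable lborel (\<lambda>x::real^'n. (1 / rho x)\<^sup>2)"
proof
  assume int: "integrable lborel (\<lambda>x::real^'n. (1 / rho x)\<^sup>2)"
  define I where "I = integral\<^sup>L lborel (\<lambda>x::real^'n. (1 / rho x)\<^sup>2)"
  define u where "u = unit_ball_vol (real CARD('n))"
  have u: "u > 0" by (simp add: u_def)
  have "u * R / 2 \<le> I" if R: "R \<ge> 1" for R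
  proof -
    have "R ^ 3 \<le> R ^ CARD('n)" using R n by (intro power_increasing) auto
    have "u * R ^ CARD('n) * (1 / (1 + R\<^sup>2)) = (\<integral>x. (1 / (1 + R\<^sup>2)) * indicator (cball (0::real^'n) R)
        x \<partial>lborel)"
      using R by (simp add: u_def content_cball)
    also have "\<dots> \<le> I" unfolding I_def
    proof (rule integral_mono[OF _ int])
      show "integrable lborel (\<lambda>x. (1 / (1 + R\<^sup>2)) * indicator (cball (0::real^'n) R) x)"
        using emeasure_lborel_cball_finite[of "0::real^'n" R]
        by (intro integrable_mult_right integrable_real_indicator) auto
      show "(1 / (1 + R\<^sup>2)) * indicator (cball 0 R) x \<le> (1 / rho x)\<^sup>2" for x :: "real^'n"
      proof (cases "norm x \<le> R")
        case True
        then have "(norm x)\<^sup>2 \<le> R\<^sup>2" by (intro power_mono) auto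
        moreover have "0 < 1 + (norm x)\<^sup>2" by (simp add: add_pos_nonneg)
        ultimately show ?thesis using True by (simp add: power_divide rho_square frac_le)
      qed simp
    qed
    finally have "u * R ^ CARD('n) * (1 / (1 + R\<^sup>2)) \<le> I" .
    moreover have "u * R / 2 \<le> u * R ^ CARD('n) * (1 / (1 + R\<^sup>2))"
    proof -
      have "1 + R\<^sup>2 \<le> 2 * R\<^sup>2" using one_le_power[OF R, of 2] by simp
      then have "R * (1 + R\<^sup>2) \<le> R * (2 * R\<^sup>2)" using R by (intro mult_left_mono) auto
      also have "\<dots> = 2 * R ^ 3" by (simp add: power2_eq_square power3_eq_cube)
      also have "\<dots> \<le> 2 * R ^ CARD('n)" using \<open>R ^ 3 \<le> R ^ CARD('n)\<close> by simp
      finally have "u * (R * (1 + R\<^sup>2)) \<le> u * (2 * R ^ CARD('n))" using u by (intro mult_left_mono) auto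
      moreover have "1 + R\<^sup>2 > 0" by (simp add: add_pos_nonneg)
      ultimately show ?thesis by (simp add: field_simps)
    qed
    ultimately show ?thesis by linarith
  qed
  \<comment> \<open>This radius turns the bound u R / 2 \<le> I into I + 1 \<le> I.\<close>
  from this[of "max 1 (2 * (I + 1) / u)"] have "u * max 1 (2 * (I + 1) / u) / 2 \<le> I" by simp
  moreover have "u * (2 * (I + 1) / u) \<le> u * max 1 (2 * (I + 1) / u)" using u
      by (intro mult_left_mono) auto
  ultimately show False using u by simp
qed

lemma weighted_liouville:
  fixes z :: "real^'n::finite \<Rightarrow> real"
  assumes n: "CARD('n) \<ge> 3" and z: "(\<lambda>x. z x / rho x) \<in> L2"
    and harm: "\<And>\<phi>. \<phi> \<in> test_functions \<Longrightarrow>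
      (\<integral>x. z x * (\<Sum>i\<in>UNIV. partial_deriv i (partial_deriv i \<phi>) x) \<partial>lebesgue) = 0"
  shows "AE x in lebesgue. z x = 0"
proof (rule fundamental_lemma[OF z])
  fix \<eta> :: "real^'n \<Rightarrow> real" assume \<eta>: "\<eta> \<in> test_functions"
  define w where "w = correl z \<eta>"
  have sw: "smooth w" unfolding w_def by (rule smooth_correl[OF z \<eta>])
  have hw: "(\<Sum>i\<in>UNIV. partial_deriv i (partial_deriv i w) x) = 0" for x
    unfolding w_def by (rule correl_harmonic[OF z harm \<eta>])
  have wi: "integrable lborel (\<lambda>x. (w x / rho x)\<^sup>2)" unfolding w_def by (rule correl_over_rho_L2[OF z \<eta>])
  have [measurable]: "f \<in> borel_measurable borel" if "smooth f" for f :: "real^'n \<Rightarrow> real"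
    by (intro borel_measurable_continuous_onI smooth_continuous that)
  note [measurable] = this[OF sw] this[OF smooth_partial_deriv[OF sw]]
  obtain \<omega> :: "nat \<Rightarrow> real^'n \<Rightarrow> real" and c C where \<omega>: "\<And>k. \<omega> k \<in> test_functions" and c: "c > 0"
    and lim: "\<And>x. (\<lambda>k. \<omega> k x) \<longlonglongrightarrow> c"
    and C: "\<And>k i x. \<bar>partial_deriv i (\<omega> k) x\<bar> \<le> C / rho x"
    and dlim: "\<And>i x. (\<lambda>k. partial_deriv i (\<omega> k) x) \<longlonglongrightarrow> 0"
    using cutoff_sequence by blast
  note [measurable] = test_borel[OF \<omega>] test_borel[OF test_partial_deriv[OF \<omega>]]
  define G where "G x = (\<Sum>i\<in>UNIV. (partial_deriv i w x)\<^sup>2)" for x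
  have Gm [measurable]: "G \<in> borel_measurable borel" unfolding G_def by measurable
  define H where "H k x = (w x)\<^sup>2 * (\<Sum>i\<in>UNIV. (partial_deriv i (\<omega> k) x)\<^sup>2)" for k x
  have [measurable]: "H k \<in> borel_measurable borel" for k unfolding H_def by measurable
  \<comment> \<open>The right-hand side of Caccioppoli's inequality tends to 0: the bound C / rho x
    on the derivatives of the cutoffs makes a multiple of (w / rho)^2 a dominating function.\<close>
  have H0: "(\<lambda>k. \<integral>x. H k x \<partial>lborel) \<longlonglongrightarrow> integral\<^sup>L lborel (\<lambda>x::real^'n. 0)"
  proof (rule integral_dominated_convergence)
    show "integrable lborel (\<lambda>x. (real CARD('n) * C\<^sup>2) * (w x / rho x)\<^sup>2)"
      using wi by (rule integrable_mult_right)
    show "AE x in lborel. (\<lambda>k. H k x) \<longlonglongrightarrow> 0"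
    proof (rule AE_I2)
      fix x
      have "(\<lambda>k. (w x)\<^sup>2 * (\<Sum>i\<in>UNIV. (partial_deriv i (\<omega> k) x)\<^sup>2)) \<longlonglongrightarrow> (w x)\<^sup>2 * (\<Sum>i\<in>(UNIV::'n set). 0\<^sup>2)"
        by (intro tendsto_mult tendsto_const tendsto_sum tendsto_power dlim)
      then show "(\<lambda>k. H k x) \<longlonglongrightarrow> 0" by (simp add: H_def)
    qed
    show "AE x in lborel. norm (H k x) \<le> (real CARD('n) * C\<^sup>2) * (w x / rho x)\<^sup>2" for k
    proof (rule AE_I2)
      fix x
      have "(partial_deriv i (\<omega> k) x)\<^sup>2 \<le> (C / rho x)\<^sup>2" for i
        using power_mono[OF C[of i k x] abs_ge_zero, of 2] by simp
      then have "(\<Sum>i\<in>UNIV. (partial_deriv i (\<omega> k) x)\<^sup>2) \<le> (\<Sum>i\<in>(UNIV::'n set). (C / rho x)\<^sup>2)"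
          by (rule sum_mono)
      then have "(w x)\<^sup>2 * (\<Sum>i\<in>UNIV. (partial_deriv i (\<omega> k) x)\<^sup>2)
          \<le> (w x)\<^sup>2 * (real CARD('n) * (C / rho x)\<^sup>2)"
        by (intro mult_left_mono) auto
      then show "norm (H k x) \<le> (real CARD('n) * C\<^sup>2) * (w x / rho x)\<^sup>2"
        by (simp add: H_def power_divide mult_ac sum_nonneg)
    qed
  qed measurable
  have GH: "(\<integral>\<^sup>+x. ennreal ((\<omega> k x)\<^sup>2 * G x) \<partial>lborel) \<le>
      ennreal (4 * (\<integral>x. H k x \<partial>lborel))" for k
  proof -
    have cc: "continuous_on UNIV (\<lambda>x. (\<omega> k x)\<^sup>2 * G x)" unfolding G_def
      by (intro continuous_intros smooth_continuous smooth_partial_deriv sw test_smooth \<omega>)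
    obtain r where "\<And>x. norm x > r \<Longrightarrow> \<omega> k x = 0" using testE[OF \<omega>] by metis
    then have "integrable lborel (\<lambda>x. (\<omega> k x)\<^sup>2 * G x)"
      by (intro integrable_continuous_compact_support[OF cc, of r]) auto
    then have "(\<integral>\<^sup>+x. ennreal ((\<omega> k x)\<^sup>2 * G x) \<partial>lborel) = ennreal (\<integral>x. (\<omega> k x)\<^sup>2 * G x \<partial>lborel)"
      by (intro nn_integral_eq_integral) (auto simp: G_def sum_nonneg)
    also have "(\<integral>x. (\<omega> k x)\<^sup>2 * G x \<partial>lborel) = (\<integral>x. (\<omega> k x)\<^sup>2 * G x \<partial>lebesgue)"
      by (rule integral_completion[symmetric]) measurable
    also have "\<dots> \<le> 4 * (\<integral>x. H k x \<partial>lebesgue)"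
      unfolding G_def H_def by (rule caccioppoli[OF sw hw \<omega>])
    also have "(\<integral>x. H k x \<partial>lebesgue)
        = (\<integral>x. H k x \<partial>lborel)"
      by (rule integral_completion) measurable
    finally show ?thesis by (simp add: ennreal_leI)
  qed
  \<comment> \<open>Fatou's lemma passes the limit to G, whose integrability is not known
    beforehand.\<close>
  have "(\<integral>\<^sup>+x. ennreal (c\<^sup>2 * G x) \<partial>lborel) = (\<integral>\<^sup>+x. liminf (\<lambda>k. ennreal ((\<omega> k x)\<^sup>2 * G x)) \<partial>lborel)"
  proof (rule nn_integral_cong)
    fix x
    have "(\<lambda>k. ennreal ((\<omega> k x)\<^sup>2 * G x)) \<longlonglongrightarrow> ennreal (c\<^sup>2 * G x)"
      by (intro tendsto_ennrealI tendsto_intros lim)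
    then show "ennreal (c\<^sup>2 * G x) = liminf (\<lambda>k. ennreal ((\<omega> k x)\<^sup>2 * G x))"
      by (simp add: lim_imp_Liminf)
  qed
  also have "\<dots> \<le> liminf (\<lambda>k. \<integral>\<^sup>+x. ennreal ((\<omega> k x)\<^sup>2 * G x) \<partial>lborel)"
    by (rule nn_integral_liminf) measurable
  also have "\<dots> \<le> liminf (\<lambda>k. ennreal (4 * (\<integral>x. H k x \<partial>lborel)))"
    by (rule Liminf_mono) (simp add: GH)
  also have "\<dots> = 0"
  proof (rule lim_imp_Liminf)
    have "(\<lambda>k. ennreal (4 * (\<integral>x. H k x \<partial>lborel))) \<longlonglongrightarrow> ennreal (4 * 0)"
      using H0 by (intro tendsto_ennrealI tendsto_mult tendsto_const) simp
    then show "(\<lambda>k. ennreal (4 * (\<integral>x. H k x \<partial>lborel))) \<longlonglongrightarrow> 0" by simp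
  qed simp
  finally have "(\<integral>\<^sup>+x. ennreal (c\<^sup>2 * G x) \<partial>lborel) = 0" by simp
  then have "AE x in lborel. ennreal (c\<^sup>2 * G x) = 0"
    by (subst (asm) nn_integral_0_iff_AE) auto
  then have "AE x in lborel. G x = 0"
  proof eventually_elim
    case (elim x)
    have "G x \<ge> 0" by (simp add: G_def sum_nonneg)
    then show ?case using elim c by (simp add: mult_le_0_iff)
  qed
  then have "{x. G x \<noteq> 0} \<in> null_sets lborel" by (subst AE_iff_null_sets) auto
  then have neg: "negligible {x. G x \<noteq> 0}" by (simp add: negligible_iff_null_sets null_sets_completionI)
  \<comment> \<open>An open null set is empty, so the gradient of w vanishes everywhere and w is
    constant; \<open>rho_power_not_integrable\<close> then makes the constant 0.\<close>
  have "open {x. G x \<noteq> 0}"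
  proof -
    have "continuous_on UNIV G" unfolding G_def
      by (intro continuous_intros smooth_continuous smooth_partial_deriv sw)
    then show ?thesis by (intro open_Collect_neq continuous_on_const)
  qed
  then have "{x. G x \<noteq> 0} = {}" using neg open_not_negligible by blast
  then have "partial_deriv i w x = 0" for i x
    unfolding G_def by (auto simp: sum_nonneg_eq_0_iff)
  then have "(w has_derivative (\<lambda>t. 0)) (at x)" for x
    using smooth_has_derivative[OF sw, of x] by simp
  then obtain k where k: "\<And>x. w x = k"
    using has_derivative_zero_constant[OF convex_UNIV, of w] by auto
  have "k = 0"
  proof (rule ccontr)
    assume "k \<noteq> 0"
    have "integrable lborel (\<lambda>x. (1 / k\<^sup>2) * (w x / rho x)\<^sup>2)" using wi by (rule integrable_mult_right)
    then have "integrable lborel (\<lambda>x::real^'n. (1 / rho x)\<^sup>2)" using \<open>k \<noteq> 0\<close>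
        by (simp add: k power_divide)
    then show False using rho_power_not_integrable[OF n] by blast
  qed
  then have "w 0 = 0" using k by simp
  then show "(\<integral>x. z x * \<eta> x \<partial>lebesgue) = 0" by (simp add: w_def correl_def)
qed

section \<open>The Hilbert space of classes of square integrable functions\<close>

lemma L2_diff: "f \<in> L2 \<Longrightarrow> g \<in> L2 \<Longrightarrow> (\<lambda>x. f x - g x) \<in> L2"
  using L2_add[of f "\<lambda>x. -1 * g x"] L2_cmult[of g "-1"] by simp

text \<open>A partial equivalence whose domain is L2: functions outside L2 represent nothing, and
  the quotient consists exactly of the classes of L2 functions.\<close>

definition l2_rel :: "(real^'n::finite \<Rightarrow> real) \<Rightarrow> (real^'n \<Rightarrow> real) \<Rightarrow> bool" where
  "l2_rel f g \<longleftrightarrow> f \<in> L2 \<and> g \<in> L2 \<and> (AE x in lebesgue. f x = g x)"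

lemma part_equivp_l2_rel: "part_equivp l2_rel"
proof (rule part_equivpI)
  show "\<exists>f. l2_rel f f" using L2_zero by (auto simp: l2_rel_def)
  show "symp l2_rel" by (auto simp: symp_def l2_rel_def elim: eventually_mono)
  show "transp l2_rel"
  proof (rule transpI)
    fix f g h :: "real^'n \<Rightarrow> real" assume "l2_rel f g" "l2_rel g h"
    moreover then have "AE x in lebesgue. f x = h x" unfolding l2_rel_def by (auto elim: AE_mp)
    ultimately show "l2_rel f h" by (simp add: l2_rel_def)
  qed
qed

\<comment> \<open>A type rather than a set of functions, so that \<open>'n l2 ^ 'n\<close> and
  \<open>'n l2 ^ 'n ^ 'n\<close> become the Hilbert spaces of gradients and of Jacobians through the
  instances for vectors.\<close>
quotient_type 'n l2 = "real^'n::finite \<Rightarrow> real" / partial: l2_rel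
  by (rule part_equivp_l2_rel)

instantiation l2 :: (finite) real_vector
begin

lift_definition zero_l2 :: "'a l2" is "\<lambda>x. 0"
  by (simp add: l2_rel_def L2_zero)

lift_definition plus_l2 :: "'a l2 \<Rightarrow> 'a l2 \<Rightarrow> 'a l2" is "\<lambda>f g x. f x + g x"
  by (auto simp: l2_rel_def intro: L2_add elim: AE_mp)

lift_definition minus_l2 :: "'a l2 \<Rightarrow> 'a l2 \<Rightarrow> 'a l2" is "\<lambda>f g x. f x - g x"
  by (auto simp: l2_rel_def intro: L2_diff elim: AE_mp)

lift_definition uminus_l2 :: "'a l2 \<Rightarrow> 'a l2" is "\<lambda>f x. - f x"
  using L2_cmult[where c="-1"] by (auto simp: l2_rel_def elim: AE_mp)

lift_definition scaleR_l2 :: "real \<Rightarrow> 'a l2 \<Rightarrow> 'a l2" is "\<lambda>c f x. c * f x"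
  by (auto simp: l2_rel_def intro: L2_cmult elim: AE_mp)

instance
proof
  fix x y z :: "'a l2" and a b :: real
  show "x + y + z = x + (y + z)"
    by transfer (auto simp: l2_rel_def add.assoc intro: L2_add)
  show "x + y = y + x" by transfer (auto simp: l2_rel_def add.commute intro: L2_add)
  show "0 + x = x" by transfer (auto simp: l2_rel_def)
  show "- x + x = 0" by transfer (auto simp: l2_rel_def L2_zero)
  show "x - y = x + - y" by transfer (auto simp: l2_rel_def intro: L2_diff)
  show "a *\<^sub>R (x + y) = a *\<^sub>R x + a *\<^sub>R y"
    by transfer (auto simp: l2_rel_def distrib_left intro: L2_add L2_cmult)
  show "(a + b) *\<^sub>R x = a *\<^sub>R x + b *\<^sub>R x"
    by transfer (auto simp: l2_rel_def distrib_right intro: L2_add L2_cmult)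
  show "a *\<^sub>R b *\<^sub>R x = (a * b) *\<^sub>R x" by transfer (auto simp: l2_rel_def mult.assoc intro: L2_cmult)
  show "1 *\<^sub>R x = x" by transfer (auto simp: l2_rel_def)
qed

end

instantiation l2 :: (finite) real_inner
begin

lift_definition inner_l2 :: "'a l2 \<Rightarrow> 'a l2 \<Rightarrow> real" is "\<lambda>f g. \<integral>x. f x * g x \<partial>lebesgue"
  unfolding l2_rel_def
  by (intro integral_cong_AE borel_measurable_times) (auto intro: L2_measurable elim: AE_mp)

definition norm_l2 :: "'a l2 \<Rightarrow> real" where "norm_l2 x = sqrt (inner x x)"
definition dist_l2 :: "'a l2 \<Rightarrow> 'a l2 \<Rightarrow> real" where "dist_l2 x y = norm (x - y)"
definition sgn_l2 :: "'a l2 \<Rightarrow> 'a l2" where "sgn_l2 x = x /\<^sub>R norm x"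
definition uniformity_l2 :: "('a l2 \<times> 'a l2) filter" where
  "uniformity_l2 = (INF e\<in>{0<..}. principal {(x, y). dist x y < e})"
definition open_l2 :: "'a l2 set \<Rightarrow> bool" where
  "open_l2 U \<longleftrightarrow> (\<forall>x\<in>U. eventually (\<lambda>(x', y). x' = x \<longrightarrow> y \<in> U) uniformity)"

instance
proof
  fix x y z :: "'a l2" and a :: real and U :: "'a l2 set"
  show "inner x y = inner y x" by transfer (simp add: mult.commute)
  show "inner (x + y) z = inner x z + inner y z"
    by transfer (simp add: l2_rel_def distrib_right L2_mult_integrable)
  show "inner (a *\<^sub>R x) y = a * inner x y" by transfer (simp add: mult.assoc)
  show "0 \<le> inner x x" by transfer simp
  show "inner x x = 0 \<longleftrightarrow> x = 0"
  proof transfer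
    fix f :: "real^'a \<Rightarrow> real" assume "l2_rel f f"
    then have f: "f \<in> L2" by (simp add: l2_rel_def)
    show "((\<integral>x. f x * f x \<partial>lebesgue) = 0) = l2_rel f (\<lambda>x. 0)"
      using integral_nonneg_eq_0_iff_AE[OF L2_mult_integrable[OF f f]]
          by (simp add: l2_rel_def f L2_zero)
  qed
qed (rule norm_l2_def dist_l2_def sgn_l2_def uniformity_l2_def open_l2_def)+

end

section \<open>Passing between functions and classes\<close>

definition l2_class :: "(real^'n::finite \<Rightarrow> real) \<Rightarrow> 'n l2" where "l2_class = abs_l2"

definition l2_rep :: "'n::finite l2 \<Rightarrow> real^'n \<Rightarrow> real" where "l2_rep u = (SOME f. f \<in> L2 \<and> l2_class f
    = u)"

lemma l2_class_eq_iff: "f \<in> L2 \<Longrightarrow> g \<in> L2 \<Longrightarrow> l2_class f = l2_class g \<longleftrightarrow> (AE x in lebesgue. f x = g x)"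
  using Quotient3_rel_abs Quotient_l2
  by (auto simp: l2_class_def l2_rel_def Quotient_def)

lemma l2_rep: "l2_rep u \<in> L2" "l2_class (l2_rep u) = u"
proof -
  have "\<exists>f. f \<in> L2 \<and> l2_class f = u"
    by (induction u rule: l2.abs_induct) (auto simp: l2_class_def l2_rel_def)
  then have "l2_rep u \<in> L2 \<and> l2_class (l2_rep u) = u" unfolding l2_rep_def by (rule someI_ex)
  then show "l2_rep u \<in> L2" "l2_class (l2_rep u) = u" by auto
qed

lemma l2_rep_l2_class: "f \<in> L2 \<Longrightarrow> AE x in lebesgue. l2_rep (l2_class f) x = f x"
  using l2_class_eq_iff l2_rep by blast

lemma l2_class_zero: "l2_class (\<lambda>x. 0) = 0"
  by (simp add: l2_class_def zero_l2.abs_eq)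

lemma l2_class_add: "f \<in> L2 \<Longrightarrow> g \<in> L2 \<Longrightarrow> l2_class (\<lambda>x. f x + g x) = l2_class f + l2_class g"
  by (simp add: l2_class_def plus_l2.abs_eq l2_rel_def)

lemma l2_class_diff: "f \<in> L2 \<Longrightarrow> g \<in> L2 \<Longrightarrow> l2_class (\<lambda>x. f x - g x) = l2_class f - l2_class g"
  by (simp add: l2_class_def minus_l2.abs_eq l2_rel_def)

lemma l2_class_cmult: "f \<in> L2 \<Longrightarrow> l2_class (\<lambda>x. c * f x) = c *\<^sub>R l2_class f"
  by (simp add: l2_class_def scaleR_l2.abs_eq l2_rel_def)

lemma inner_l2_class: "f \<in> L2 \<Longrightarrow> g \<in> L2 \<Longrightarrow> inner (l2_class f) (l2_class g) = (\<integral>x. f x * g x \<partial>lebesgue)"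
  by (simp add: l2_class_def inner_l2.abs_eq l2_rel_def)

lemma norm_l2_class: "f \<in> L2 \<Longrightarrow> norm (l2_class f) = norm_L2 f"
  by (simp add: norm_eq_sqrt_inner inner_l2_class norm_L2_def power2_eq_square)

lemma inner_l2_rep: "inner u v = (\<integral>x. l2_rep u x * l2_rep v x \<partial>lebesgue)"
  using inner_l2_class[OF l2_rep(1) l2_rep(1), of u v] by (simp add: l2_rep(2))

lemma l2_class_sum:
  "finite I \<Longrightarrow> (\<And>i. i \<in> I \<Longrightarrow> f i \<in> L2) \<Longrightarrow> (\<lambda>x. \<Sum>i\<in>I. f i x) \<in> L2 \<and> l2_class (\<lambda>x. \<Sum>i\<in>I. f i x)
      = (\<Sum>i\<in>I. l2_class (f i))"
  by (induction rule: finite_induct) (auto simp: L2_zero l2_class_zero L2_add l2_class_add)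

text \<open>Riesz-Fischer: a sequence of representatives with \<open>\<parallel>f (k + 1) - f k\<parallel>\<^sup>2 \<le> 8^(-k)\<close>
  converges almost everywhere because \<open>\<Sum>k. 4^k (f (k + 1) - f k)\<^sup>2\<close> is integrable.\<close>

lemma L2_fast_Cauchy_limit:
  fixes X :: "nat \<Rightarrow> 'n::finite l2"
  assumes fast: "\<And>k. (norm (X (Suc k) - X k))\<^sup>2 \<le> (1/8) ^ k" and "Cauchy X"
  shows "\<exists>l. X \<longlonglongrightarrow> l"
proof -
  define f where "f k = l2_rep (X k)" for k
  have f: "f k \<in> L2" "l2_class (f k) = X k" for k by (auto simp: f_def l2_rep)
  note [measurable] = L2_measurable[OF f(1)]
  have nn: "(\<integral>\<^sup>+x. ennreal ((f i x - f j x)\<^sup>2) \<partial>lebesgue) = ennreal ((norm (X i - X j))\<^sup>2)" for i j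
  proof -
    have d: "(\<lambda>x. f i x - f j x) \<in> L2" by (intro L2_diff f)
    have "(norm (X i - X j))\<^sup>2 = (\<integral>x. (f i x - f j x)\<^sup>2 \<partial>lebesgue)"
      unfolding power2_norm_eq_inner using inner_l2_class[OF d d]
          by (simp add: l2_class_diff f power2_eq_square)
    then show ?thesis using L2_integrable_square[OF d] by (simp add: nn_integral_eq_integral)
  qed
  define g where "g x = (\<Sum>k. ennreal (4 ^ k * (f (Suc k) x - f k x)\<^sup>2))" for x
  have "(\<integral>\<^sup>+x. g x \<partial>lebesgue) = (\<Sum>k. (\<integral>\<^sup>+x. ennreal (4 ^ k * (f (Suc k) x - f k x)\<^sup>2) \<partial>lebesgue))"
    unfolding g_def by (rule nn_integral_suminf) measurable
  also have "\<dots> \<le> (\<Sum>k. ennreal ((1/2) ^ k))"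
  proof (rule suminf_le)
    fix k
    have "(\<integral>\<^sup>+x. ennreal (4 ^ k * (f (Suc k) x - f k x)\<^sup>2) \<partial>lebesgue)
        = ennreal (4 ^ k) * (\<integral>\<^sup>+x. ennreal ((f (Suc k) x - f k x)\<^sup>2) \<partial>lebesgue)"
      by (simp add: ennreal_mult nn_integral_cmult)
    also have "\<dots> = ennreal (4 ^ k * (norm (X (Suc k) - X k))\<^sup>2)" by (simp add: nn ennreal_mult)
    also have "\<dots> \<le> ennreal (4 ^ k * (1/8) ^ k)" by (intro ennreal_leI mult_left_mono fast) auto
    also have "(4::real) ^ k * (1/8) ^ k = (1/2) ^ k" by (simp flip: power_mult_distrib)
    finally show "(\<integral>\<^sup>+x. ennreal (4 ^ k * (f (Suc k) x - f k x)\<^sup>2) \<partial>lebesgue) \<le> ennreal ((1/2) ^ k)" .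
  qed auto
  also have "\<dots> = ennreal (\<Sum>k. (1/2) ^ k)" by (rule suminf_ennreal2) (auto intro: summable_geometric)
  also have "\<dots> < \<infinity>" by simp
  finally have "(\<integral>\<^sup>+x. g x \<partial>lebesgue) \<noteq> \<infinity>" by simp
  then have "AE x in lebesgue. g x \<noteq> \<infinity>" unfolding g_def by (intro nn_integral_PInf_AE) measurable
  then have conv: "AE x in lebesgue. convergent (\<lambda>k. f k x)"
  proof eventually_elim
    case (elim x)
    define M where "M = enn2real (g x)"
    have M0: "M \<ge> 0" by (simp add: M_def)
    have M: "g x = ennreal M" using elim by (simp add: M_def less_top)
    \<comment> \<open>A single term of the series is at most its finite sum M, so the increments
      decay like 2^(-k).\<close>
    have b: "\<bar>f (Suc k) x - f k x\<bar> \<le> sqrt M * (1/2) ^ k" for k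
    proof -
      define h where "h k = ennreal (4 ^ k * (f (Suc k) x - f k x)\<^sup>2)" for k
      have "sum h {k} \<le> suminf h" by (rule sum_le_suminf) (auto intro: summableI)
      then have "ennreal (4 ^ k * (f (Suc k) x - f k x)\<^sup>2) \<le> g x" by (simp add: g_def h_def[abs_def])
      then have "4 ^ k * (f (Suc k) x - f k x)\<^sup>2 \<le> M" by (simp add: M ennreal_le_iff M0)
      moreover have "(2 ^ k)\<^sup>2 = (4::real) ^ k"
        unfolding power2_eq_square power_mult_distrib[symmetric] by simp
      ultimately have "\<bar>2 ^ k * (f (Suc k) x - f k x)\<bar>\<^sup>2 \<le> M"
        by (simp only: power_mult_distrib power2_abs)
      then have "\<bar>2 ^ k * (f (Suc k) x - f k x)\<bar> \<le> sqrt M" by (rule real_le_rsqrt)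
      then show ?thesis by (simp add: abs_mult power_divide le_divide_eq mult.commute)
    qed
    have "summable (\<lambda>k. sqrt M * (1/2) ^ k)" by (intro summable_mult summable_geometric) simp
    then have "summable (\<lambda>k. f (Suc k) x - f k x)"
      by (rule summable_comparison_test'[where N=0]) (use b in simp)
    then have "convergent (\<lambda>n. \<Sum>k<n. f (Suc k) x - f k x)" by (simp add: summable_iff_convergent)
    then have "convergent (\<lambda>n. f n x - f 0 x)" by (simp only: sum_lessThan_telescope[of "\<lambda>k. f k x"])
    then have "convergent (\<lambda>n. (f n x - f 0 x) + f 0 x)" by (intro convergent_add convergent_const)
    then show ?case by simp
  qed
  define F where "F x = lim (\<lambda>k. f k x)" for x
  have Fm [measurable]: "F \<in> borel_measurable lebesgue" unfolding F_def by measurable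
  have ae: "AE x in lebesgue. (\<lambda>k. f k x) \<longlonglongrightarrow> F x"
    using conv by eventually_elim (simp add: F_def convergent_LIMSEQ_iff)
  \<comment> \<open>Fatou's lemma carries the Cauchy bound at index j over to the pointwise limit
    F.\<close>
  have est: "(\<integral>\<^sup>+x. ennreal ((F x - f j x)\<^sup>2) \<partial>lebesgue) \<le> ennreal (e\<^sup>2)"
    if "\<And>i. i \<ge> j \<Longrightarrow> norm (X i - X j) \<le> e" for e j
  proof -
    have "(\<integral>\<^sup>+x. ennreal ((F x - f j x)\<^sup>2) \<partial>lebesgue) = (\<integral>\<^sup>+x. liminf (\<lambda>i. ennreal ((f i x - f j x)\<^sup>2))
        \<partial>lebesgue)"
    proof (rule nn_integral_cong_AE, use ae in eventually_elim)
      case (elim x)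
      then have "(\<lambda>i. ennreal ((f i x - f j x)\<^sup>2)) \<longlonglongrightarrow> ennreal ((F x - f j x)\<^sup>2)"
        by (intro tendsto_ennrealI tendsto_intros)
      then show ?case by (rule lim_imp_Liminf[symmetric, OF trivial_limit_sequentially])
    qed
    also have "\<dots> \<le> liminf (\<lambda>i. \<integral>\<^sup>+x. ennreal ((f i x - f j x)\<^sup>2) \<partial>lebesgue)"
      by (rule nn_integral_liminf) measurable
    also have "\<dots> \<le> liminf (\<lambda>i. ennreal (e\<^sup>2))"
    proof (rule Liminf_mono)
      show "\<forall>\<^sub>F i in sequentially. (\<integral>\<^sup>+x. ennreal ((f i x - f j x)\<^sup>2) \<partial>lebesgue) \<le> ennreal (e\<^sup>2)"
        using eventually_ge_at_top[of j]
        by eventually_elim (auto simp: nn intro!: ennreal_leI power_mono that)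
    qed
    also have "\<dots> = ennreal (e\<^sup>2)" by (simp add: Liminf_const)
    finally show ?thesis .
  qed
  have dL2: "(\<lambda>x. F x - f j x) \<in> L2" if "\<And>i. i \<ge> j \<Longrightarrow> norm (X i - X j) \<le> e" for e j
  proof -
    have "integrable lebesgue (\<lambda>x. (F x - f j x)\<^sup>2)"
    proof (rule integrableI_bounded)
      have "(\<integral>\<^sup>+x. ennreal ((F x - f j x)\<^sup>2) \<partial>lebesgue) < \<infinity>"
        using le_less_trans[OF est[of j e] ennreal_less_top] that by simp
      then show "(\<integral>\<^sup>+x. ennreal (norm ((F x - f j x)\<^sup>2)) \<partial>lebesgue) < \<infinity>" by simp
    qed measurable
    then show ?thesis by (auto simp: L2_def)
  qed
  obtain j0 where j0: "\<forall>m\<ge>j0. \<forall>n\<ge>j0. dist (X m) (X n) < 1"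
    using metric_CauchyD[OF \<open>Cauchy X\<close> zero_less_one] by blast
  then have "norm (X i - X j0) \<le> 1" if "i \<ge> j0" for i
    using that by (simp add: dist_norm less_imp_le)
  then have "(\<lambda>x. (F x - f j0 x) + f j0 x) \<in> L2" by (intro L2_add f dL2)
  then have F: "F \<in> L2" by simp
  have "X \<longlonglongrightarrow> l2_class F"
  proof (rule metric_LIMSEQ_I)
    fix r :: real assume r: "r > 0"
    obtain N where "\<forall>i\<ge>N. \<forall>j\<ge>N. dist (X i) (X j) < r / 2"
      using metric_CauchyD[OF \<open>Cauchy X\<close>, of "r / 2"] r by auto
    then have N: "norm (X i - X j) < r / 2" if "i \<ge> N" "j \<ge> N" for i j
      using that by (simp add: dist_norm)
    have "dist (X j) (l2_class F) < r" if "j \<ge> N" for j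
    proof -
      have d: "(\<lambda>x. F x - f j x) \<in> L2" by (intro L2_diff F f)
      have e1: "(norm (l2_class F - X j))\<^sup>2 = (\<integral>x. (F x - f j x)\<^sup>2 \<partial>lebesgue)"
        unfolding power2_norm_eq_inner using inner_l2_class[OF d d]
            by (simp add: l2_class_diff f F power2_eq_square)
      have "ennreal (\<integral>x. (F x - f j x)\<^sup>2 \<partial>lebesgue) \<le> ennreal ((r / 2)\<^sup>2)"
        using est[of j "r / 2", OF less_imp_le[OF N[OF order_trans[OF that] that]]]
            L2_integrable_square[OF d]
        by (subst nn_integral_eq_integral[symmetric]) auto
      then have "(\<integral>x. (F x - f j x)\<^sup>2 \<partial>lebesgue) \<le> (r / 2)\<^sup>2"
        by (subst (asm) ennreal_le_iff) auto
      then have "(norm (l2_class F - X j))\<^sup>2 \<le> (r / 2)\<^sup>2" by (subst e1)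
      then have "norm (l2_class F - X j) \<le> r / 2" by (rule power2_le_imp_le) (use r in simp)
      then show ?thesis using r by (simp add: dist_norm norm_minus_commute)
    qed
    then show "\<exists>N. \<forall>j\<ge>N. dist (X j) (l2_class F) < r" by blast
  qed
  then show ?thesis by blast
qed

instance l2 :: (finite) banach
proof
  fix X :: "nat \<Rightarrow> 'a l2" assume X: "Cauchy X"
  have "\<exists>N. \<forall>m\<ge>N. \<forall>n\<ge>N. norm (X m - X n) < (1/3) ^ k" for k :: nat
    using metric_CauchyD[OF X, of "(1/3) ^ k"] by (auto simp: dist_norm)
  then obtain N where N: "\<And>k m n. m \<ge> N k \<Longrightarrow> n \<ge> N k \<Longrightarrow> norm (X m - X n) < (1/3) ^ k" by metis
  \<comment> \<open>The sum makes r dominate N, and the summand k makes it strictly increasing.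
    Consecutive terms are then within 3^(-k), whose square 9^(-k) lies below the 8^(-k) of
    \<open>L2_fast_Cauchy_limit\<close>.\<close>
  define r where "r k = (\<Sum>i\<le>k. N i) + k" for k
  have rN: "N k \<le> r k" for k
    unfolding r_def using member_le_sum[of k "{..k}" N] by simp
  have mono: "strict_mono r" by (rule strict_monoI_Suc) (simp add: r_def)
  have "(norm ((X \<circ> r) (Suc k) - (X \<circ> r) k))\<^sup>2 \<le> (1/8) ^ k" for k
  proof -
    have "r k < r (Suc k)" using mono by (simp add: strict_mono_Suc_iff)
    then have "norm (X (r (Suc k)) - X (r k)) \<le> (1/3) ^ k"
      using N[of k "r (Suc k)" "r k"] rN[of k] by simp
    then have "(norm (X (r (Suc k)) - X (r k)))\<^sup>2 \<le> ((1/3) ^ k)\<^sup>2" by (intro power_mono) auto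
    also have "((1/3::real) ^ k)\<^sup>2 = (1/9) ^ k"
      by (simp add: power_mult_distrib[symmetric] power2_eq_square)
    also have "\<dots> \<le> (1/8) ^ k" by (intro power_mono) auto
    finally show ?thesis by simp
  qed
  moreover have "Cauchy (X \<circ> r)" using X mono by (rule Cauchy_subseq_Cauchy)
  ultimately obtain l where "(X \<circ> r) \<longlonglongrightarrow> l" using L2_fast_Cauchy_limit by blast
  then have "X \<longlonglongrightarrow> l" by (rule Cauchy_converges_subseq[OF X mono])
  then show "convergent X" by (auto simp: convergent_def)
qed

section \<open>Hardy's inequality\<close>

lemma smooth_coord: "smooth (\<lambda>x::real^'n::finite. x $ i)"
proof -
  have D: "((\<lambda>x::real^'n. x $ i) has_derivative (\<lambda>t. t $ i)) (at x)" for x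
    by (rule bounded_linear_imp_has_derivative[OF bounded_linear_vec_nth])
  have p: "partial_deriv j (\<lambda>x::real^'n. x $ i) = (\<lambda>x. (axis j 1 :: real^'n) $ i)" for j
    by (rule ext) (rule partial_deriv_eq[OF D])
  show ?thesis
  proof (rule smooth_coinduct[where S="insert (\<lambda>x. x $ i) (range (\<lambda>c x. c))"])
    show "g differentiable (at x)" if "g \<in> insert (\<lambda>x. x $ i) (range (\<lambda>c x. c))"
        for g :: "real^'n \<Rightarrow> real" and x
      using that D differentiableI by auto
    show "partial_deriv j g \<in> insert (\<lambda>x. x $ i) (range (\<lambda>c x. c))"
      if "g \<in> insert (\<lambda>x. x $ i) (range (\<lambda>c x. c))" for g :: "real^'n \<Rightarrow> real" and j
      using that by (auto simp: p partial_deriv_const)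
  qed simp
qed

lemma rho_square_sum: "(rho x)\<^sup>2 = 1 + (\<Sum>i\<in>UNIV. x $ i * x $ i)"
  by (simp add: rho_square power2_norm_eq_inner inner_vec_def)

text \<open>Squaring removes the root from the weight, so that all derivatives are rational
  functions of the coordinates.\<close>

definition inv_rho2 :: "real^'n::finite \<Rightarrow> real" where
  "inv_rho2 x = 1 / (rho x)\<^sup>2"

lemma inv_rho2_has_derivative:
  "(inv_rho2 has_derivative (\<lambda>t. - 2 * inner x t * (inv_rho2 x)\<^sup>2)) (at x)"
proof -
  have e: "inv_rho2 = (\<lambda>x. inverse (1 + inner x x))"
    by (simp add: inv_rho2_def fun_eq_iff rho_square power2_norm_eq_inner inverse_eq_divide)
  have "1 + inner x x \<noteq> 0" using inner_ge_zero[of x] by linarith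
  then have "((\<lambda>x. inverse (1 + inner x x)) has_derivative
      (\<lambda>t. - (inverse (1 + inner x x) * (inner x t + inner t x) * inverse (1 + inner x x)))) (at x)"
    by (auto intro!: derivative_eq_intros)
  then show ?thesis unfolding e
    by (rule has_derivative_eq_rhs) (simp add: fun_eq_iff inner_commute power2_eq_square)
qed

lemma inv_rho2_partial: "partial_deriv i inv_rho2 x = -2 * x $ i * (inv_rho2 x)\<^sup>2"
  by (simp add: partial_deriv_eq[OF inv_rho2_has_derivative] inner_axis)

lemma inv_rho2_differentiable: "inv_rho2 differentiable (at x)"
  using inv_rho2_has_derivative differentiableI by blast

lemma inv_rho2_power_partial:
  "partial_deriv i (\<lambda>x. inv_rho2 x ^ k) x = - (2 * real k) * x $ i * inv_rho2 x ^ Suc k"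
  "(\<lambda>x. inv_rho2 x ^ k) differentiable (at x)"
proof (induction k arbitrary: x)
  case 0
  { case 1 show ?case by (simp add: partial_deriv_const) }
  { case 2 show ?case by simp }
next
  case (Suc k)
  { case 1
    show ?case
      using partial_deriv_mult[where x=x and i=i, OF inv_rho2_differentiable Suc.IH(2)]
      by (simp add: inv_rho2_partial Suc.IH(1) algebra_simps power2_eq_square) }
  { case 2
    show ?case
      using differentiable_mult[OF inv_rho2_differentiable Suc.IH(2)] by simp }
qed

text \<open>Products of a smooth p with a power of \<open>inv_rho2\<close> are stable under
  derivatives once both terms of the product rule are brought to the power k + 1, by inserting 1 =
  (1 + norm x^2) \<open>inv_rho2 x\<close>.\<close>

lemma smooth_inv_rho2: "smooth inv_rho2"
proof (rule smooth_coinduct)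
  let ?S = "{(\<lambda>x::real^'a. p x * inv_rho2 x ^ k) | p k. smooth p}"
  show "inv_rho2 \<in> ?S"
    by (intro CollectI exI[of _ "\<lambda>x. 1"] exI[of _ 1]) (simp add: smooth_const)
  show "g differentiable (at x)" if "g \<in> ?S" for g x
    using that differentiable_mult[OF smooth_differentiable inv_rho2_power_partial(2)] by blast
  show "partial_deriv i g \<in> ?S" if "g \<in> ?S" for g i
  proof -
    obtain p k where g: "g = (\<lambda>x. p x * inv_rho2 x ^ k)" and p: "smooth p" using \<open>g \<in> ?S\<close> by blast
    define p' where "p' x = partial_deriv i p x * (1 + (\<Sum>j\<in>UNIV. x $ j * x $ j)) + (- (2 * real k))
        * (x $ i * p x)" for x
    have "smooth p'"
      unfolding p'_def
      by (intro smooth_add smooth_mult smooth_partial_deriv p smooth_const smooth_sum smooth_coord) simp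
    moreover have "partial_deriv i g = (\<lambda>x. p' x * inv_rho2 x ^ Suc k)"
    proof
      fix x :: "real^'a"
      have "(1 + (\<Sum>j\<in>UNIV. x $ j * x $ j)) * inv_rho2 x = 1"
        unfolding rho_square_sum[symmetric] by (simp add: inv_rho2_def)
      then have q: "inv_rho2 x ^ k = (1 + (\<Sum>j\<in>UNIV. x $ j * x $ j)) * inv_rho2 x ^ Suc k"
        by (simp only: power_Suc mult.assoc[symmetric] mult_1_left)
      have "partial_deriv i g x = p x * (- (2 * real k) * x $ i * inv_rho2 x ^ Suc k) + partial_deriv i
          p x * inv_rho2 x ^ k"
        unfolding g using partial_deriv_mult[OF smooth_differentiable[OF p] inv_rho2_power_partial(2)]
        by (simp add: inv_rho2_power_partial(1))
      also have "\<dots> = p' x * inv_rho2 x ^ Suc k"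
        unfolding p'_def by (subst q) (simp only: algebra_simps)
      finally show "partial_deriv i g x = p' x * inv_rho2 x ^ Suc k" .
    qed
    ultimately show ?thesis by blast
  qed
qed

text \<open>Integrate \<phi>^2 against the divergence of X = x / rho^2. For n \<ge> 3 the divergence
  (n - 2) / rho^2 + 2 / rho^4 is at least 1 / rho^2, and norm X is at most 1 / rho. After
  integration by parts, Young's inequality leaves half of the left-hand side to be absorbed, which
  produces the factor 4.\<close>

lemma hardy_inequality_test:
  fixes \<phi> :: "real^'n::finite \<Rightarrow> real"
  assumes n: "CARD('n) \<ge> 3" and \<phi>: "\<phi> \<in> test_functions"
  shows "(\<integral>x. (\<phi> x / rho x)\<^sup>2 \<partial>lebesgue) \<le> 4 * (\<integral>x. (\<Sum>i\<in>UNIV. (partial_deriv i \<phi> x)\<^sup>2) \<partial>lebesgue)"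
proof -
  define X where "X i x = x $ i * inv_rho2 x" for i and x :: "real^'n"
  have sX: "smooth (X i)" for i
    unfolding X_def by (intro smooth_mult smooth_coord smooth_inv_rho2)
  have dX: "partial_deriv i (X i) x = inv_rho2 x - 2 * (x $ i)\<^sup>2 * (inv_rho2 x)\<^sup>2" for i x
  proof -
    have "partial_deriv i (\<lambda>x::real^'n. x $ i) x = 1"
      using partial_deriv_eq[OF bounded_linear_imp_has_derivative[OF bounded_linear_vec_nth], of i i x]
          by simp
    then show ?thesis
      using partial_deriv_mult[where x=x and i=i and f="\<lambda>x. x $ i",
          OF smooth_differentiable[OF smooth_coord] smooth_differentiable[OF smooth_inv_rho2]]
      by (simp add: X_def[abs_def] inv_rho2_partial power2_eq_square algebra_simps)
  qed
  have s2: "(\<lambda>x. \<phi> x * \<phi> x) \<in> test_functions" by (intro test_mult test_smooth \<phi>)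
  have d2: "partial_deriv i (\<lambda>x. \<phi> x * \<phi> x) x = 2 * (\<phi> x * partial_deriv i \<phi> x)" for i x
    using partial_deriv_mult[where x=x and i=i, OF smooth_differentiable[OF test_smooth[OF \<phi>]]
        smooth_differentiable[OF test_smooth[OF \<phi>]]] by simp
  have int1: "integrable lebesgue (\<lambda>x. X i x * (2 * (\<phi> x * partial_deriv i \<phi> x)))" for i
    by (intro test_integrable test_mult sX smooth_const test_partial_deriv \<phi> test_smooth)
  have int2: "integrable lebesgue (\<lambda>x. partial_deriv i (X i) x * (\<phi> x * \<phi> x))" for i
    by (intro test_integrable test_mult sX smooth_partial_deriv \<phi> test_smooth)
  have intq: "integrable lebesgue (\<lambda>x. (\<phi> x / rho x)\<^sup>2)"
    using L2_integrable_square[OF test_over_rho_L2[OF \<phi>]] .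
  have intg: "integrable lebesgue (\<lambda>x. \<Sum>i\<in>UNIV. (partial_deriv i \<phi> x)\<^sup>2)"
    by (intro Bochner_Integration.integrable_sum L2_integrable_square test_L2 test_partial_deriv \<phi>)
  have "(\<integral>x. (\<phi> x / rho x)\<^sup>2 \<partial>lebesgue) \<le> (\<integral>x. (\<Sum>i\<in>UNIV. partial_deriv i (X i) x * (\<phi> x * \<phi> x))
      \<partial>lebesgue)"
  proof (rule integral_mono[OF intq])
    show "integrable lebesgue (\<lambda>x. \<Sum>i\<in>UNIV. partial_deriv i (X i) x * (\<phi> x * \<phi> x))"
      by (intro Bochner_Integration.integrable_sum int2)
    fix x :: "real^'n"
    have "(\<Sum>i\<in>UNIV. partial_deriv i (X i) x) = real CARD('n) * inv_rho2 x - 2 * (inv_rho2 x)\<^sup>2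
        * (\<Sum>i\<in>UNIV. x $ i * x $ i)"
      by (simp add: dX sum_subtractf sum_distrib_left power2_eq_square mult_ac)
    also have "(\<Sum>i\<in>UNIV. x $ i * x $ i) = (rho x)\<^sup>2 - 1" by (simp add: rho_square_sum)
    also have "real CARD('n) * inv_rho2 x - 2 * (inv_rho2 x)\<^sup>2 * ((rho x)\<^sup>2 - 1)
        = (real CARD('n) - 2) * inv_rho2 x + 2 * (inv_rho2 x)\<^sup>2"
    proof -
      have "inv_rho2 x * (rho x)\<^sup>2 = 1" by (simp add: inv_rho2_def)
      then have "(inv_rho2 x)\<^sup>2 * (rho x)\<^sup>2 = inv_rho2 x"
          by (simp only: power2_eq_square mult.assoc mult_1_right)
      then have "2 * (inv_rho2 x)\<^sup>2 * ((rho x)\<^sup>2 - 1) = 2 * inv_rho2 x - 2 * (inv_rho2 x)\<^sup>2"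
        by (simp only: right_diff_distrib mult.assoc mult_1_right)
      then show ?thesis by (simp only: left_diff_distrib)
    qed
    also have "\<dots> \<ge> inv_rho2 x"
    proof -
      have "1 * inv_rho2 x \<le> (real CARD('n) - 2) * inv_rho2 x"
        using n by (intro mult_right_mono) (auto simp: inv_rho2_def)
      moreover have "0 \<le> 2 * (inv_rho2 x)\<^sup>2" by simp
      ultimately show ?thesis by linarith
    qed
    finally have "inv_rho2 x * (\<phi> x * \<phi> x) \<le> (\<Sum>i\<in>UNIV. partial_deriv i (X i) x) * (\<phi> x * \<phi> x)"
      by (intro mult_right_mono) auto
    then show "(\<phi> x / rho x)\<^sup>2 \<le> (\<Sum>i\<in>UNIV. partial_deriv i (X i) x * (\<phi> x * \<phi> x))"
      by (simp add: sum_distrib_right power2_eq_square inv_rho2_def)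
  qed
  also have "\<dots> = (\<Sum>i\<in>UNIV. (\<integral>x. partial_deriv i (X i) x * (\<phi> x * \<phi> x) \<partial>lebesgue))"
    by (rule Bochner_Integration.integral_sum) (rule int2)
  also have "\<dots> = (\<Sum>i\<in>UNIV. - (\<integral>x. X i x * (2 * (\<phi> x * partial_deriv i \<phi> x)) \<partial>lebesgue))"
    using integral_by_parts[OF sX s2] by (simp add: d2)
  also have "\<dots> = - (\<integral>x. (\<Sum>i\<in>UNIV. X i x * (2 * (\<phi> x * partial_deriv i \<phi> x))) \<partial>lebesgue)"
    by (subst Bochner_Integration.integral_sum) (auto simp: sum_negf intro: int1)
  also have "\<dots> = (\<integral>x. - (\<Sum>i\<in>UNIV. X i x * (2 * (\<phi> x * partial_deriv i \<phi> x))) \<partial>lebesgue)" by simp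
  also have "\<dots> \<le> (\<integral>x. (1/2) * (\<phi> x / rho x)\<^sup>2 + 2 * (\<Sum>i\<in>UNIV. (partial_deriv i \<phi> x)\<^sup>2) \<partial>lebesgue)"
  proof (rule integral_mono)
    show "integrable lebesgue (\<lambda>x. - (\<Sum>i\<in>UNIV. X i x * (2 * (\<phi> x * partial_deriv i \<phi> x))))"
      by (intro Bochner_Integration.integrable_minus Bochner_Integration.integrable_sum int1)
    show "integrable lebesgue (\<lambda>x. (1/2) * (\<phi> x / rho x)\<^sup>2 + 2 * (\<Sum>i\<in>UNIV. (partial_deriv i \<phi> x)\<^sup>2))"
      by (intro Bochner_Integration.integrable_add integrable_mult_right intq intg)
    fix x :: "real^'n"
    \<comment> \<open>The weight is distributed so that a^2 is the integrand on the left, while in b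
      the factor rho compensates the decay of X and b^2 is at most the squared gradient.\<close>
    define a where "a = \<phi> x / rho x"
    define b where "b = rho x * (\<Sum>i\<in>UNIV. partial_deriv i \<phi> x * X i x)"
    have "- (\<Sum>i\<in>UNIV. X i x * (2 * (\<phi> x * partial_deriv i \<phi> x))) = - 2 * a * b"
      by (simp add: a_def b_def sum_distrib_left sum_negf mult_ac)
    also have "\<dots> \<le> (1/2) * a\<^sup>2 + 2 * b\<^sup>2"
      using zero_le_power2[of "a + 2 * b"] by (simp add: power2_sum power_mult_distrib)
    also have "b\<^sup>2 \<le> (\<Sum>i\<in>UNIV. (partial_deriv i \<phi> x)\<^sup>2)"
    proof -
      have "(\<Sum>i\<in>UNIV. partial_deriv i \<phi> x * X i x)\<^sup>2 \<le> (\<Sum>i\<in>UNIV. (partial_deriv i \<phi> x)\<^sup>2)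
          * (\<Sum>i\<in>UNIV. (X i x)\<^sup>2)"
        by (rule Cauchy_Schwarz_ineq_sum)
      then have "b\<^sup>2 \<le> (rho x)\<^sup>2 * ((\<Sum>i\<in>UNIV. (partial_deriv i \<phi> x)\<^sup>2) * (\<Sum>i\<in>UNIV. (X i x)\<^sup>2))"
        unfolding b_def power_mult_distrib by (intro mult_left_mono) auto
      also have "\<dots> = (\<Sum>i\<in>UNIV. (partial_deriv i \<phi> x)\<^sup>2) * ((rho x)\<^sup>2 * (\<Sum>i\<in>UNIV. (X i x)\<^sup>2))"
          by (simp only: mult_ac)
      also have "\<dots> \<le> (\<Sum>i\<in>UNIV. (partial_deriv i \<phi> x)\<^sup>2) * 1"
      proof (intro mult_left_mono)
        have "(\<Sum>i\<in>UNIV. (X i x)\<^sup>2) = (inv_rho2 x)\<^sup>2 * (\<Sum>i\<in>UNIV. x $ i * x $ i)"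
          by (simp only: X_def power_mult_distrib sum_distrib_left mult.commute power2_eq_square[of
              "x $ _"])
        also have "(\<Sum>i\<in>UNIV. x $ i * x $ i) = (rho x)\<^sup>2 - 1" by (simp add: rho_square_sum)
        finally have "(rho x)\<^sup>2 * (\<Sum>i\<in>UNIV. (X i x)\<^sup>2) = ((rho x)\<^sup>2 - 1) / (rho x)\<^sup>2"
          by (simp add: power2_eq_square inv_rho2_def)
        also have "\<dots> \<le> 1" using rho_pos[of x] by (simp add: divide_le_eq)
        finally show "(rho x)\<^sup>2 * (\<Sum>i\<in>UNIV. (X i x)\<^sup>2) \<le> 1" .
      qed (simp add: sum_nonneg)
      finally show ?thesis by simp
    qed
    finally show "- (\<Sum>i\<in>UNIV. X i x * (2 * (\<phi> x * partial_deriv i \<phi> x)))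
        \<le> (1/2) * (\<phi> x / rho x)\<^sup>2 + 2 * (\<Sum>i\<in>UNIV. (partial_deriv i \<phi> x)\<^sup>2)" by (simp add: a_def)
  qed
  also have "\<dots> = (1/2) * (\<integral>x. (\<phi> x / rho x)\<^sup>2 \<partial>lebesgue)
      + 2 * (\<integral>x. (\<Sum>i\<in>UNIV. (partial_deriv i \<phi> x)\<^sup>2) \<partial>lebesgue)"
    using intq intg by simp
  finally show ?thesis by linarith
qed

section \<open>Gradients in the closure of the test functions\<close>

definition grad :: "(real^'n::finite \<Rightarrow> real) \<Rightarrow> 'n l2 ^ 'n" where
  "grad \<phi> = (\<chi> i. l2_class (partial_deriv i \<phi>))"

definition grad_space :: "('n::finite l2 ^ 'n) set" where
  "grad_space = closure (grad ` test_functions)"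

text \<open>A relation between a function and the classes of its distributional derivatives: u is a
  representative, fixed only almost everywhere, whereas U is a vector of classes. It sidesteps the
  choice hidden in \<open>weak_partial\<close>.\<close>

definition weak_grad :: "(real^'n::finite \<Rightarrow> real) \<Rightarrow> 'n l2 ^ 'n \<Rightarrow> bool" where
  "weak_grad u U \<longleftrightarrow> (\<lambda>x. u x / rho x) \<in> L2 \<and>
    (\<forall>i. \<forall>\<phi>\<in>test_functions. (\<integral>x. u x * partial_deriv i \<phi> x \<partial>lebesgue) = - inner (U $ i) (l2_class \<phi>))"

lemma L2_over_rho: "f \<in> L2 \<Longrightarrow> (\<lambda>x. f x / rho x) \<in> L2"
proof -
  assume f: "f \<in> L2"
  have m: "(\<lambda>x. 1 / rho x) \<in> borel_measurable lebesgue"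
    by (intro borel_measurable_divide borel_measurable_const rho_lebesgue)
  have "\<bar>1 / rho x\<bar> \<le> 1" for x using rho_ge_1[of x] by (simp add: abs_of_pos rho_pos)
  then have "(\<lambda>x. (1 / rho x) * f x) \<in> L2" by (intro L2_bounded_mult[where K=1, OF f m]) auto
  then show ?thesis by simp
qed

text \<open>Density of the test functions in L2, in dual form and as a consequence of the
  fundamental lemma.\<close>

lemma l2_eq_0I:
  assumes "\<And>\<phi>. \<phi> \<in> test_functions \<Longrightarrow> inner u (l2_class \<phi>) = 0"
  shows "u = 0"
proof -
  have "(\<integral>x. l2_rep u x * \<phi> x \<partial>lebesgue) = 0" if "\<phi> \<in> test_functions" for \<phi>
    using inner_l2_class[OF l2_rep(1) test_L2[OF that], of u] assms[OF that] by (simp add: l2_rep(2))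
  then have "AE x in lebesgue. l2_rep u x = 0" by (rule fundamental_lemma[OF L2_over_rho[OF l2_rep(1)]])
  then have "l2_class (l2_rep u) = l2_class (\<lambda>x. 0)" by (simp add: l2_class_eq_iff l2_rep(1) L2_zero)
  then show ?thesis by (simp add: l2_rep(2) l2_class_zero)
qed

text \<open>Since rho \<ge> 1, L2 lies in the weighted space and \<open>weighted_liouville\<close>
  applies. The Laplacian is kept as a sum of inner products, the shape in which it arises from
  gradients.\<close>

lemma l2_liouville:
  fixes u :: "'n::finite l2"
  assumes "CARD('n) \<ge> 3"
    and "\<And>\<phi>. \<phi> \<in> test_functions \<Longrightarrow> (\<Sum>i\<in>UNIV. inner u (l2_class (partial_deriv i (partial_deriv i \<phi>))))
        = 0"
  shows "u = 0"
proof -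
  have "(\<integral>x. l2_rep u x * (\<Sum>i\<in>UNIV. partial_deriv i (partial_deriv i \<phi>) x) \<partial>lebesgue) = 0"
    if \<phi>: "\<phi> \<in> test_functions" for \<phi>
  proof -
    have t: "partial_deriv i (partial_deriv i \<phi>) \<in> L2" for i by (intro test_L2 test_partial_deriv \<phi>)
    have s: "(\<lambda>x. \<Sum>i\<in>UNIV. partial_deriv i (partial_deriv i \<phi>) x) \<in> L2"
      "l2_class (\<lambda>x. \<Sum>i\<in>UNIV. partial_deriv i (partial_deriv i \<phi>) x)
          = (\<Sum>i\<in>UNIV. l2_class (partial_deriv i (partial_deriv i \<phi>)))"
      using l2_class_sum[where f="\<lambda>i. partial_deriv i (partial_deriv i \<phi>)", OF finite_class.finite_UNIV
          t] by auto
    show ?thesis using inner_l2_class[OF l2_rep(1) s(1), of u] assms(2)[OF \<phi>]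
        by (simp add: l2_rep(2) s(2) inner_sum_right)
  qed
  then have "AE x in lebesgue. l2_rep u x = 0"
      by (rule weighted_liouville[OF assms(1) L2_over_rho[OF l2_rep(1)]])
  then have "l2_class (l2_rep u) = l2_class (\<lambda>x. 0)" by (simp add: l2_class_eq_iff l2_rep(1) L2_zero)
  then show ?thesis by (simp add: l2_rep(2) l2_class_zero)
qed

lemma grad_add: "\<phi> \<in> test_functions \<Longrightarrow> \<psi> \<in> test_functions \<Longrightarrow> grad (\<lambda>x. \<phi> x + \<psi> x) = grad \<phi> + grad \<psi>"
proof -
  assume t: "\<phi> \<in> test_functions" "\<psi> \<in> test_functions"
  have "partial_deriv i (\<lambda>x. \<phi> x + \<psi> x) = (\<lambda>x. partial_deriv i \<phi> x + partial_deriv i \<psi> x)" for i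
    by (rule ext) (intro partial_deriv_add smooth_differentiable test_smooth t)
  then show ?thesis
    by (simp add: grad_def vec_eq_iff l2_class_add test_L2 test_partial_deriv t)
qed

lemma grad_cmult: "\<phi> \<in> test_functions \<Longrightarrow> grad (\<lambda>x. c * \<phi> x) = c *\<^sub>R grad \<phi>"
proof -
  assume t: "\<phi> \<in> test_functions"
  have "partial_deriv i (\<lambda>x. c * \<phi> x) = (\<lambda>x. c * partial_deriv i \<phi> x)" for i
    by (rule ext) (intro partial_deriv_cmult smooth_differentiable test_smooth t)
  then show ?thesis by (simp add: grad_def vec_eq_iff l2_class_cmult test_L2 test_partial_deriv t)
qed

lemma grad_in: "\<phi> \<in> test_functions \<Longrightarrow> grad \<phi> \<in> grad_space"
  unfolding grad_space_def by (rule subsetD[OF closure_subset]) (rule imageI)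

lemma closed_grad_space: "closed grad_space"
  by (simp add: grad_space_def)

lemma subspace_grad_space: "subspace grad_space"
  unfolding grad_space_def
proof (rule subspace_closure_normed, unfold subspace_def, intro conjI ballI allI)
  show "0 \<in> grad ` test_functions"
    using grad_cmult[OF test_zero, of 0] test_zero by (auto intro!: image_eqI[of _ _ "\<lambda>x. 0"])
  show "x + y \<in> grad ` test_functions" if "x \<in> grad ` test_functions" "y \<in> grad ` test_functions" for x y
    using that by (auto simp: grad_add[symmetric] intro!: imageI test_add)
  show "c *\<^sub>R x \<in> grad ` test_functions" if "x \<in> grad ` test_functions" for c x
    using that by (auto simp: grad_cmult[symmetric] intro!: imageI test_cmult)
qed

lemma weak_grad_test: "\<phi> \<in> test_functions \<Longrightarrow> weak_grad \<phi> (grad \<phi>)"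
  unfolding weak_grad_def
  by (auto simp: test_over_rho_L2 grad_def inner_l2_class test_L2 test_partial_deriv integral_by_parts
      test_smooth)

lemma weak_grad_diff:
  assumes "weak_grad u U" "weak_grad v V" shows "weak_grad (\<lambda>x. u x - v x) (U - V)"
proof -
  have i: "integrable lebesgue (\<lambda>x. u x * partial_deriv i \<phi> x)" "integrable lebesgue (\<lambda>x. v x
      * partial_deriv i \<phi> x)"
    if "\<phi> \<in> test_functions" for i \<phi>
    using assms weighted_mult_test_integrable test_partial_deriv[OF that] by (auto simp: weak_grad_def)
  then show ?thesis
    using assms L2_diff unfolding weak_grad_def
    by (auto simp: left_diff_distrib inner_diff_left diff_divide_distrib)
qed

lemma weak_grad_add:
  assumes "weak_grad u U" "weak_grad v V" shows "weak_grad (\<lambda>x. u x + v x) (U + V)"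
proof -
  have i: "integrable lebesgue (\<lambda>x. u x * partial_deriv i \<phi> x)" "integrable lebesgue (\<lambda>x. v x
      * partial_deriv i \<phi> x)"
    if "\<phi> \<in> test_functions" for i \<phi>
    using assms weighted_mult_test_integrable test_partial_deriv[OF that] by (auto simp: weak_grad_def)
  then show ?thesis
    using assms L2_add unfolding weak_grad_def
    by (auto simp: distrib_right inner_add_left add_divide_distrib)
qed

lemma weak_grad_cmult:
  assumes "weak_grad u U" shows "weak_grad (\<lambda>x. c * u x) (c *\<^sub>R U)"
  using assms L2_cmult[of "\<lambda>x. u x / rho x" c] unfolding weak_grad_def by (simp add: mult.assoc)

lemma norm_vec_square: "(norm (U :: 'a::real_inner ^ 'n::finite))\<^sup>2 = (\<Sum>i\<in>UNIV. (norm (U $ i))\<^sup>2)"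
  by (simp add: power2_norm_eq_inner inner_vec_def)

lemma hardy_test_norm:
  fixes \<phi> :: "real^'n::finite \<Rightarrow> real"
  assumes n: "CARD('n) \<ge> 3" and \<phi>: "\<phi> \<in> test_functions"
  shows "norm (l2_class (\<lambda>x. \<phi> x / rho x)) \<le> 2 * norm (grad \<phi>)"
proof -
  have d: "partial_deriv i \<phi> \<in> L2" for i by (intro test_L2 test_partial_deriv \<phi>)
  have "(norm (l2_class (\<lambda>x. \<phi> x / rho x)))\<^sup>2 = (\<integral>x. (\<phi> x / rho x)\<^sup>2 \<partial>lebesgue)"
    unfolding power2_norm_eq_inner inner_l2_class[OF test_over_rho_L2[OF \<phi>] test_over_rho_L2[OF \<phi>]]
    by (simp only: power2_eq_square)
  also have "\<dots> \<le> 4 * (\<integral>x. (\<Sum>i\<in>UNIV. (partial_deriv i \<phi> x)\<^sup>2) \<partial>lebesgue)"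
    by (rule hardy_inequality_test[OF n \<phi>])
  also have "(\<integral>x. (\<Sum>i\<in>UNIV. (partial_deriv i \<phi> x)\<^sup>2) \<partial>lebesgue)
      = (\<Sum>i\<in>UNIV. (\<integral>x. (partial_deriv i \<phi> x)\<^sup>2 \<partial>lebesgue))"
    by (rule Bochner_Integration.integral_sum) (rule L2_integrable_square[OF d])
  also have "\<dots> = (norm (grad \<phi>))\<^sup>2"
  proof -
    have "(norm (grad \<phi> $ i))\<^sup>2 = (\<integral>x. (partial_deriv i \<phi> x)\<^sup>2 \<partial>lebesgue)" for i
      unfolding power2_norm_eq_inner grad_def by (simp add: inner_l2_class[OF d d] power2_eq_square)
    then show ?thesis by (simp add: norm_vec_square)
  qed
  finally have "(norm (l2_class (\<lambda>x. \<phi> x / rho x)))\<^sup>2 \<le> (2 * norm (grad \<phi>))\<^sup>2"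
      by (simp add: power_mult_distrib)
  then show ?thesis by (rule power2_le_imp_le) simp
qed

text \<open>Hardy's inequality turns a Cauchy sequence of gradients into a Cauchy sequence of
  weighted functions, and the weak form of the gradient passes to the limit. The factor 2 is the
  root of Hardy's 4.\<close>

lemma grad_space_potential:
  fixes U :: "'n::finite l2 ^ 'n"
  assumes n: "CARD('n) \<ge> 3" and U: "U \<in> grad_space"
  shows "\<exists>u. weak_grad u U \<and> norm (l2_class (\<lambda>x. u x / rho x)) \<le> 2 * norm U"
proof -
  obtain G where "\<And>k. G k \<in> grad ` test_functions" and lim: "G \<longlonglongrightarrow> U"
    using U unfolding grad_space_def closure_sequential by blast
  then obtain \<phi> where \<phi>: "\<And>k. \<phi> k \<in> test_functions" and G: "\<And>k. G k = grad (\<phi> k)"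
    by (simp add: image_iff) metis
  define s where "s k = l2_class (\<lambda>x. \<phi> k x / rho x)" for k
  have sd: "norm (s k - s m) \<le> 2 * norm (G k - G m)" for k m
  proof -
    have t: "(\<lambda>x. \<phi> k x + -1 * \<phi> m x) \<in> test_functions" by (intro test_add test_cmult \<phi>)
    have "s k - s m = l2_class (\<lambda>x. (\<phi> k x + -1 * \<phi> m x) / rho x)"
      unfolding s_def by (subst l2_class_diff[symmetric]) (auto simp: diff_divide_distrib
          test_over_rho_L2 \<phi>)
    moreover have "grad (\<lambda>x. \<phi> k x + -1 * \<phi> m x) = G k - G m"
      by (simp only: grad_add[OF \<phi> test_cmult[OF \<phi>]] grad_cmult[OF \<phi>] G) simp
    ultimately show ?thesis using hardy_test_norm[OF n t] by simp
  qed
  have "Cauchy s"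
  proof (rule metric_CauchyI)
    fix e :: real assume "e > 0"
    then obtain M where M: "\<And>m k. m \<ge> M \<Longrightarrow> k \<ge> M \<Longrightarrow> dist (G m) (G k) < e / 2"
      using metric_CauchyD[OF LIMSEQ_imp_Cauchy[OF lim], of "e / 2"] by auto
    have "dist (s m) (s k) < e" if "m \<ge> M" "k \<ge> M" for m k
      using sd[of m k] M[OF that] by (simp add: dist_norm)
    then show "\<exists>M. \<forall>m\<ge>M. \<forall>k\<ge>M. dist (s m) (s k) < e" by blast
  qed
  then obtain l where l: "s \<longlonglongrightarrow> l" using Cauchy_convergent_iff convergent_def by blast
  \<comment> \<open>The limit l was taken for the quotients \<phi> / rho, so the weight is
    multiplied back.\<close>
  define u where "u x = rho x * l2_rep l x" for x
  have ur: "(\<lambda>x. u x / rho x) = l2_rep l" by (simp add: u_def fun_eq_iff)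
  have "norm (s k) \<le> 2 * norm (G k)" for k
    unfolding s_def G by (rule hardy_test_norm[OF n \<phi>])
  then have "norm l \<le> 2 * norm U"
    by (intro LIMSEQ_le[OF tendsto_norm[OF l] tendsto_mult_left[OF tendsto_norm[OF lim]]]) auto
  moreover have "weak_grad u U"
    unfolding weak_grad_def
  proof (intro conjI allI ballI)
    show "(\<lambda>x. u x / rho x) \<in> L2" unfolding ur by (rule l2_rep(1))
    fix i and \<psi> :: "real^'n \<Rightarrow> real" assume \<psi>: "\<psi> \<in> test_functions"
    have r: "(\<lambda>x. rho x * partial_deriv i \<psi> x) \<in> L2" by (intro test_rho_L2 test_partial_deriv \<psi>)
    have "(\<integral>x. u x * partial_deriv i \<psi> x \<partial>lebesgue)
        = inner l (l2_class (\<lambda>x. rho x * partial_deriv i \<psi> x))"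
      using inner_l2_class[OF l2_rep(1) r, of l] by (simp add: l2_rep(2) u_def mult_ac)
    moreover have "(\<lambda>k. inner (s k) (l2_class (\<lambda>x. rho x * partial_deriv i \<psi> x)))
        \<longlonglongrightarrow> inner l (l2_class (\<lambda>x. rho x * partial_deriv i \<psi> x))"
      by (intro tendsto_inner l tendsto_const)
    moreover have "inner (s k) (l2_class (\<lambda>x. rho x * partial_deriv i \<psi> x))
        = - inner (G k $ i) (l2_class \<psi>)" for k
    proof -
      have "inner (s k) (l2_class (\<lambda>x. rho x * partial_deriv i \<psi> x))
          = (\<integral>x. \<phi> k x * partial_deriv i \<psi> x \<partial>lebesgue)"
        unfolding s_def by (subst inner_l2_class[OF test_over_rho_L2[OF \<phi>] r]) simp
      then show ?thesis using weak_grad_test[OF \<phi>, of k] \<psi> by (simp add: weak_grad_def G)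
    qed
    moreover have "(\<lambda>k. - inner (G k $ i) (l2_class \<psi>)) \<longlonglongrightarrow> - inner (U $ i) (l2_class \<psi>)"
      by (intro tendsto_minus tendsto_inner tendsto_vec_nth lim tendsto_const)
    ultimately show "(\<integral>x. u x * partial_deriv i \<psi> x \<partial>lebesgue) = - inner (U $ i) (l2_class \<psi>)"
      using LIMSEQ_unique by simp
  qed
  ultimately show ?thesis by (intro exI[of _ u]) (simp add: ur l2_rep(2))
qed

text \<open>Moving one more derivative onto the test function turns orthogonality into weak
  harmonicity of z, and the weighted Liouville theorem applies. With Z = 0 it says that a function
  of the weighted space is determined almost everywhere by its gradient.\<close>

lemma weak_grad_orthogonal_zero:
  fixes z :: "real^'n::finite \<Rightarrow> real"
  assumes n: "CARD('n) \<ge> 3" and z: "weak_grad z Z"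
    and orth: "\<And>\<phi>. \<phi> \<in> test_functions \<Longrightarrow> inner Z (grad \<phi>) = 0"
  shows "AE x in lebesgue. z x = 0" "Z = 0"
proof -
  have zr: "(\<lambda>x. z x / rho x) \<in> L2" using z by (simp add: weak_grad_def)
  show ae: "AE x in lebesgue. z x = 0"
  proof (rule weighted_liouville[OF n zr])
    fix \<phi> :: "real^'n \<Rightarrow> real" assume \<phi>: "\<phi> \<in> test_functions"
    have "(\<integral>x. z x * (\<Sum>i\<in>UNIV. partial_deriv i (partial_deriv i \<phi>) x) \<partial>lebesgue)
        = (\<Sum>i\<in>UNIV. \<integral>x. z x * partial_deriv i (partial_deriv i \<phi>) x \<partial>lebesgue)"
      unfolding sum_distrib_left
      by (rule Bochner_Integration.integral_sum)
        (intro weighted_mult_test_integrable zr test_partial_deriv \<phi>)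
    also have "\<dots> = (\<Sum>i\<in>UNIV. - inner (Z $ i) (l2_class (partial_deriv i \<phi>)))"
      using z test_partial_deriv[OF \<phi>] by (simp add: weak_grad_def)
    also have "\<dots> = - inner Z (grad \<phi>)" by (simp add: inner_vec_def grad_def sum_negf)
    finally show "(\<integral>x. z x * (\<Sum>i\<in>UNIV. partial_deriv i (partial_deriv i \<phi>) x) \<partial>lebesgue) = 0"
      using orth[OF \<phi>] by simp
  qed
  have "Z $ i = 0" for i
  proof (rule l2_eq_0I)
    fix \<phi> :: "real^'n \<Rightarrow> real" assume \<phi>: "\<phi> \<in> test_functions"
    have "(\<integral>x. z x * partial_deriv i \<phi> x \<partial>lebesgue) = 0"
      by (rule integral_eq_zero_AE) (use ae in \<open>eventually_elim, simp\<close>)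
    then show "inner (Z $ i) (l2_class \<phi>) = 0" using z \<phi> by (simp add: weak_grad_def)
  qed
  then show "Z = 0" by (simp add: vec_eq_iff)
qed

text \<open>Compare u with the potential w of the projection P of U: u - w has gradient U - P,
  orthogonal to the gradients of test functions, and therefore vanishes. So Hardy's inequality,
  known for limits of test functions, extends to all of \<open>H1\<close>.\<close>

lemma weak_grad_in_grad_space:
  fixes u :: "real^'n::finite \<Rightarrow> real"
  assumes n: "CARD('n) \<ge> 3" and u: "weak_grad u U"
  shows "U \<in> grad_space" "norm (l2_class (\<lambda>x. u x / rho x)) \<le> 2 * norm U"
proof -
  define P where "P = orth_proj grad_space U"
  have P: "P \<in> grad_space" unfolding P_def
      by (rule orth_proj_in[OF closed_grad_space subspace_grad_space])
  obtain w where w: "weak_grad w P" "norm (l2_class (\<lambda>x. w x / rho x)) \<le> 2 * norm P"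
    using grad_space_potential[OF n P] by blast
  have orth: "inner (U - P) (grad \<phi>) = 0" if "\<phi> \<in> test_functions" for \<phi>
    using inner_orth_proj[OF closed_grad_space subspace_grad_space grad_in[OF that], of U]
    by (simp add: P_def inner_diff_left)
  have ae: "AE x in lebesgue. u x - w x = 0"
    by (rule weak_grad_orthogonal_zero(1)[OF n weak_grad_diff[OF u w(1)]]) (rule orth)
  have "U - P = 0"
    by (rule weak_grad_orthogonal_zero(2)[OF n weak_grad_diff[OF u w(1)]]) (rule orth)
  then have "U = P" by simp
  then show "U \<in> grad_space" using P by simp
  have "l2_class (\<lambda>x. u x / rho x) = l2_class (\<lambda>x. w x / rho x)"
  proof (subst l2_class_eq_iff)
    show "AE x in lebesgue. u x / rho x = w x / rho x" using ae by eventually_elim simp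
  qed (use u w in \<open>auto simp: weak_grad_def\<close>)
  then show "norm (l2_class (\<lambda>x. u x / rho x)) \<le> 2 * norm U" using w(2) \<open>U = P\<close> by simp
qed

section \<open>The weighted Sobolev space\<close>

lemma dist_partial_iff:
  fixes h :: "real^'n::finite \<Rightarrow> real"
  assumes "h \<in> L2"
  shows "dist_eq (dist_partial i (regular_dist u)) (regular_dist h) \<longleftrightarrow>
    (\<forall>\<phi>\<in>test_functions. (\<integral>x. u x * partial_deriv i \<phi> x \<partial>lebesgue) = - inner (l2_class h) (l2_class \<phi>))"
  unfolding dist_eq_def dist_partial_def regular_dist_def
proof (intro ball_cong refl)
  fix \<phi> :: "real^'n \<Rightarrow> real" assume "\<phi> \<in> test_functions"
  then show "(- (\<integral>x. u x * partial_deriv i \<phi> x \<partial>lebesgue) = (\<integral>x. h x * \<phi> x \<partial>lebesgue)) =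
      ((\<integral>x. u x * partial_deriv i \<phi> x \<partial>lebesgue) = - inner (l2_class h) (l2_class \<phi>))"
    unfolding inner_l2_class[OF assms test_L2[OF \<open>\<phi> \<in> test_functions\<close>]] by linarith
qed

text \<open>\<open>weak_partial\<close> is a choice, so only its class can be identified, by means
  of \<open>l2_eq_0I\<close>. Together with \<open>H1_weak_grad\<close> this translates between
  \<open>H1\<close> and \<open>weak_grad\<close>.\<close>

lemma weak_grad_H1:
  fixes u :: "real^'n::finite \<Rightarrow> real"
  assumes "weak_grad u U"
  shows "u \<in> H1" "weak_partial i u \<in> L2" "l2_class (weak_partial i u) = U $ i"
proof -
  have ur: "(\<lambda>x. u x / rho x) \<in> L2" using assms by (simp add: weak_grad_def)
  have d: "dist_eq (dist_partial i (regular_dist u)) (regular_dist (l2_rep (U $ i)))" for i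
    using assms by (simp add: dist_partial_iff l2_rep weak_grad_def)
  then show "u \<in> H1" using ur weighted_L2_measurable[OF ur] l2_rep(1) by (auto simp: H1_def)
  have "weak_partial i u \<in> L2 \<and> dist_eq (dist_partial i (regular_dist u)) (regular_dist (weak_partial i
      u))"
    unfolding weak_partial_def by (rule someI[of _ "l2_rep (U $ i)"]) (use d l2_rep(1) in auto)
  then show L: "weak_partial i u \<in> L2"
    and "l2_class (weak_partial i u) = U $ i"
  proof -
    assume w: "weak_partial i u \<in> L2 \<and> dist_eq (dist_partial i (regular_dist u)) (regular_dist
        (weak_partial i u))"
    then show "weak_partial i u \<in> L2" by simp
    have "l2_class (weak_partial i u) - U $ i = 0"
    proof (rule l2_eq_0I)
      fix \<phi> :: "real^'n \<Rightarrow> real" assume "\<phi> \<in> test_functions"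
      moreover have "\<forall>\<phi>\<in>test_functions. (\<integral>x. u x * partial_deriv i \<phi> x \<partial>lebesgue)
          = - inner (l2_class (weak_partial i u)) (l2_class \<phi>)"
        using w dist_partial_iff by blast
      ultimately show "inner (l2_class (weak_partial i u) - U $ i) (l2_class \<phi>) = 0"
        using assms by (simp add: weak_grad_def inner_diff_left)
    qed
    then show "l2_class (weak_partial i u) = U $ i" by simp
  qed
qed

lemma H1_weak_grad:
  assumes "u \<in> H1"
  shows "weak_grad u (\<chi> i. l2_class (weak_partial i u))"
proof -
  have "\<exists>h. h \<in> L2 \<and> dist_eq (dist_partial i (regular_dist u)) (regular_dist h)" for i
    using assms by (auto simp: H1_def)
  then have "weak_partial i u \<in> L2 \<and> dist_eq (dist_partial i (regular_dist u)) (regular_dist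
      (weak_partial i u))" for i
    unfolding weak_partial_def by (rule someI_ex)
  then have "\<forall>\<phi>\<in>test_functions. (\<integral>x. u x * partial_deriv i \<phi> x \<partial>lebesgue)
      = - inner (l2_class (weak_partial i u)) (l2_class \<phi>)" for i
    using dist_partial_iff by blast
  then show ?thesis using assms by (simp add: weak_grad_def H1_def)
qed

lemma norm_H1_weak_grad:
  assumes "weak_grad u U"
  shows "norm_H1 u = sqrt ((norm (l2_class (\<lambda>x. u x / rho x)))\<^sup>2 + (norm U)\<^sup>2)"
proof -
  have "(\<lambda>x. u x / rho x) \<in> L2" using assms by (simp add: weak_grad_def)
  then show ?thesis
    unfolding norm_H1_def norm_vec_square
    by (simp add: norm_l2_class[symmetric] weak_grad_H1[OF assms])
qed

text \<open>Hardy's inequality bounds the weighted part by 2 norm U, and the root of 4 + 1 is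
  rounded up to 3.\<close>

lemma norm_H1_le:
  fixes u :: "real^'n::finite \<Rightarrow> real"
  assumes n: "CARD('n) \<ge> 3" and u: "weak_grad u U"
  shows "norm_H1 u \<le> 3 * norm U"
proof -
  have "(norm (l2_class (\<lambda>x. u x / rho x)))\<^sup>2 \<le> (2 * norm U)\<^sup>2"
    by (intro power_mono weak_grad_in_grad_space(2)[OF n u]) auto
  moreover have "(2 * norm U)\<^sup>2 = 4 * (norm U)\<^sup>2" "(3 * norm U)\<^sup>2 = 9 * (norm U)\<^sup>2"
    by (simp_all add: power_mult_distrib)
  ultimately have "(norm (l2_class (\<lambda>x. u x / rho x)))\<^sup>2 + (norm U)\<^sup>2 \<le> (3 * norm U)\<^sup>2"
    using zero_le_power2[of "norm U"] by linarith
  then show ?thesis unfolding norm_H1_weak_grad[OF u] by (intro real_le_lsqrt) auto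
qed

section \<open>Korn's inequality and the divergence\<close>

lemma grad_space_induct_closed:
  assumes "closed {U. P U}" "\<And>\<phi>. \<phi> \<in> test_functions \<Longrightarrow> P (grad \<phi>)" "U \<in> grad_space"
  shows "P U"
proof -
  have "closure (grad ` test_functions) \<subseteq> {U. P U}" using assms(1,2) by (intro closure_minimal) auto
  then show ?thesis using assms(3) by (auto simp: grad_space_def)
qed

lemma continuous_on_vec_nth_id: "continuous_on A (\<lambda>U::'a::real_normed_vector^'n::finite. U $ i)"
  by (intro continuous_intros)

text \<open>Known for test functions by \<open>integral_partial_deriv_swap\<close>; it extends to
  the closure in one argument at a time, since both sides are continuous in each argument.\<close>

lemma grad_space_swap:
  assumes U: "U \<in> grad_space" and W: "W \<in> grad_space"
  shows "inner (U $ j) (W $ k) = inner (U $ k) (W $ j)"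
proof (rule grad_space_induct_closed[OF _ _ U])
  show "closed {U. inner (U $ j) (W $ k) = inner (U $ k) (W $ j)}"
    by (intro closed_Collect_eq continuous_on_inner continuous_on_const continuous_on_vec_nth_id)
  fix \<phi> :: "real^'a \<Rightarrow> real" assume \<phi>: "\<phi> \<in> test_functions"
  show "inner (grad \<phi> $ j) (W $ k) = inner (grad \<phi> $ k) (W $ j)"
  proof (rule grad_space_induct_closed[OF _ _ W])
    show "closed {W. inner (grad \<phi> $ j) (W $ k) = inner (grad \<phi> $ k) (W $ j)}"
      by (intro closed_Collect_eq continuous_on_inner continuous_on_const continuous_on_vec_nth_id)
    fix \<psi> :: "real^'a \<Rightarrow> real" assume \<psi>: "\<psi> \<in> test_functions"
    show "inner (grad \<phi> $ j) (grad \<psi> $ k) = inner (grad \<phi> $ k) (grad \<psi> $ j)"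
      using integral_partial_deriv_swap[OF \<phi> \<psi>]
      by (simp add: grad_def inner_l2_class test_L2 test_partial_deriv \<phi> \<psi>)
  qed
qed

text \<open>Jacobians of vector fields. The first index is the component and the second the
  derivative: \<open>U $ i $ j\<close> stands for the j-th derivative of u_i.\<close>

definition vgrad_space :: "('n::finite l2 ^ 'n ^ 'n) set" where
  "vgrad_space = {U. \<forall>i. U $ i \<in> grad_space}"

lemma closed_vgrad_space: "closed (vgrad_space :: ('n::finite l2 ^ 'n ^ 'n) set)"
proof -
  have e: "(vgrad_space :: ('n l2 ^ 'n ^ 'n) set) = (\<Inter>i. (\<lambda>U. U $ i) -` grad_space)"
      by (auto simp: vgrad_space_def)
  show ?thesis unfolding e
    by (intro closed_INT ballI closed_vimage closed_grad_space continuous_on_vec_nth_id)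
qed

lemma subspace_vgrad_space: "subspace vgrad_space"
  using subspace_grad_space by (auto simp: subspace_def vgrad_space_def)

definition vtrace :: "'n::finite l2 ^ 'n ^ 'n \<Rightarrow> 'n l2" where
  "vtrace U = (\<Sum>i\<in>UNIV. U $ i $ i)"

definition sym_part :: "'n::finite l2 ^ 'n ^ 'n \<Rightarrow> 'n l2 ^ 'n ^ 'n" where
  "sym_part U = (\<chi> j k. (1/2) *\<^sub>R (U $ k $ j + U $ j $ k))"

lemma bounded_linear_vtrace: "bounded_linear (vtrace :: 'n::finite l2 ^ 'n ^ 'n \<Rightarrow> 'n l2)"
  unfolding vtrace_def
  by (rule bounded_linear_sum)
    (rule bounded_linear_compose[OF bounded_linear_vec_nth bounded_linear_vec_nth])

lemmas vtrace_simps = bounded_linear.linear[OF bounded_linear_vtrace, THEN linear_add]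
  bounded_linear.linear[OF bounded_linear_vtrace, THEN linear_diff]
  bounded_linear.linear[OF bounded_linear_vtrace, THEN linear_scale]
  bounded_linear.linear[OF bounded_linear_vtrace, THEN linear_0]

text \<open>The mixed products in the squared norm of the symmetric part pair
  \<open>U $ k $ j\<close> with \<open>U $ j $ k\<close>; the swap identity turns them into products
  of diagonal entries, which sum to the squared norm of the divergence. On divergence-free fields
  exactly half of the squared gradient norm survives, the origin of the factor 2 in the coercivity
  constant 1 / (2 c).\<close>

lemma korn:
  assumes U: "U \<in> vgrad_space"
  shows "(norm (sym_part U))\<^sup>2 = (1/2) * (norm U)\<^sup>2 + (1/2) * (norm (vtrace U))\<^sup>2"
proof -
  have g: "U $ i \<in> grad_space" for i using U by (simp add: vgrad_space_def)
  have swap: "inner (U $ k $ j) (U $ j $ k) = inner (U $ k $ k) (U $ j $ j)" for j k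
    by (rule grad_space_swap[OF g g])
  have n1: "(norm (sym_part U))\<^sup>2 = (\<Sum>j\<in>UNIV. \<Sum>k\<in>UNIV. (norm (sym_part U $ j $ k))\<^sup>2)"
    by (simp add: norm_vec_square)
  have n2: "(norm U)\<^sup>2 = (\<Sum>j\<in>UNIV. \<Sum>k\<in>UNIV. (norm (U $ j $ k))\<^sup>2)" by (simp add: norm_vec_square)
  have n3: "(norm (vtrace U))\<^sup>2 = (\<Sum>j\<in>UNIV. \<Sum>k\<in>UNIV. inner (U $ k $ k) (U $ j $ j))"
    by (simp add: power2_norm_eq_inner vtrace_def inner_sum_left inner_sum_right)
  have "(norm (sym_part U $ j $ k))\<^sup>2 = (1/4) * (norm (U $ k $ j))\<^sup>2 + (1/4) * (norm (U $ j $ k))\<^sup>2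
      + (1/2) * inner (U $ k $ k) (U $ j $ j)" for j k
    unfolding swap[symmetric] power2_norm_eq_inner sym_part_def
    by (simp add: inner_add_left inner_add_right inner_commute field_simps)
  then have "(norm (sym_part U))\<^sup>2 = (1/4) * (\<Sum>j\<in>UNIV. \<Sum>k\<in>UNIV. (norm (U $ k $ j))\<^sup>2)
      + (1/4) * (norm U)\<^sup>2 + (1/2) * (norm (vtrace U))\<^sup>2"
    unfolding n1 n2 n3 by (simp add: sum.distrib sum_distrib_left)
  also have "(\<Sum>j\<in>UNIV. \<Sum>k\<in>UNIV. (norm (U $ k $ j))\<^sup>2) = (norm U)\<^sup>2"
    unfolding n2 by (rule sum.swap)
  finally show ?thesis by simp
qed

section \<open>Linear maps into vectors and a right inverse of the divergence\<close>

lemma norm_vec_le_sum: "norm (x :: 'a::real_normed_vector ^ 'n::finite) \<le> (\<Sum>i\<in>UNIV. norm (x $ i))"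
  by (simp add: norm_vec_def L2_set_le_sum)

lemma bounded_linear_vec_lambda:
  assumes "\<And>i. bounded_linear (f i)"
  shows "bounded_linear (\<lambda>x. \<chi> i. f i x :: 'b::real_normed_vector ^ 'n::finite)"
proof -
  have "\<exists>K. \<forall>x. norm (f i x) \<le> norm x * K" for i using bounded_linear.bounded[OF assms] by blast
  then obtain K where K: "\<And>i x. norm (f i x) \<le> norm x * K i" by metis
  show ?thesis
  proof (rule bounded_linear_intro)
    show "norm (\<chi> i. f i x) \<le> norm x * (\<Sum>i\<in>UNIV. K i)" for x
    proof -
      have "norm (\<chi> i. f i x) \<le> (\<Sum>i\<in>UNIV. norm (f i x))"
        using norm_vec_le_sum[of "\<chi> i. f i x"] by simp
      also have "\<dots> \<le> (\<Sum>i\<in>UNIV. norm x * K i)" by (intro sum_mono K)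
      finally show ?thesis by (simp add: sum_distrib_left)
    qed
  qed (auto simp: vec_eq_iff linear_add linear_scale bounded_linear.linear[OF assms])
qed

lemma bounded_linear_axis: "bounded_linear (axis i :: 'a::real_normed_vector \<Rightarrow> 'a ^ 'n::finite)"
  unfolding axis_def
proof (rule bounded_linear_vec_lambda)
  show "bounded_linear (\<lambda>x::'a. if j = i then x else 0)" for j
    by (cases "j = i") (simp_all add: bounded_linear_ident bounded_linear_zero)
qed

text \<open>Row i is the gradient of v_i, where \<Delta> v_i is the i-th derivative of p in the weak
  sense: projecting the field with p in slot i onto \<open>grad_space\<close> solves this equation,
  as \<open>inner_div_inverse\<close> expresses.\<close>

definition div_inverse :: "'n::finite l2 \<Rightarrow> 'n l2 ^ 'n ^ 'n" where
  "div_inverse p = (\<chi> i. orth_proj grad_space (axis i p))"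

lemma bounded_linear_div_inverse: "bounded_linear (div_inverse :: 'n::finite l2 \<Rightarrow> _)"
  unfolding div_inverse_def
  by (rule bounded_linear_vec_lambda)
    (rule bounded_linear_compose[OF bounded_linear_orth_proj[OF closed_grad_space subspace_grad_space]
        bounded_linear_axis])

lemma div_inverse_in: "div_inverse p \<in> vgrad_space"
  by (simp add: div_inverse_def vgrad_space_def orth_proj_in[OF closed_grad_space subspace_grad_space])

lemma inner_div_inverse: "W \<in> grad_space \<Longrightarrow> inner (div_inverse p $ i) W = inner p (W $ i)"
  by (simp add: div_inverse_def inner_orth_proj[OF closed_grad_space subspace_grad_space] inner_axis')

text \<open>The divergence of the solution \<open>v\<close> of \<open>- \<Delta> v = \<nabla> p\<close> differs from \<open>p\<close> by a weakly harmonic function.\<close>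

lemma vtrace_div_inverse:
  fixes p :: "'n::finite l2"
  assumes n: "CARD('n) \<ge> 3"
  shows "vtrace (div_inverse p) = p"
proof -
  let ?V = "div_inverse p"
  have g: "?V $ i \<in> grad_space" for i using div_inverse_in[of p] by (simp add: vgrad_space_def)
  have "vtrace ?V - p = 0"
  proof (rule l2_liouville[OF n])
    fix \<phi> :: "real^'n \<Rightarrow> real" assume \<phi>: "\<phi> \<in> test_functions"
    let ?D = "\<lambda>i. grad (partial_deriv i \<phi>)"
    have gD: "?D i \<in> grad_space" for i by (intro grad_in test_partial_deriv \<phi>)
    have comm: "?D k $ i = ?D i $ k" for i k
      by (simp add: grad_def partial_deriv_commute[OF test_smooth[OF \<phi>], of i k])
    have "(\<Sum>k\<in>UNIV. inner (vtrace ?V) (?D k $ k)) = (\<Sum>k\<in>UNIV. \<Sum>i\<in>UNIV. inner (?V $ i $ i) (?D k $ k))"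
      by (simp add: vtrace_def inner_sum_left)
    \<comment> \<open>\<open>grad_space_swap\<close> exchanges the indices and the second
      derivatives of \<phi> commute; the divergence tested with the Laplacian of \<phi> thereby
      becomes the weak equation of the rows.\<close>
    also have "\<dots> = (\<Sum>k\<in>UNIV. \<Sum>i\<in>UNIV. inner (?V $ i $ k) (?D i $ k))"
      by (intro sum.cong refl) (use grad_space_swap[OF g gD] comm in metis)
    also have "\<dots> = (\<Sum>i\<in>UNIV. inner (?V $ i) (?D i))" by (subst sum.swap) (simp add: inner_vec_def)
    also have "\<dots> = (\<Sum>i\<in>UNIV. inner p (?D i $ i))" by (simp add: inner_div_inverse gD)
    finally have "(\<Sum>k\<in>UNIV. inner (vtrace ?V - p) (?D k $ k)) = 0"
      by (simp add: inner_diff_left sum_subtractf)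
    then show "(\<Sum>i\<in>UNIV. inner (vtrace ?V - p) (l2_class (partial_deriv i (partial_deriv i \<phi>)))) = 0"
      by (simp add: grad_def)
  qed
  then show ?thesis by simp
qed

text \<open>Testing each row with itself yields the inner product of p with the divergence of the
  field, which is p. Consequently lifting g and recovering the pressure cost no constant.\<close>

lemma norm_div_inverse:
  fixes p :: "'n::finite l2"
  assumes n: "CARD('n) \<ge> 3"
  shows "norm (div_inverse p) = norm p"
proof -
  have g: "div_inverse p $ i \<in> grad_space" for i
    using div_inverse_in[of p] by (simp add: vgrad_space_def)
  have "(norm (div_inverse p))\<^sup>2 = (\<Sum>i\<in>UNIV. inner (div_inverse p $ i) (div_inverse p $ i))"
    by (simp add: power2_norm_eq_inner inner_vec_def)
  also have "\<dots> = (\<Sum>i\<in>UNIV. inner p (div_inverse p $ i $ i))" by (simp only: inner_div_inverse[OF g])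
  also have "\<dots> = inner p (vtrace (div_inverse p))" by (simp add: vtrace_def inner_sum_right)
  also have "\<dots> = (norm p)\<^sup>2" by (simp add: vtrace_div_inverse[OF n] power2_norm_eq_inner)
  finally show ?thesis by (simp add: power2_eq_iff_nonneg)
qed

section \<open>The abstract Stokes problem\<close>

text \<open>A stands for the viscosity operator applied to the symmetric part of a Jacobian. It is
  bounded on all matrix fields, but coercivity is asked only on divergence-free Jacobians, which is
  what ellipticity on trace-free matrices yields.\<close>

locale stokes_form =
  fixes A :: "'n::finite l2 ^ 'n ^ 'n \<Rightarrow> 'n l2 ^ 'n ^ 'n" and \<gamma> \<beta> :: real
  assumes n: "CARD('n) \<ge> 3"
    and A: "bounded_linear A" and \<gamma>: "\<gamma> > 0"
    and bound: "norm (A U) \<le> \<beta> * norm U"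
    and coercive: "U \<in> vgrad_space \<Longrightarrow> vtrace U = 0 \<Longrightarrow> \<gamma> * (norm U)\<^sup>2 \<le> inner (A U) U"
begin

text \<open>The signs come from integrating the equation by parts: R represents the force, and A U +
  R is balanced by the pressure tested with the divergence. The test fields include those with
  nonzero divergence, and these determine p.\<close>

definition weak_stokes :: "'n l2 ^ 'n ^ 'n \<Rightarrow> 'n l2 \<Rightarrow> 'n l2 ^ 'n ^ 'n \<Rightarrow> 'n l2 \<Rightarrow> bool" where
  "weak_stokes R g U p \<longleftrightarrow> U \<in> vgrad_space \<and> vtrace U = g \<and>
    (\<forall>W\<in>vgrad_space. inner (A U) W + inner R W = inner p (vtrace W))"

text \<open>The difference of two velocities is divergence-free, so coercivity applies to it. The
  pressures are compared by testing with \<open>div_inverse (p - q)\<close>, whose divergence is p -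
  q.\<close>

lemma weak_stokes_unique:
  assumes 1: "weak_stokes R g U p" and 2: "weak_stokes R g V q"
  shows "U = V" "p = q"
proof -
  interpret A: bounded_linear A by (rule A)
  have D: "U - V \<in> vgrad_space" "vtrace (U - V) = 0"
    using 1 2 by (auto simp: weak_stokes_def vtrace_simps intro: subspace_diff[OF subspace_vgrad_space])
  have eq: "inner (A (U - V)) W = inner (p - q) (vtrace W)" if "W \<in> vgrad_space" for W
  proof -
    have "inner (A U) W + inner R W = inner p (vtrace W)" "inner (A V) W + inner R W
        = inner q (vtrace W)"
      using 1 2 that by (auto simp: weak_stokes_def)
    then show ?thesis by (simp add: A.diff inner_diff_left)
  qed
  have "\<gamma> * (norm (U - V))\<^sup>2 \<le> 0" using coercive[OF D] eq[OF D(1)] D(2) by simp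
  then have "(norm (U - V))\<^sup>2 \<le> 0" using \<gamma> by (simp add: mult_le_0_iff)
  then show UV: "U = V" by simp
  have "inner (p - q) (p - q) = 0"
    using eq[OF div_inverse_in, of "p - q"] by (simp add: UV A.zero vtrace_div_inverse[OF n])
  then show "p = q" by simp
qed

lemma weak_stokes_exists:
  "\<exists>U p. weak_stokes R g U p \<and> norm U \<le> (norm R + \<beta> * norm g) / \<gamma> + norm g
    \<and> norm p \<le> \<beta> * norm U + norm R"
proof -
  interpret A: bounded_linear A by (rule A)
  define S where "S = {W \<in> vgrad_space. vtrace W = (0 :: 'n l2)}"
  have sS: "subspace S"
    using subspace_vgrad_space by (auto simp: S_def subspace_def vtrace_simps)
  have cS: "closed S"
  proof -
    have "S = vgrad_space \<inter> vtrace -` {0}" by (auto simp: S_def)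
    then show ?thesis
      by (auto intro!: closed_Int closed_vgrad_space closed_vimage
          linear_continuous_on bounded_linear_vtrace)
  qed
  define Ug where "Ug = div_inverse g"
  have Ug: "Ug \<in> vgrad_space" "vtrace Ug = g" "norm Ug = norm g"
    by (simp_all add: Ug_def div_inverse_in vtrace_div_inverse norm_div_inverse n)
  obtain U0 where U0: "U0 \<in> S" and U0eq: "\<And>W. W \<in> S \<Longrightarrow> inner (A U0) W = inner (- R - A Ug) W"
    using lax_milgram[OF cS sS A \<gamma>, of "- R - A Ug"] coercive by (auto simp: S_def)
  define U where "U = U0 + Ug"
  have U: "U \<in> vgrad_space" "vtrace U = g"
    using U0 Ug(1,2) subspace_add[OF subspace_vgrad_space, of U0 Ug]
    by (simp_all add: U_def S_def vtrace_simps)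
  have orth: "inner (A U + R) W = 0" if "W \<in> S" for W
    using U0eq[OF that] by (simp add: U_def A.add inner_add_left inner_diff_left)
  interpret V: bounded_linear "div_inverse :: 'n l2 \<Rightarrow> _" by (rule bounded_linear_div_inverse)
  have "\<exists>p\<in>UNIV. \<forall>q\<in>UNIV. inner (A U + R) (div_inverse q) = inner p q"
  proof (rule riesz_representation)
    show "\<bar>inner (A U + R) (div_inverse q)\<bar> \<le> norm (A U + R) * norm q" for q
      using Cauchy_Schwarz_ineq2[of "A U + R" "div_inverse q"] by (simp add: norm_div_inverse[OF n])
  qed (auto simp: V.add V.scaleR inner_add_right)
  then obtain p where p: "\<And>q. inner (A U + R) (div_inverse q) = inner p q" by auto
  have "inner (A U) W + inner R W = inner p (vtrace W)" if W: "W \<in> vgrad_space" for W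
  proof -
    \<comment> \<open>W splits into a divergence-free part, on which the residual A U + R vanishes,
      and \<open>div_inverse (vtrace W)\<close>, on which p represents it.\<close>
    have "W - div_inverse (vtrace W) \<in> S"
      using subspace_diff[OF subspace_vgrad_space W div_inverse_in]
      by (simp add: S_def vtrace_simps vtrace_div_inverse[OF n])
    from orth[OF this] show ?thesis using p[of "vtrace W"] by (simp add: inner_diff_right inner_add_left)
  qed
  then have ws: "weak_stokes R g U p" using U by (simp add: weak_stokes_def)
  have "norm U0 \<le> (norm R + \<beta> * norm g) / \<gamma>"
  proof (cases "U0 = 0")
    case True
    \<comment> \<open>The locale leaves the sign of \<beta> open; nonnegativity of the product is
      read off from \<open>bound\<close> at Ug, whose norm is that of g.\<close>
    have "0 \<le> norm R + \<beta> * norm g"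
      using bound[of Ug, unfolded Ug(3)] norm_ge_zero[of "A Ug"] norm_ge_zero[of R] by linarith
    then show ?thesis using True \<gamma> by simp
  next
    case False
    have "\<gamma> * (norm U0)\<^sup>2 \<le> inner (- R - A Ug) U0"
      using coercive[of U0] U0eq[OF U0] U0 by (simp add: S_def)
    also have "\<dots> \<le> norm (- R - A Ug) * norm U0" by (rule norm_cauchy_schwarz)
    also have "\<dots> \<le> (norm R + \<beta> * norm g) * norm U0"
      using norm_triangle_ineq4[of "- R" "A Ug"] bound[of Ug]
          by (intro mult_right_mono) (auto simp: Ug(3))
    finally have "(\<gamma> * norm U0) * norm U0 \<le> (norm R + \<beta> * norm g) * norm U0"
      by (simp add: power2_eq_square mult.assoc)
    then have "\<gamma> * norm U0 \<le> norm R + \<beta> * norm g" using False by simp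
    then show ?thesis using \<gamma> by (simp add: field_simps)
  qed
  then have nU: "norm U \<le> (norm R + \<beta> * norm g) / \<gamma> + norm g"
    using norm_triangle_ineq[of U0 Ug] by (simp add: U_def Ug(3))
  have "norm p \<le> \<beta> * norm U + norm R"
  proof (cases "p = 0")
    case True
    have "0 \<le> \<beta> * norm U + norm R"
      using bound[of U] norm_ge_zero[of "A U"] norm_ge_zero[of R] by linarith
    then show ?thesis using True by simp
  next
    case False
    \<comment> \<open>The representation of the residual at q = p, combined with the isometry of
      \<open>div_inverse\<close>.\<close>
    have "norm p * norm p = inner (A U + R) (div_inverse p)"
      by (simp add: p power2_norm_eq_inner[symmetric] power2_eq_square)
    also have "\<dots> \<le> norm (A U + R) * norm p"
      using norm_cauchy_schwarz[of "A U + R" "div_inverse p"] by (simp add: norm_div_inverse[OF n])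
    also have "\<dots> \<le> (\<beta> * norm U + norm R) * norm p"
      using norm_triangle_ineq[of "A U" R] bound[of U] by (intro mult_right_mono) auto
    finally show ?thesis using False by simp
  qed
  then show ?thesis using ws nU by blast
qed

end

section \<open>The viscosity operator\<close>

text \<open>Multiplication acts through a chosen representative; for bounded measurable b,
  \<open>mult_op_l2_class\<close> shows that the choice does not matter.\<close>

definition mult_op :: "(real^'n::finite \<Rightarrow> real) \<Rightarrow> 'n l2 \<Rightarrow> 'n l2" where
  "mult_op b v = l2_class (\<lambda>x. b x * l2_rep v x)"

lemma Linf_mult_L2: "Linf_bounded_by K b \<Longrightarrow> f \<in> L2 \<Longrightarrow> (\<lambda>x. b x * f x) \<in> L2"
  unfolding Linf_bounded_by_def by (elim conjE) (rule L2_bounded_mult)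

lemma mult_op_l2_class:
  assumes b: "Linf_bounded_by K b" and f: "f \<in> L2"
  shows "mult_op b (l2_class f) = l2_class (\<lambda>x. b x * f x)"
  unfolding mult_op_def
proof (subst l2_class_eq_iff)
  show "AE x in lebesgue. b x * l2_rep (l2_class f) x = b x * f x" using l2_rep_l2_class[OF f]
      by eventually_elim simp
qed (intro Linf_mult_L2[OF b] l2_rep f)+

lemma norm_mult_op:
  assumes b: "Linf_bounded_by K b" and K: "K \<ge> 0"
  shows "norm (mult_op b v) \<le> K * norm v"
proof -
  have L: "(\<lambda>x. b x * l2_rep v x) \<in> L2" by (rule Linf_mult_L2[OF b l2_rep(1)])
  have "(norm (mult_op b v))\<^sup>2 = (\<integral>x. (b x * l2_rep v x)\<^sup>2 \<partial>lebesgue)"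
    unfolding mult_op_def power2_norm_eq_inner inner_l2_class[OF L L] by (simp only: power2_eq_square)
  also have "\<dots> \<le> (\<integral>x. K\<^sup>2 * (l2_rep v x)\<^sup>2 \<partial>lebesgue)"
  proof (rule integral_mono_AE)
    show "integrable lebesgue (\<lambda>x. (b x * l2_rep v x)\<^sup>2)" by (rule L2_integrable_square[OF L])
    show "integrable lebesgue (\<lambda>x. K\<^sup>2 * (l2_rep v x)\<^sup>2)"
      by (intro integrable_mult_right L2_integrable_square l2_rep)
    have "AE x in lebesgue. \<bar>b x\<bar> \<le> K" using b by (simp add: Linf_bounded_by_def)
    then show "AE x in lebesgue. (b x * l2_rep v x)\<^sup>2 \<le> K\<^sup>2 * (l2_rep v x)\<^sup>2"
    proof eventually_elim
      case (elim x)
      then have "\<bar>b x\<bar>\<^sup>2 \<le> K\<^sup>2" by (intro power_mono) auto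
      then show ?case by (simp add: power_mult_distrib mult_right_mono)
    qed
  qed
  also have "\<dots> = (K * norm v)\<^sup>2"
    using inner_l2_rep[of v v] by (simp add: power_mult_distrib power2_norm_eq_inner
        power2_eq_square[of "l2_rep v _"])
  finally show ?thesis by (rule power2_le_imp_le) (simp add: K)
qed

lemma bounded_linear_mult_op:
  assumes b: "Linf_bounded_by K b" and K: "K \<ge> 0"
  shows "bounded_linear (mult_op b)"
proof (rule bounded_linear_intro)
  show "mult_op b (u + v) = mult_op b u + mult_op b v" for u v
  proof -
    have "mult_op b (u + v) = mult_op b (l2_class (\<lambda>x. l2_rep u x + l2_rep v x))"
        by (simp add: l2_class_add l2_rep)
    also have "\<dots> = l2_class (\<lambda>x. b x * l2_rep u x + b x * l2_rep v x)"
      by (subst mult_op_l2_class[OF b]) (auto simp: distrib_left intro: L2_add l2_rep)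
    finally show ?thesis by (simp add: l2_class_add Linf_mult_L2[OF b] l2_rep mult_op_def)
  qed
  show "mult_op b (r *\<^sub>R v) = r *\<^sub>R mult_op b v" for r v
  proof -
    have "mult_op b (r *\<^sub>R v) = mult_op b (l2_class (\<lambda>x. r * l2_rep v x))"
        by (simp add: l2_class_cmult l2_rep)
    also have "\<dots> = l2_class (\<lambda>x. r * (b x * l2_rep v x))"
      by (subst mult_op_l2_class[OF b]) (auto simp: mult_ac intro: L2_cmult l2_rep)
    finally show ?thesis by (simp add: l2_class_cmult Linf_mult_L2[OF b] l2_rep mult_op_def)
  qed
  show "norm (mult_op b v) \<le> norm v * K" for v using norm_mult_op[OF b K, of v]
      by (simp add: mult.commute)
qed

definition visc_op :: "'n::finite tensor \<Rightarrow> 'n l2 ^ 'n ^ 'n \<Rightarrow> 'n l2 ^ 'n ^ 'n" where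
  "visc_op a E = (\<chi> i \<alpha>. \<Sum>j\<in>UNIV. \<Sum>\<beta>\<in>UNIV. mult_op (a i j \<alpha> \<beta>) (E $ j $ \<beta>))"

lemma bounded_linear_sym_part: "bounded_linear (sym_part :: 'n::finite l2 ^ 'n ^ 'n \<Rightarrow> _)"
  unfolding sym_part_def
  by (intro bounded_linear_vec_lambda bounded_linear_const_scaleR bounded_linear_add
      bounded_linear_compose[OF bounded_linear_vec_nth bounded_linear_vec_nth])

lemma sym_part_sym: "sym_part U $ j $ k = sym_part U $ k $ j"
  by (simp add: sym_part_def add.commute)

lemma vtrace_sym_part: "vtrace (sym_part U) = vtrace U"
  by (simp add: vtrace_def sym_part_def scaleR_2[symmetric])

text \<open>The antisymmetric part of U cancels against a symmetric T. This converts between testing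
  the viscous stress with a Jacobian, as the weak equation does, and with its symmetric part, as
  ellipticity does.\<close>

lemma inner_sym_part:
  assumes "\<And>i j. T $ i $ j = T $ j $ i"
  shows "inner T (sym_part U) = inner T U"
proof -
  have "(\<Sum>j\<in>UNIV. \<Sum>k\<in>UNIV. inner (T $ j $ k) (U $ k $ j))
      = (\<Sum>k\<in>UNIV. \<Sum>j\<in>UNIV. inner (T $ k $ j) (U $ k $ j))"
    by (subst sum.swap) (simp only: assms[of _ _])
  then show ?thesis
    by (simp add: inner_vec_def sym_part_def inner_add_right sum.distrib sum_distrib_left[symmetric]
        sum_divide_distrib[symmetric])
qed

context
  fixes a :: "'n::finite tensor" and c K :: real
  assumes visc: "viscosity_tensor c a" and K: "K \<ge> 0"
    and bnd: "\<And>i j \<alpha> \<beta>. Linf_bounded_by K (a i j \<alpha> \<beta>)"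
begin

lemma bounded_linear_visc_op: "bounded_linear (visc_op a)"
  unfolding visc_op_def
  by (intro bounded_linear_vec_lambda bounded_linear_sum
      bounded_linear_compose[OF bounded_linear_mult_op[OF bnd K]
        bounded_linear_compose[OF bounded_linear_vec_nth bounded_linear_vec_nth]])

lemma visc_op_l2_class:
  assumes e: "\<And>j \<beta>. e j \<beta> \<in> L2" "\<And>j \<beta>. E $ j $ \<beta> = l2_class (e j \<beta>)"
  shows "(\<lambda>x. \<Sum>j\<in>UNIV. \<Sum>\<beta>\<in>UNIV. a i j \<alpha> \<beta> x * e j \<beta> x) \<in> L2"
    "visc_op a E $ i $ \<alpha> = l2_class (\<lambda>x. \<Sum>j\<in>UNIV. \<Sum>\<beta>\<in>UNIV. a i j \<alpha> \<beta> x * e j \<beta> x)"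
proof -
  have L: "(\<lambda>x. a i j \<alpha> \<beta> x * e j \<beta> x) \<in> L2" for j \<beta> by (rule Linf_mult_L2[OF bnd e(1)])
  have L': "(\<lambda>x. \<Sum>\<beta>\<in>UNIV. a i j \<alpha> \<beta> x * e j \<beta> x) \<in> L2"
    "l2_class (\<lambda>x. \<Sum>\<beta>\<in>UNIV. a i j \<alpha> \<beta> x * e j \<beta> x) = (\<Sum>\<beta>\<in>UNIV. l2_class (\<lambda>x. a i j \<alpha> \<beta> x * e j \<beta> x))"
        for j
    using l2_class_sum[where f="\<lambda>\<beta> x. a i j \<alpha> \<beta> x * e j \<beta> x", OF finite_class.finite_UNIV L] by auto
  note L'' = l2_class_sum[where f="\<lambda>j x. \<Sum>\<beta>\<in>UNIV. a i j \<alpha> \<beta> x * e j \<beta> x", OF finite_class.finite_UNIV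
      L'(1)]
  then show "(\<lambda>x. \<Sum>j\<in>UNIV. \<Sum>\<beta>\<in>UNIV. a i j \<alpha> \<beta> x * e j \<beta> x) \<in> L2" by blast
  show "visc_op a E $ i $ \<alpha> = l2_class (\<lambda>x. \<Sum>j\<in>UNIV. \<Sum>\<beta>\<in>UNIV. a i j \<alpha> \<beta> x * e j \<beta> x)"
    using L'' by (simp add: visc_op_def e(2) mult_op_l2_class[OF bnd e(1)] L'(2))
qed

lemmas visc_op_l2_rep = visc_op_l2_class[of "\<lambda>j \<beta>. l2_rep (_ $ j $ \<beta>)", OF l2_rep(1)
    l2_rep(2)[symmetric]]

text \<open>Reflects the coefficient symmetry that exchanges i and \<alpha>.\<close>

lemma visc_op_sym: "visc_op a E $ i $ \<alpha> = visc_op a E $ \<alpha> $ i"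
proof -
  have "AE x in lebesgue. \<forall>i j \<alpha> \<beta>. a i j \<alpha> \<beta> x = a \<alpha> j i \<beta> x \<and> a i j \<alpha> \<beta> x = a i \<beta> \<alpha> j x"
    using visc by (simp add: viscosity_tensor_def)
  then have "AE x in lebesgue. (\<Sum>j\<in>UNIV. \<Sum>\<beta>\<in>UNIV. a i j \<alpha> \<beta> x * l2_rep (E $ j $ \<beta>) x)
      = (\<Sum>j\<in>UNIV. \<Sum>\<beta>\<in>UNIV. a \<alpha> j i \<beta> x * l2_rep (E $ j $ \<beta>) x)"
  proof eventually_elim
    case (elim x)
    then have "a i j \<alpha> \<beta> x = a \<alpha> j i \<beta> x" for j \<beta> by blast
    then show ?case by (simp only:)
  qed
  then show ?thesis by (simp add: visc_op_l2_rep l2_class_eq_iff)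
qed

text \<open>A crude entrywise estimate: the sums over i, \<alpha>, j and \<beta> have n^4 terms,
  each at most K norm U.\<close>

lemma norm_visc_op_sym_part:
  "norm (visc_op a (sym_part U)) \<le> (real CARD('n) ^ 4 * K) * norm U"
proof -
  have s: "norm (sym_part U $ j $ k) \<le> norm U" for j k
  proof -
    have c: "norm (U $ j $ k) \<le> norm U" for j k
      by (rule order_trans[OF Finite_Cartesian_Product.norm_nth_le Finite_Cartesian_Product.norm_nth_le])
    have "norm (sym_part U $ j $ k) \<le> (1/2) * (norm (U $ k $ j) + norm (U $ j $ k))"
      using norm_triangle_ineq[of "U $ k $ j" "U $ j $ k"] by (simp add: sym_part_def)
    also have "\<dots> \<le> (1/2) * (norm U + norm U)" by (intro mult_left_mono add_mono c) auto
    finally show ?thesis by simp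
  qed
  have "norm (visc_op a (sym_part U)) \<le> (\<Sum>i\<in>UNIV. norm (visc_op a (sym_part U) $ i))"
      by (rule norm_vec_le_sum)
  also have "\<dots> \<le> (\<Sum>i\<in>(UNIV::'n set). \<Sum>\<alpha>\<in>(UNIV::'n set). norm (visc_op a (sym_part U) $ i $ \<alpha>))"
    by (intro sum_mono norm_vec_le_sum)
  also have "\<dots> \<le> (\<Sum>i\<in>(UNIV::'n set). \<Sum>\<alpha>\<in>(UNIV::'n set). \<Sum>j\<in>(UNIV::'n set). \<Sum>\<beta>\<in>(UNIV::'n set). K * norm
      U)"
  proof (intro sum_mono)
    fix i \<alpha>
    have "norm (visc_op a (sym_part U) $ i $ \<alpha>)
        \<le> (\<Sum>j\<in>UNIV. \<Sum>\<beta>\<in>UNIV. norm (mult_op (a i j \<alpha> \<beta>) (sym_part U $ j $ \<beta>)))"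
      unfolding visc_op_def by (simp, intro sum_norm_le) (rule order_refl sum_norm_le)+
    also have "\<dots> \<le> (\<Sum>j\<in>(UNIV::'n set). \<Sum>\<beta>\<in>(UNIV::'n set). K * norm U)"
      by (intro sum_mono order_trans[OF norm_mult_op[OF bnd K]] mult_left_mono s K)
    finally show "norm (visc_op a (sym_part U) $ i $ \<alpha>) \<le> (\<Sum>j\<in>(UNIV::'n set). \<Sum>\<beta>\<in>(UNIV::'n set). K
        * norm U)" .
  qed
  also have "\<dots> = (real CARD('n) ^ 4 * K) * norm U" by (simp add: power4_eq_xxxx)
  finally show ?thesis .
qed

lemma visc_op_elliptic:
  assumes sym: "\<And>i j. E $ i $ j = E $ j $ i" and tr: "vtrace E = 0"
  shows "inverse c * (norm E)\<^sup>2 \<le> inner (visc_op a E) E"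
proof -
  define e where "e i \<alpha> = l2_rep (E $ i $ \<alpha>)" for i \<alpha>
  have e: "e i \<alpha> \<in> L2" "l2_class (e i \<alpha>) = E $ i $ \<alpha>" for i \<alpha> by (auto simp: e_def l2_rep)
  \<comment> \<open>Symmetry holds at every point, because equal classes have the same chosen
    representative; the trace of the representatives is only known to vanish almost
    everywhere.\<close>
  have es: "e i \<alpha> = e \<alpha> i" for i \<alpha> by (simp add: e_def sym)
  define h where "h i \<alpha> x = (\<Sum>j\<in>UNIV. \<Sum>\<beta>\<in>UNIV. a i j \<alpha> \<beta> x * e j \<beta> x)" for i \<alpha> x
  have h: "h i \<alpha> \<in> L2" "visc_op a E $ i $ \<alpha> = l2_class (h i \<alpha>)" for i \<alpha>
    using visc_op_l2_class[of e E i \<alpha>] e by (simp_all add: h_def[abs_def])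
  have I1: "integrable lebesgue (\<lambda>x. h i \<alpha> x * e i \<alpha> x)" for i \<alpha> by (intro L2_mult_integrable h e)
  have I2: "integrable lebesgue (\<lambda>x. (e i \<alpha> x)\<^sup>2)" for i \<alpha> by (intro L2_integrable_square e)
  have lhs: "inner (visc_op a E) E = (\<integral>x. (\<Sum>i\<in>UNIV. \<Sum>\<alpha>\<in>UNIV. h i \<alpha> x * e i \<alpha> x) \<partial>lebesgue)"
  proof -
    have "inner (visc_op a E) E = (\<Sum>i\<in>UNIV. \<Sum>\<alpha>\<in>UNIV. inner (l2_class (h i \<alpha>)) (l2_class (e i \<alpha>)))"
      by (simp add: inner_vec_def h(2) e(2))
    also have "\<dots> = (\<Sum>i\<in>UNIV. \<Sum>\<alpha>\<in>UNIV. \<integral>x. h i \<alpha> x * e i \<alpha> x \<partial>lebesgue)"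
      by (simp only: inner_l2_class[OF h(1) e(1)])
    also have "\<dots> = (\<integral>x. (\<Sum>i\<in>UNIV. \<Sum>\<alpha>\<in>UNIV. h i \<alpha> x * e i \<alpha> x) \<partial>lebesgue)"
      using I1 by simp
    finally show ?thesis .
  qed
  have rhs: "(norm E)\<^sup>2 = (\<integral>x. (\<Sum>i\<in>UNIV. \<Sum>\<alpha>\<in>UNIV. (e i \<alpha> x)\<^sup>2) \<partial>lebesgue)"
  proof -
    have "(norm E)\<^sup>2 = (\<Sum>i\<in>UNIV. \<Sum>\<alpha>\<in>UNIV. inner (l2_class (e i \<alpha>)) (l2_class (e i \<alpha>)))"
      by (simp add: power2_norm_eq_inner inner_vec_def e(2))
    also have "\<dots> = (\<Sum>i\<in>UNIV. \<Sum>\<alpha>\<in>UNIV. \<integral>x. (e i \<alpha> x)\<^sup>2 \<partial>lebesgue)"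
      by (simp only: inner_l2_class[OF e(1) e(1)] power2_eq_square)
    also have "\<dots> = (\<integral>x. (\<Sum>i\<in>UNIV. \<Sum>\<alpha>\<in>UNIV. (e i \<alpha> x)\<^sup>2) \<partial>lebesgue)"
      using I2 by simp
    finally show ?thesis .
  qed
  have "AE x in lebesgue. (\<Sum>i\<in>UNIV. e i i x) = 0"
  proof -
    note s = l2_class_sum[where f="\<lambda>i. e i i", OF finite_class.finite_UNIV e(1)]
    have "l2_class (\<lambda>x. \<Sum>i\<in>UNIV. e i i x) = l2_class (\<lambda>x. 0)" using s tr
        by (simp add: vtrace_def e(2) l2_class_zero)
    then show ?thesis using l2_class_eq_iff[OF conjunct1[OF s] L2_zero] by simp
  qed
  moreover have "AE x in lebesgue. \<forall>\<xi>::real^'n^'n. transpose \<xi> = \<xi> \<longrightarrow> trace \<xi> = 0 \<longrightarrow>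
        (\<Sum>i\<in>UNIV. \<Sum>j\<in>UNIV. \<Sum>\<alpha>\<in>UNIV. \<Sum>\<beta>\<in>UNIV. a i j \<alpha> \<beta> x * \<xi> $ i $ \<alpha> * \<xi> $ j $ \<beta>)
          \<ge> inverse c * (\<Sum>i\<in>UNIV. \<Sum>\<alpha>\<in>UNIV. (\<xi> $ i $ \<alpha>)\<^sup>2)"
    using visc by (simp add: viscosity_tensor_def)
  ultimately have "AE x in lebesgue. inverse c * (\<Sum>i\<in>UNIV. \<Sum>\<alpha>\<in>UNIV. (e i \<alpha> x)\<^sup>2)
      \<le> (\<Sum>i\<in>UNIV. \<Sum>\<alpha>\<in>UNIV. h i \<alpha> x * e i \<alpha> x)"
  proof eventually_elim
    case (elim x)
    define \<xi> :: "real^'n^'n" where "\<xi> = (\<chi> i \<alpha>. e i \<alpha> x)"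
    have "transpose \<xi> = \<xi>" using es by (simp add: transpose_def \<xi>_def vec_eq_iff)
    moreover have "trace \<xi> = 0" using elim(1) by (simp add: trace_def \<xi>_def)
    ultimately have "inverse c * (\<Sum>i\<in>UNIV. \<Sum>\<alpha>\<in>UNIV. (e i \<alpha> x)\<^sup>2)
        \<le> (\<Sum>i\<in>UNIV. \<Sum>j\<in>UNIV. \<Sum>\<alpha>\<in>UNIV. \<Sum>\<beta>\<in>UNIV. a i j \<alpha> \<beta> x * e i \<alpha> x * e j \<beta> x)"
      using elim(2) by (auto simp: \<xi>_def)
    also have "\<dots> = (\<Sum>i\<in>UNIV. \<Sum>\<alpha>\<in>UNIV. \<Sum>j\<in>UNIV. \<Sum>\<beta>\<in>UNIV. a i j \<alpha> \<beta> x * e i \<alpha> x * e j \<beta> x)"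
      by (rule sum.cong[OF refl]) (rule sum.swap)
    also have "\<dots> = (\<Sum>i\<in>UNIV. \<Sum>\<alpha>\<in>UNIV. h i \<alpha> x * e i \<alpha> x)"
      unfolding h_def sum_distrib_right by (intro sum.cong refl) (simp only: mult_ac)
    finally show ?case .
  qed
  then have "(\<integral>x. inverse c * (\<Sum>i\<in>UNIV. \<Sum>\<alpha>\<in>UNIV. (e i \<alpha> x)\<^sup>2) \<partial>lebesgue)
      \<le> (\<integral>x. (\<Sum>i\<in>UNIV. \<Sum>\<alpha>\<in>UNIV. h i \<alpha> x * e i \<alpha> x) \<partial>lebesgue)"
    by (intro integral_mono_AE integrable_mult_right Bochner_Integration.integrable_sum I1 I2)
  then show ?thesis unfolding lhs rhs by simp
qed

text \<open>Ellipticity controls the symmetric part with constant 1 / c, and Korn's identity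
  converts it into half of the full gradient; hence 1 / (2 c).\<close>

lemma stokes_form_visc_op:
  assumes n: "CARD('n) \<ge> 3"
  shows "stokes_form (\<lambda>U. visc_op a (sym_part U)) (inverse (2 * c)) (real CARD('n) ^ 4 * K)"
proof (rule stokes_form.intro)
  have c: "c > 0" using visc by (simp add: viscosity_tensor_def)
  show "bounded_linear (\<lambda>U. visc_op a (sym_part U))"
    by (rule bounded_linear_compose[OF bounded_linear_visc_op bounded_linear_sym_part])
  show "inverse (2 * c) > 0" using c by simp
  show "norm (visc_op a (sym_part U)) \<le> real CARD('n) ^ 4 * K * norm U" for U
      by (rule norm_visc_op_sym_part)
  show "inverse (2 * c) * (norm U)\<^sup>2 \<le> inner (visc_op a (sym_part U)) U"
    if U: "U \<in> vgrad_space" "vtrace U = 0" for U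
  proof -
    have "(norm (sym_part U))\<^sup>2 = (1/2) * (norm U)\<^sup>2" using korn[OF U(1)] U(2) by simp
    then have "inverse (2 * c) * (norm U)\<^sup>2 = inverse c * (norm (sym_part U))\<^sup>2" by simp
    also have "\<dots> \<le> inner (visc_op a (sym_part U)) (sym_part U)"
      by (rule visc_op_elliptic) (simp_all add: sym_part_sym vtrace_sym_part U(2))
    also have "\<dots> = inner (visc_op a (sym_part U)) U" by (rule inner_sym_part) (rule visc_op_sym)
    finally show ?thesis .
  qed
qed (rule n)

end

section \<open>The dual space\<close>

lemma norm_H1_nonneg: "norm_H1 v \<ge> 0"
  by (simp add: norm_H1_def sum_nonneg)

lemma norm_H1_cmult:
  assumes "weak_grad v V" shows "norm_H1 (\<lambda>x. c * v x) = \<bar>c\<bar> * norm_H1 v"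
proof -
  have L: "(\<lambda>x. v x / rho x) \<in> L2" using assms by (simp add: weak_grad_def)
  have "l2_class (\<lambda>x. c * v x / rho x) = c *\<^sub>R l2_class (\<lambda>x. v x / rho x)"
      using l2_class_cmult[OF L, of c] by simp
  then have "norm_H1 (\<lambda>x. c * v x) = sqrt (c\<^sup>2 * ((norm (l2_class (\<lambda>x. v x / rho x)))\<^sup>2 + (norm V)\<^sup>2))"
    unfolding norm_H1_weak_grad[OF weak_grad_cmult[OF assms]]
        by (simp add: power_mult_distrib distrib_left)
  then show ?thesis unfolding norm_H1_weak_grad[OF assms] real_sqrt_mult by simp
qed

lemma Hm1_bdd_above:
  fixes F :: "'n::finite distr"
  assumes "F \<in> Hm1"
  shows "bdd_above ((\<lambda>v. \<bar>F v\<bar>) ` {v \<in> H1. norm_H1 v \<le> 1})"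
proof -
  obtain K where K: "\<forall>v\<in>H1. \<bar>F v\<bar> \<le> K * norm_H1 v" using assms unfolding Hm1_def by blast
  show ?thesis
  proof (rule bdd_aboveI2)
    fix v :: "real^'n \<Rightarrow> real" assume v: "v \<in> {v \<in> H1. norm_H1 v \<le> 1}"
    have "\<bar>F v\<bar> \<le> K * norm_H1 v" using K v by simp
    also have "\<dots> \<le> \<bar>K\<bar> * 1" using v norm_H1_nonneg[of v] by (intro mult_mono) auto
    finally show "\<bar>F v\<bar> \<le> \<bar>K\<bar> * 1" .
  qed
qed

text \<open>Scale w to norm 1, where the supremum applies; if its norm is 0, the boundedness built
  into \<open>Hm1\<close> already gives F w = 0.\<close>

lemma Hm1_bound:
  fixes F :: "'n::finite distr"
  assumes F: "F \<in> Hm1" and w: "weak_grad w W"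
  shows "\<bar>F w\<bar> \<le> norm_Hm1 F * norm_H1 w"
proof -
  have w1: "w \<in> H1" by (rule weak_grad_H1(1)[OF w])
  obtain K where K: "\<forall>v\<in>H1. \<bar>F v\<bar> \<le> K * norm_H1 v" using F unfolding Hm1_def by blast
  show ?thesis
  proof (cases "norm_H1 w = 0")
    case True
    then show ?thesis using bspec[OF K w1] by simp
  next
    case False
    then have pos: "norm_H1 w > 0" using norm_H1_nonneg[of w] by simp
    let ?v = "\<lambda>x. (1 / norm_H1 w) * w x"
    have v: "?v \<in> H1" by (rule weak_grad_H1(1)[OF weak_grad_cmult[OF w]])
    have nv: "norm_H1 ?v = 1" unfolding norm_H1_cmult[OF w] using pos by simp
    have Fv: "F ?v = (1 / norm_H1 w) * F w" using F w1 unfolding Hm1_def by blast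
    have "\<bar>F ?v\<bar> \<le> norm_Hm1 F"
      unfolding norm_Hm1_def using v nv by (intro cSUP_upper Hm1_bdd_above[OF F]) auto
    then show ?thesis unfolding Fv using pos by (simp add: abs_mult field_simps)
  qed
qed

text \<open>The zero function belongs to the unit ball, so the supremum dominates at least one
  absolute value.\<close>

lemma Hm1_norm_nonneg:
  fixes F :: "'n::finite distr"
  assumes "F \<in> Hm1" shows "norm_Hm1 F \<ge> 0"
proof -
  have z: "weak_grad (\<lambda>x::real^'n. 0) (grad (\<lambda>x. 0))" by (rule weak_grad_test[OF test_zero])
  have "norm_H1 (\<lambda>x::real^'n. 0 * (\<lambda>x. 0) x) = 0" unfolding norm_H1_cmult[OF z] by simp
  then have n0: "norm_H1 (\<lambda>x::real^'n. 0) = 0" by simp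
  have "\<bar>F (\<lambda>x. 0)\<bar> \<le> norm_Hm1 F"
    unfolding norm_Hm1_def using weak_grad_H1(1)[OF z] n0 by (intro cSUP_upper Hm1_bdd_above[OF assms])
        auto
  then show ?thesis using abs_ge_zero order_trans by blast
qed

text \<open>F depends only on the weak gradient, because by \<open>norm_H1_le\<close> a function
  with gradient 0 has norm 0 in \<open>H1\<close>. So F descends to a bounded functional on
  \<open>grad_space\<close>, where the Riesz theorem applies; the factor 3 is that of
  \<open>norm_H1_le\<close>.\<close>

lemma Hm1_representation:
  fixes F :: "'n::finite distr"
  assumes n: "CARD('n) \<ge> 3" and F: "F \<in> Hm1"
  shows "\<exists>r. (\<forall>w W. weak_grad w W \<longrightarrow> F w = inner r W) \<and> norm r \<le> 3 * norm_Hm1 F"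
proof -
  have add: "F (\<lambda>x. v x + w x) = F v + F w" if "v \<in> H1" "w \<in> H1" for v w
    using F that by (simp add: Hm1_def)
  have scale: "F (\<lambda>x. c * v x) = c * F v" if "v \<in> H1" for v c
    using F that by (simp add: Hm1_def)
  have bd: "\<bar>F w\<bar> \<le> 3 * norm_Hm1 F * norm W" if w: "weak_grad w W" for w W
  proof -
    have "\<bar>F w\<bar> \<le> norm_Hm1 F * norm_H1 w" by (rule Hm1_bound[OF F w])
    also have "\<dots> \<le> norm_Hm1 F * (3 * norm W)"
      by (intro mult_left_mono norm_H1_le[OF n w] Hm1_norm_nonneg[OF F])
    finally show ?thesis by simp
  qed
  have wd: "F v = F w" if v: "weak_grad v W" and w: "weak_grad w W" for v w W
  proof -
    have m: "weak_grad (\<lambda>x. -1 * w x) ((-1) *\<^sub>R W)" by (rule weak_grad_cmult[OF w])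
    have "F (\<lambda>x. v x + -1 * w x) = F v - F w"
      using add[OF weak_grad_H1(1)[OF v] weak_grad_H1(1)[OF m]] scale[OF weak_grad_H1(1)[OF w], of "-1"]
      by simp
    moreover have "\<bar>F (\<lambda>x. v x + -1 * w x)\<bar> \<le> 3 * norm_Hm1 F * norm (W + (-1) *\<^sub>R W)"
      by (rule bd[OF weak_grad_add[OF v m]])
    ultimately show ?thesis by simp
  qed
  \<comment> \<open>An arbitrary choice of potentials. The choice itself need not be linear, but
    \<open>F (pot W)\<close> is linear in W because F does not see the choice.\<close>
  define pot where "pot W = (SOME w. weak_grad w W)" for W :: "'n l2 ^ 'n"
  have pot: "weak_grad (pot W) W" if "W \<in> grad_space" for W
    unfolding pot_def by (rule someI_ex[of "\<lambda>w. weak_grad w W"]) (use grad_space_potential[OF n that]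
        in blast)
  have Fpot: "F w = F (pot W)" if w: "weak_grad w W" for w W
    by (rule wd[OF w pot[OF weak_grad_in_grad_space(1)[OF n w]]])
  have "\<exists>r\<in>grad_space. \<forall>W\<in>grad_space. F (pot W) = inner r W"
  proof (rule riesz_representation[OF closed_grad_space subspace_grad_space])
    show "F (pot (V + W)) = F (pot V) + F (pot W)" if "V \<in> grad_space" "W \<in> grad_space" for V W
      using Fpot[OF weak_grad_add[OF pot[OF that(1)] pot[OF that(2)]]]
        add[OF weak_grad_H1(1)[OF pot[OF that(1)]] weak_grad_H1(1)[OF pot[OF that(2)]]] by simp
    show "F (pot (c *\<^sub>R W)) = c * F (pot W)" if "W \<in> grad_space" for c W
      using Fpot[OF weak_grad_cmult[OF pot[OF that]], of c] scale[OF weak_grad_H1(1)[OF pot[OF that]],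
          of c] by simp
    show "\<bar>F (pot W)\<bar> \<le> 3 * norm_Hm1 F * norm W" if "W \<in> grad_space" for W
      by (rule bd[OF pot[OF that]])
  qed
  then obtain r where r: "r \<in> grad_space" "\<And>W. W \<in> grad_space \<Longrightarrow> F (pot W) = inner r W" by blast
  have "F w = inner r W" if w: "weak_grad w W" for w W
    using Fpot[OF w] r(2)[OF weak_grad_in_grad_space(1)[OF n w]] by simp
  moreover have "norm r \<le> 3 * norm_Hm1 F"
  proof (cases "r = 0")
    case True
    then show ?thesis using Hm1_norm_nonneg[OF F] by simp
  next
    case False
    have "norm r * norm r = inner r r" by (simp add: power2_norm_eq_inner[symmetric] power2_eq_square)
    also have "\<dots> \<le> 3 * norm_Hm1 F * norm r" using bd[OF pot[OF r(1)]] r by simp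
    finally show ?thesis using False by simp
  qed
  ultimately show ?thesis by blast
qed

section \<open>Well-posedness\<close>

text \<open>Passes from n scalar equations tested with test functions to one equation tested with
  Jacobians: forward by density in each row, backward by fields with a single nonzero
  component.\<close>

lemma weak_equation_iff:
  "(\<forall>i. \<forall>\<phi>\<in>test_functions. inner (X $ i) (grad \<phi>) = inner q (grad \<phi> $ i))
    \<longleftrightarrow> (\<forall>W\<in>vgrad_space. inner X W = inner q (vtrace W))"
proof safe
  fix W :: "'a l2 ^ 'a ^ 'a"
  assume *: "\<forall>i. \<forall>\<phi>\<in>test_functions. inner (X $ i) (grad \<phi>) = inner q (grad \<phi> $ i)"
      and W: "W \<in> vgrad_space"
  have "inner (X $ i) (W $ i) = inner q (W $ i $ i)" for i
  proof (rule grad_space_induct_closed)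
    show "closed {G. inner (X $ i) G = inner q (G $ i)}"
      by (intro closed_Collect_eq continuous_on_inner continuous_on_const continuous_on_id
          continuous_on_vec_nth_id)
    show "W $ i \<in> grad_space" using W by (simp add: vgrad_space_def)
  qed (use * in blast)
  then show "inner X W = inner q (vtrace W)"
      by (simp add: inner_vec_def[of X] vtrace_def inner_sum_right)
next
  fix i and \<phi> :: "real^'a \<Rightarrow> real"
  assume *: "\<forall>W\<in>vgrad_space. inner X W = inner q (vtrace W)" and \<phi>: "\<phi> \<in> test_functions"
  have "axis i (grad \<phi>) \<in> vgrad_space"
    using grad_in[OF \<phi>] subspace_0[OF subspace_grad_space] by (auto simp: vgrad_space_def axis_def)
  then have "inner X (axis i (grad \<phi>)) = inner q (vtrace (axis i (grad \<phi>)))" using * by blast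
  moreover have "vtrace (axis i (grad \<phi>)) = grad \<phi> $ i"
  proof -
    have "axis i (grad \<phi>) $ j $ j = (if j = i then grad \<phi> $ j else 0)" for j by (simp add: axis_def)
    then show ?thesis by (simp add: vtrace_def)
  qed
  ultimately show "inner (X $ i) (grad \<phi>) = inner q (grad \<phi> $ i)" by (simp add: inner_axis)
qed

lemma dist_div_iff:
  fixes u :: "real^'n::finite \<Rightarrow> real^'n"
  assumes u: "\<And>i. weak_grad (\<lambda>x. u x $ i) (U $ i)" and g: "g \<in> L2"
  shows "dist_eq (dist_div u) (regular_dist g) \<longleftrightarrow> vtrace U = l2_class g"
proof -
  have "dist_div u \<phi> = inner (vtrace U) (l2_class \<phi>)" "regular_dist g \<phi>
      = inner (l2_class g) (l2_class \<phi>)"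
    if \<phi>: "\<phi> \<in> test_functions" for \<phi>
    using u \<phi> inner_l2_class[OF g test_L2[OF \<phi>]]
    by (simp_all add: dist_div_def dist_partial_def regular_dist_def weak_grad_def vtrace_def
        inner_sum_left)
  then have "dist_eq (dist_div u) (regular_dist g) \<longleftrightarrow>
      (\<forall>\<phi>\<in>test_functions. inner (vtrace U - l2_class g) (l2_class \<phi>) = 0)"
    by (simp add: dist_eq_def inner_diff_left)
  also have "\<dots> \<longleftrightarrow> vtrace U - l2_class g = 0" using l2_eq_0I[of "vtrace U - l2_class g"] by auto
  finally show ?thesis by simp
qed

context
  fixes a :: "'n::finite tensor" and c K :: real
  assumes visc: "viscosity_tensor c a" and K: "K \<ge> 0"
    and bnd: "\<And>i j \<alpha> \<beta>. Linf_bounded_by K (a i j \<alpha> \<beta>)" and n: "CARD('n) \<ge> 3"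
begin

text \<open>Every distributional derivative moves onto \<phi> with a minus sign; hence the viscous
  term is negative and the pressure term positive.\<close>

lemma stokes_op_eq:
  assumes u: "\<And>i. weak_grad (\<lambda>x. u x $ i) (U $ i)" and p: "p \<in> L2" and \<phi>: "\<phi> \<in> test_functions"
  shows "stokes_op a u p i \<phi> = inner (l2_class p) (grad \<phi> $ i) - inner (visc_op a (sym_part U) $ i)
      (grad \<phi>)"
proof -
  have wp: "weak_partial j (\<lambda>y. u y $ k) \<in> L2" "l2_class (weak_partial j (\<lambda>y. u y $ k)) = U $ k $ j"
      for j k
    using weak_grad_H1[OF u] by auto
  have sg: "sym_grad u j \<beta> = (\<lambda>x. (1/2) * (weak_partial j (\<lambda>y. u y $ \<beta>) x
      + weak_partial \<beta> (\<lambda>y. u y $ j) x))" for j \<beta>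
    by (simp add: sym_grad_def fun_eq_iff)
  have e: "sym_grad u j \<beta> \<in> L2" "sym_part U $ j $ \<beta> = l2_class (sym_grad u j \<beta>)" for j \<beta>
    unfolding sg by (intro L2_cmult L2_add wp) (simp only: l2_class_cmult[OF L2_add[OF wp(1) wp(1)]]
        l2_class_add[OF wp(1) wp(1)]
        wp(2) sym_part_def vec_lambda_beta)
  define h where "h \<alpha> x = (\<Sum>j\<in>UNIV. \<Sum>\<beta>\<in>UNIV. a i j \<alpha> \<beta> x * sym_grad u j \<beta> x)" for \<alpha> x
  have h: "h \<alpha> \<in> L2" "visc_op a (sym_part U) $ i $ \<alpha> = l2_class (h \<alpha>)" for \<alpha>
    using visc_op_l2_class[OF visc K bnd e, of i \<alpha>] by (simp_all add: h_def[abs_def])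
  have t: "partial_deriv \<alpha> \<phi> \<in> L2" for \<alpha> by (intro test_L2 test_partial_deriv \<phi>)
  have "stokes_op a u p i \<phi> = (\<Sum>\<alpha>\<in>UNIV. - (\<integral>x. h \<alpha> x * partial_deriv \<alpha> \<phi> x \<partial>lebesgue))
      + (\<integral>x. p x * partial_deriv i \<phi> x \<partial>lebesgue)"
    by (simp add: stokes_op_def dist_partial_def regular_dist_def h_def)
  also have "\<dots> = (\<Sum>\<alpha>\<in>UNIV. - inner (l2_class (h \<alpha>)) (l2_class (partial_deriv \<alpha> \<phi>)))
      + inner (l2_class p) (l2_class (partial_deriv i \<phi>))"
    by (simp only: inner_l2_class[OF h(1) t] inner_l2_class[OF p t])
  finally show ?thesis by (simp add: inner_vec_def h(2) grad_def sum_negf)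
qed

interpretation stokes_form "\<lambda>U. visc_op a (sym_part U)" "inverse (2 * c)" "real CARD('n) ^ 4 * K"
  by (rule stokes_form_visc_op[OF visc K bnd n])

text \<open>The assumptions already place u in \<open>H1\<close> and U in
  \<open>vgrad_space\<close>, so only the two equations remain to be translated.\<close>

lemma stokes_solution_iff:
  assumes F: "\<And>i w W. weak_grad w W \<Longrightarrow> F i w = inner (R $ i) W" and g: "g \<in> L2"
    and u: "\<And>i. weak_grad (\<lambda>x. u x $ i) (U $ i)" and p: "p \<in> L2"
  shows "stokes_solution a F g u p \<longleftrightarrow> weak_stokes R (l2_class g) U (l2_class p)"
proof -
  have "dist_eq (stokes_op a u p i) (F i) \<longleftrightarrow>
      (\<forall>\<phi>\<in>test_functions. inner ((visc_op a (sym_part U) + R) $ i) (grad \<phi>)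
          = inner (l2_class p) (grad \<phi> $ i))" for i
    unfolding dist_eq_def
  proof (intro ball_cong refl)
    fix \<phi> :: "real^'n \<Rightarrow> real" assume \<phi>: "\<phi> \<in> test_functions"
    show "(stokes_op a u p i \<phi> = F i \<phi>) \<longleftrightarrow>
        (inner ((visc_op a (sym_part U) + R) $ i) (grad \<phi>) = inner (l2_class p) (grad \<phi> $ i))"
      unfolding stokes_op_eq[OF u p \<phi>] F[OF weak_grad_test[OF \<phi>]] by (auto simp: inner_add_left)
  qed
  then have "(\<forall>i. dist_eq (stokes_op a u p i) (F i)) \<longleftrightarrow>
      (\<forall>W\<in>vgrad_space. inner (visc_op a (sym_part U) + R) W = inner (l2_class p) (vtrace W))"
    using weak_equation_iff[of "visc_op a (sym_part U) + R" "l2_class p"] by simp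
  moreover have "U \<in> vgrad_space"
    unfolding vgrad_space_def using weak_grad_in_grad_space(1)[OF n u] by blast
  moreover have "(\<lambda>x. u x $ i) \<in> H1" for i by (rule weak_grad_H1(1)[OF u])
  ultimately show ?thesis
    using dist_div_iff[OF u g] p by (auto simp: stokes_solution_def weak_stokes_def inner_add_left)
qed

text \<open>Let N be the norm of the data. From norm R \<le> 3 N and the coercivity constant 1 / (2
  c) follows norm U \<le> (2 c (3 + \<beta>) + 1) N. Passing from U to u costs a factor 3 and the
  pressure is at most \<beta> norm U + 3 N, so the total is (3 + \<beta>) norm U + 3 N.\<close>

lemma stokes_well_posed:
  assumes F: "\<And>i. F i \<in> Hm1" and g: "g \<in> L2"
  defines "\<beta> \<equiv> real CARD('n) ^ 4 * K"
  shows "\<exists>u p. stokes_solution a F g u p \<and>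
        (\<forall>v q. stokes_solution a F g v q \<longrightarrow>
          (AE x in lebesgue. v x = u x) \<and> (AE x in lebesgue. q x = p x)) \<and>
        norm_H1_vec u + norm_L2 p \<le> ((3 + \<beta>) * (2 * c * (3 + \<beta>) + 1) + 3) * (norm_Hm1_vec F + norm_L2 g)"
proof -
  have c: "c > 0" using visc by (simp add: viscosity_tensor_def)
  have \<beta>: "\<beta> \<ge> 0" using K by (simp add: \<beta>_def)
  have "\<exists>r. (\<forall>w W. weak_grad w W \<longrightarrow> F i w = inner r W) \<and> norm r \<le> 3 * norm_Hm1 (F i)" for i
    by (rule Hm1_representation[OF n F])
  then obtain r where r: "\<And>i w W. weak_grad w W \<Longrightarrow> F i w = inner (r i) W"
      "\<And>i. norm (r i) \<le> 3 * norm_Hm1 (F i)" by metis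
  define R where "R = (\<chi> i. r i)"
  have R: "\<And>i w W. weak_grad w W \<Longrightarrow> F i w = inner (R $ i) W" using r(1) by (simp add: R_def)
  have nR: "norm R \<le> 3 * norm_Hm1_vec F"
  proof -
    have "(norm R)\<^sup>2 = (\<Sum>i\<in>UNIV. (norm (r i))\<^sup>2)" by (simp add: norm_vec_square R_def)
    also have "\<dots> \<le> (\<Sum>i\<in>UNIV. (3 * norm_Hm1 (F i))\<^sup>2)" by (intro sum_mono power_mono r(2)) auto
    also have "\<dots> = (3 * norm_Hm1_vec F)\<^sup>2"
      by (simp add: norm_Hm1_vec_def power_mult_distrib sum_nonneg sum_distrib_left)
    finally show ?thesis
      by (rule power2_le_imp_le) (simp add: norm_Hm1_vec_def sum_nonneg)
  qed
  obtain U q where ws: "weak_stokes R (l2_class g) U q"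
    and nU: "norm U \<le> (norm R + \<beta> * norm (l2_class g)) / inverse (2 * c) + norm (l2_class g)"
    and nq: "norm q \<le> \<beta> * norm U + norm R"
    using weak_stokes_exists[of R "l2_class g"] unfolding \<beta>_def by blast
  have "U $ i \<in> grad_space" for i using ws by (simp add: weak_stokes_def vgrad_space_def)
  then have "\<exists>w. weak_grad w (U $ i)" for i using grad_space_potential[OF n] by blast
  then obtain w where w: "\<And>i. weak_grad (w i) (U $ i)" by metis
  define u where "u x = (\<chi> i. w i x)" for x
  have u: "weak_grad (\<lambda>x. u x $ i) (U $ i)" for i using w by (simp add: u_def)
  define p where "p = l2_rep q"
  have p: "p \<in> L2" "l2_class p = q" by (simp_all add: p_def l2_rep)
  have "weak_stokes R (l2_class g) U (l2_class p)" using ws unfolding p(2) .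
  then have sol: "stokes_solution a F g u p" using stokes_solution_iff[where F=F
      and R=R, OF R g u p(1)] by blast
  have uniq: "(AE x in lebesgue. v x = u x) \<and> (AE x in lebesgue. s x = p x)"
    if vs: "stokes_solution a F g v s" for v s
  proof -
    define V where "V = (\<chi> i k. l2_class (weak_partial k (\<lambda>x. v x $ i)))"
    have v: "weak_grad (\<lambda>x. v x $ i) (V $ i)" for i
      using vs H1_weak_grad[of "\<lambda>x. v x $ i"] by (simp add: stokes_solution_def V_def)
    have s: "s \<in> L2" using vs by (simp add: stokes_solution_def)
    have "weak_stokes R (l2_class g) V (l2_class s)" 
      using vs stokes_solution_iff[where F=F and R=R, OF R g v s] by blast
    then have eq: "V = U" "l2_class s = q" using weak_stokes_unique[OF _ ws] by auto
    \<comment> \<open>The gradients of v and u agree, so \<open>weak_grad_orthogonal_zero\<close> is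
      applied to the gradient 0.\<close>
    have "AE x in lebesgue. v x $ i - u x $ i = 0" for i
      by (rule weak_grad_orthogonal_zero(1)[OF n weak_grad_diff[OF v u]]) (simp add: eq)
    then have "AE x in lebesgue. \<forall>i\<in>UNIV. v x $ i - u x $ i = 0" by (intro AE_finite_allI) auto
    then have "AE x in lebesgue. v x = u x" by eventually_elim (simp add: vec_eq_iff)
    moreover have "AE x in lebesgue. s x = p x" using eq(2) p s by (simp add: l2_class_eq_iff[symmetric])
    ultimately show ?thesis by blast
  qed
  have est: "norm_H1_vec u + norm_L2 p \<le> ((3 + \<beta>) * (2 * c * (3 + \<beta>) + 1) + 3) * (norm_Hm1_vec F
      + norm_L2 g)"
  proof -
    define N where "N = norm_Hm1_vec F + norm_L2 g"
    have f0: "norm_Hm1_vec F \<ge> 0" by (simp add: norm_Hm1_vec_def sum_nonneg)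
    have g0: "norm (l2_class g) = norm_L2 g" by (rule norm_l2_class[OF g])
    have g1: "norm_L2 g \<ge> 0" unfolding g0[symmetric] by simp
    have "norm_H1_vec u \<le> 3 * norm U"
    proof -
      have "(norm_H1_vec u)\<^sup>2 = (\<Sum>i\<in>UNIV. (norm_H1 (\<lambda>x. u x $ i))\<^sup>2)"
        by (simp add: norm_H1_vec_def sum_nonneg)
      also have "\<dots> \<le> (\<Sum>i\<in>UNIV. (3 * norm (U $ i))\<^sup>2)"
        by (intro sum_mono power_mono norm_H1_le[OF n u] norm_H1_nonneg)
      also have "\<dots> = (3 * norm U)\<^sup>2"
        by (simp add: norm_vec_square power_mult_distrib sum_distrib_left)
      finally show ?thesis by (rule power2_le_imp_le) simp
    qed
    moreover have "norm_L2 p \<le> \<beta> * norm U + norm R" using nq norm_l2_class[OF p(1)] by (simp add: p(2))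
    moreover have nRN: "norm R \<le> 3 * N" using nR g1 by (simp add: N_def)
    moreover have "norm U \<le> (2 * c * (3 + \<beta>) + 1) * N"
    proof -
      have gN: "norm (l2_class g) \<le> N" using f0 by (simp add: N_def g0)
      have "norm R + \<beta> * norm (l2_class g) \<le> 3 * N + \<beta> * N" by (intro add_mono nRN mult_left_mono gN \<beta>)
      then have "(norm R + \<beta> * norm (l2_class g)) * (2 * c) \<le> (3 * N + \<beta> * N) * (2 * c)"
        using c by (intro mult_right_mono) auto
      then have "norm U \<le> (3 * N + \<beta> * N) * (2 * c) + N"
        using nU[unfolded divide_inverse inverse_inverse_eq] gN by linarith
      also have "\<dots> = (2 * c * (3 + \<beta>) + 1) * N" by (simp only: algebra_simps)
      finally show ?thesis .
    qed
    then have "(3 + \<beta>) * norm U \<le> (3 + \<beta>) * ((2 * c * (3 + \<beta>) + 1) * N)"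
      using \<beta> by (intro mult_left_mono) auto
    ultimately have "norm_H1_vec u + norm_L2 p \<le> (3 + \<beta>) * ((2 * c * (3 + \<beta>) + 1) * N) + 3 * N"
      unfolding distrib_right[of 3 \<beta> "norm U"] by linarith
    also have "\<dots> = ((3 + \<beta>) * (2 * c * (3 + \<beta>) + 1) + 3) * N"
      by (simp only: distrib_right mult.assoc)
    finally show ?thesis by (simp only: N_def)
  qed
  show ?thesis using sol uniq est by blast
qed

end

theorem theorem3p2:
  fixes c M :: real
  assumes "CARD('n::finite) \<ge> 3" and "c > 0"
  shows "\<exists>C>0. \<forall>a :: 'n tensor.
    viscosity_tensor c a \<and> (\<forall>i j \<alpha> \<beta>. Linf_bounded_by M (a i j \<alpha> \<beta>)) \<longrightarrow>
    (\<forall>(F :: 'n \<Rightarrow> 'n distr) g. (\<forall>i. F i \<in> Hm1) \<and> g \<in> L2 \<longrightarrow>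
      (\<exists>u p. stokes_solution a F g u p \<and>
        (\<forall>v q. stokes_solution a F g v q \<longrightarrow>
          (AE x in lebesgue. v x = u x) \<and> (AE x in lebesgue. q x = p x)) \<and>
        norm_H1_vec u + norm_L2 p \<le> C * (norm_Hm1_vec F + norm_L2 g)))"
proof -
  \<comment> \<open>\<open>stokes_well_posed\<close> takes a nonnegative bound of the coefficients,
    hence the modulus of M. C is built from c, M and n before any tensor or data is chosen.\<close>
  define \<beta> where "\<beta> = real CARD('n) ^ 4 * \<bar>M\<bar>"
  define C where "C = (3 + \<beta>) * (2 * c * (3 + \<beta>) + 1) + 3"
  have "\<beta> \<ge> 0" by (simp add: \<beta>_def)
  then have "C > 0" using assms(2) by (simp add: C_def add_nonneg_pos)
  moreover have "\<exists>u p. stokes_solution a F g u p \<and>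
        (\<forall>v q. stokes_solution a F g v q \<longrightarrow>
          (AE x in lebesgue. v x = u x) \<and> (AE x in lebesgue. q x = p x)) \<and>
        norm_H1_vec u + norm_L2 p \<le> C * (norm_Hm1_vec F + norm_L2 g)"
    if a: "viscosity_tensor c a" "\<forall>i j \<alpha> \<beta>. Linf_bounded_by M (a i j \<alpha> \<beta>)"
      and Fg: "\<forall>i. F i \<in> Hm1" "g \<in> L2"
    for a :: "'n tensor" and F :: "'n \<Rightarrow> 'n distr" and g
  proof -
    have "Linf_bounded_by \<bar>M\<bar> (a i j \<alpha> \<beta>)" for i j \<alpha> \<beta>
    proof -
      have *: "Linf_bounded_by M (a i j \<alpha> \<beta>)" using a(2) by blast
      then have "AE x in lebesgue. \<bar>a i j \<alpha> \<beta> x\<bar> \<le> M" by (simp add: Linf_bounded_by_def)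
      then have "AE x in lebesgue. \<bar>a i j \<alpha> \<beta> x\<bar> \<le> \<bar>M\<bar>" by eventually_elim simp
      then show ?thesis using * by (simp add: Linf_bounded_by_def)
    qed
    from stokes_well_posed[OF a(1) abs_ge_zero this assms(1) _ Fg(2), of F] show ?thesis
      using Fg(1) unfolding C_def \<beta>_def by blast
  qed
  ultimately show ?thesis by blast
qed

end
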